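(* Let $r,\ell$ be positive integers, let $A=(a_{ij})_{i\in[\ell],\,j\in[r]}$ be an $\ell\times r$ matrix with non-negative integer entries having no zero row and no zero column, and let ${\bf h}=(h_1,\dots,h_r)\in\mathbb{N}^r$, ${\bf k}=(k_1,\dots,k_\ell)\in\mathbb{N}^\ell$ (with $\mathbb{N}=\{1,2,\dots\}$). Assume that for every subset $J\subset[r]$ (with $\bar J=[r]\setminus J$) the series $$\sum_{\substack{m_1,\dots,m_r\ge 1\\ \sum_{j\in J}a_{ij}m_j-\sum_{j\in\bar J}a_{ij}m_j\neq 0\ (i\in[\ell])}}\ \prod_{j\in[r]}\frac{1}{m_j^{h_j}}\prod_{i\in[\ell]}\frac{1}{\bigl|\sum_{j\in J}a_{ij}m_j-\sum_{j\in\bar J}a_{ij}m_j\bigr|^{k_i}}$$ converges. Then for every ${\bf y}\in\mathbb{R}^r$, $$\zeta_{r,\ell}({\bf h},{\bf k},{\bf y},A)+(-1)^{\mathrm{wt}({\bf h})+\mathrm{wt}({\bf k})+r+1}\zeta_{r,\ell}({\bf h},{\bf k},-{\bf y},A)=\sum_{\emptyset\neq J\subset[r]}T_{r,\ell,J}({\bf h},{\bf k},{\bf y},A),$$ where, for nonempty $J\subset[r]$ with $I=I_J$, $\bar I=[\ell]\setminus I_J$, $$T_{r,\ell,J}({\bf h},{\bf k},{\bf y},A):=(-1)^{\mathrm{wt}({\bf h}_{\bar J})+\mathrm{wt}({\bf k}_{\bar I})+r+|I|}\sum_{\substack{m_j\ge1\\ j\in\bar J}}\ \prod_{j\in\bar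 J}\frac{e(-m_jy_j)}{m_j^{h_j}}\prod_{i\in\bar I}\frac{1}{(\sum_{j\in\bar J}a_{ij}m_j)^{k_i}}\; D({\bf h}_J,{\bf k}_I,{\bf y}_J;\Lambda_J)\prod_{j\in J}\frac{1}{h_j!}\prod_{i\in I}\frac{1}{k_i!}$$ (when $J=[r]$ the sum over $\bar J$ is empty and consists of the single term with empty products equal to $1$).
   Context: Notation: $[m]=\{1,\dots,m\}$, $e(\alpha)=\exp(2\pi\sqrt{-1}\alpha)$, $\{x\}=x-\lfloor x\rfloor$. For a tuple ${\bf h}=(h_1,\dots,h_r)$ and $J\subset[r]$, ${\bf h}_J=(h_j)_{j\in J}$ and $\mathrm{wt}({\bf h}_J)=\sum_{j\in J}h_j$ (zero for $J=\emptyset$); $\mathrm{wt}({\bf h})=\sum_j h_j$. The series is $$\zeta_{r,\ell}({\bf h},{\bf k},{\bf y},A)=\sum_{m_1=1}^\infty\cdots\sum_{m_r=1}^\infty\prod_{j\in[r]}\frac{e(m_jy_j)}{m_j^{h_j}}\prod_{i\in[\ell]}\frac{1}{(a_{i1}m_1+\dots+a_{ir}m_r)^{k_i}},$$ and $-{\bf y}=(-y_1,\dots,-y_r)$. For nonempty $J\subset[r]$: $I_J=\{i\in[\ell]: a_{ij}\neq0\text{ for some }j\in J\}$. Write elements of $\mathbb{R}^{|J|}\times\mathbb{C}$ as $f=(\vec f,\dot f)$. Fix $m_j\in\mathbb{N}$ for $j\in\bar J$ (the $m_j$ of the outer sum in $T$) and put $f_j=((\delta_{jk})_{k\in J},0)$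 for $j\in J$, $f_{r+i}=((a_{ij})_{j\in J},-\sum_{j\in\bar J}a_{ij}m_j)$ for $i\in I_J$, and $\Lambda=\Lambda_J=\{f_j,f_{r+i}: j\in J,\ i\in I_J\}$ (indexed family, with variable $t_k$ attached to $f_k$; write $t_f$). Let $m=|J|$. $\mathscr{B}(\Lambda)$ is the set of subsets $B\subset\Lambda$ such that $\vec B$ is a basis of $\mathbb{R}^m$; for such $B$ and $f\in B$, $\vec f^B$ denotes the element of the dual basis of $\vec B$ (w.r.t. the standard inner product $\langle\cdot,\cdot\rangle$) with $\langle\vec g,\vec f^B\rangle=\delta_{gf}$ for $g\in B$. Fix $\rho\in\mathbb{R}^m$ not lying in $\sum_{g\in R}\mathbb{R}\vec g$ for any $R\subset\Lambda$ consisting of $m-1$ elements with linearly independent $\vec g$'s, and with $\langle\rho,\vec f^B\rangle\neq0$ for all $B\in\mathscr{B}(\Lambda)$, $f\in B$. For ${\bf y}\in\mathbb{R}^m$ set $\{{\bf y}\}_{B,f}=\{\langle{\bf y},\vec f^B\rangle\}$ if $\langle\rho,\vec f^B\rangle>0$ and $=1-\{-\langle{\bf y},\vec f^B\rangle\}$ if $\langle\rho,\vec f^B\rangle<0$. Define $$G({\bf t}_\Lambda,{\bf y}_J;\Lambda)=\sum_{B\in\mathscr{B}(\Lambda)}\Bigl(\prod_{g\in\Lambda\setminus B}\frac{-t_g}{\dot g-\sum_{f\in B}\dot f\langle\vec g,\vec f^B\rangle-(t_g-\sum_{f\in B}t_f\langle\vec g,\vec f^B\rangle)}\Bigr)\frac{1}{|\mathbb{Z}^m/\langle\vec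 B\rangle|}\sum_{{\bf w}\in\mathbb{Z}^m/\langle\vec B\rangle}\prod_{f\in B}\frac{2\pi\sqrt{-1}\,t_f\,e((t_f-\dot f)\{{\bf y}_J+{\bf w}\}_{B,f})}{e(t_f)-1},$$ where $\langle\vec B\rangle$ is the lattice generated by $\vec B$ and ${\bf w}$ runs over coset representatives. $D({\bf h}_J,{\bf k}_I,{\bf y}_J;\Lambda)$ is defined by the Taylor expansion around ${\bf t}_\Lambda=0$: $G({\bf t}_\Lambda,{\bf y}_J;\Lambda)=\sum_{{\bf h}_J\in\mathbb{N}_0^{|J|},{\bf k}_I\in\mathbb{N}_0^{|I|}}D({\bf h}_J,{\bf k}_I,{\bf y}_J;\Lambda)\prod_{j\in J}\frac{t_j^{h_j}}{h_j!}\prod_{i\in I}\frac{t_{r+i}^{k_i}}{k_i!}$. *)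

theory Defs
  imports "HOL-Analysis.Analysis" "HOL-Library.Function_Algebras"
begin

(* The dimension |J| varies with J inside the statement, so R^|J| is rendered as the
   subspace of nat => real of all functions vanishing outside J.  The pointwise
   real_vector structure on functions makes the library notions independent and span
   available for it. *)

instantiation "fun" :: (type, real_vector) real_vector
begin

definition scaleR_fun :: "real \<Rightarrow> ('a \<Rightarrow> 'b) \<Rightarrow> 'a \<Rightarrow> 'b"
  where "scaleR_fun c v = (\<lambda>x. c *\<^sub>R v x)"

instance
  by standard (auto simp: scaleR_fun_def fun_eq_iff scaleR_add_right scaleR_add_left)

end

definition coord_space :: "nat set \<Rightarrow> (nat \<Rightarrow> real) set"
  where "coord_space J = {v. \<forall>x. x \<notin> J \<longrightarrow> v x = 0}"

definition coord_lattice :: "nat set \<Rightarrow> (nat \<Rightarrow> real) set"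
  where "coord_lattice J = {v \<in> coord_space J. \<forall>x. v x \<in> \<int>}"

definition coord_proj :: "nat set \<Rightarrow> (nat \<Rightarrow> real) \<Rightarrow> nat \<Rightarrow> real"
  where "coord_proj J v = (\<lambda>x. if x \<in> J then v x else 0)"

definition coord_inner :: "nat set \<Rightarrow> (nat \<Rightarrow> real) \<Rightarrow> (nat \<Rightarrow> real) \<Rightarrow> real"
  where "coord_inner J u v = (\<Sum>x\<in>J. u x * v x)"

definition expi :: "complex \<Rightarrow> complex"
  where "expi z = exp (2 * of_real pi * \<i> * z)"

definition pos_tuples :: "nat set \<Rightarrow> (nat \<Rightarrow> nat) set"
  where "pos_tuples S = (S \<rightarrow>\<^sub>E {1..})"

definition zeta_rl ::
  "nat \<Rightarrow> nat \<Rightarrow> (nat \<Rightarrow> nat) \<Rightarrow> (nat \<Rightarrow> nat) \<Rightarrow> (nat \<Rightarrow> real) \<Rightarrow> (nat \<Rightarrow> nat \<Rightarrow> nat) \<Rightarrow> complex"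
  where "zeta_rl r l h k y A =
    (\<Sum>\<^sub>\<infinity>m\<in>pos_tuples {1..r}.
       (\<Prod>j\<in>{1..r}. expi (of_real (real (m j) * y j)) / of_nat (m j) ^ h j) *
       (\<Prod>i\<in>{1..l}. 1 / of_nat (\<Sum>j\<in>{1..r}. A i j * m j) ^ k i))"

definition signed_form ::
  "nat \<Rightarrow> (nat \<Rightarrow> nat \<Rightarrow> nat) \<Rightarrow> nat set \<Rightarrow> nat \<Rightarrow> (nat \<Rightarrow> nat) \<Rightarrow> real"
  where "signed_form r A J i m =
    (\<Sum>j\<in>J. real (A i j) * real (m j)) - (\<Sum>j\<in>{1..r} - J. real (A i j) * real (m j))"

definition rows_meeting :: "nat \<Rightarrow> (nat \<Rightarrow> nat \<Rightarrow> nat) \<Rightarrow> nat set \<Rightarrow> nat set"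
  where "rows_meeting l A J = {i \<in> {1..l}. \<exists>j\<in>J. A i j \<noteq> 0}"

(* A family Lambda in R^|J| x C is a finite index set L with F :: index => vector x complex;
   subsets of Lambda are subsets of L.  Vectors with different indices may coincide, hence the
   injectivity requirement.  The index Inl j belongs to f_j and Inr i to f_{r+i}. *)

type_synonym idx = "nat + nat"
type_synonym family = "idx \<Rightarrow> (nat \<Rightarrow> real) \<times> complex"

abbreviation vec_of :: "family \<Rightarrow> idx \<Rightarrow> nat \<Rightarrow> real"
  where "vec_of F f \<equiv> fst (F f)"

abbreviation dot_of :: "family \<Rightarrow> idx \<Rightarrow> complex"
  where "dot_of F f \<equiv> snd (F f)"

definition Lambda_idx :: "nat \<Rightarrow> (nat \<Rightarrow> nat \<Rightarrow> nat) \<Rightarrow> nat set \<Rightarrow> idx set"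
  where "Lambda_idx l A J = J <+> rows_meeting l A J"

definition Lambda_fam ::
  "nat \<Rightarrow> (nat \<Rightarrow> nat \<Rightarrow> nat) \<Rightarrow> nat set \<Rightarrow> (nat \<Rightarrow> nat) \<Rightarrow> family"
  where "Lambda_fam r A J m f =
    (case f of
       Inl j \<Rightarrow> (coord_proj J (\<lambda>x. if x = j then 1 else 0), 0)
     | Inr i \<Rightarrow> (coord_proj J (\<lambda>x. real (A i x)),
                - of_nat (\<Sum>j\<in>{1..r} - J. A i j * m j)))"

definition bases :: "nat set \<Rightarrow> idx set \<Rightarrow> family \<Rightarrow> idx set set"
  where "bases J L F =
    {B. B \<subseteq> L \<and> inj_on (vec_of F) B \<and> independent (vec_of F ` B) \<and>
        span (vec_of F ` B) = coord_space J}"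

definition dual_vec :: "nat set \<Rightarrow> family \<Rightarrow> idx set \<Rightarrow> idx \<Rightarrow> nat \<Rightarrow> real"
  where "dual_vec J F B f =
    (THE v. v \<in> coord_space J \<and>
       (\<forall>g\<in>B. coord_inner J (vec_of F g) v = (if g = f then 1 else 0)))"

definition generic :: "nat set \<Rightarrow> idx set \<Rightarrow> family \<Rightarrow> (nat \<Rightarrow> real) \<Rightarrow> bool"
  where "generic J L F \<rho> \<longleftrightarrow>
    \<rho> \<in> coord_space J \<and>
    (\<forall>R. R \<subseteq> L \<and> card R = card J - 1 \<and> inj_on (vec_of F) R \<and> independent (vec_of F ` R)
         \<longrightarrow> \<rho> \<notin> span (vec_of F ` R)) \<and>
    (\<forall>B\<in>bases J L F. \<forall>f\<in>B. coord_inner J \<rho> (dual_vec J F B f) \<noteq> 0)"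

definition frac_part ::
  "nat set \<Rightarrow> family \<Rightarrow> (nat \<Rightarrow> real) \<Rightarrow> idx set \<Rightarrow> idx \<Rightarrow> (nat \<Rightarrow> real) \<Rightarrow> real"
  where "frac_part J F \<rho> B f y =
    (if coord_inner J \<rho> (dual_vec J F B f) > 0
     then frac (coord_inner J y (dual_vec J F B f))
     else 1 - frac (- coord_inner J y (dual_vec J F B f)))"

definition gen_lattice :: "family \<Rightarrow> idx set \<Rightarrow> (nat \<Rightarrow> real) set"
  where "gen_lattice F B = {v. \<exists>c :: idx \<Rightarrow> int. v = (\<Sum>f\<in>B. of_int (c f) *\<^sub>R vec_of F f)}"

definition cosets :: "nat set \<Rightarrow> family \<Rightarrow> idx set \<Rightarrow> (nat \<Rightarrow> real) set set"
  where "cosets J F B =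
    coord_lattice J //
      {(u, v). u \<in> coord_lattice J \<and> v \<in> coord_lattice J \<and> u - v \<in> gen_lattice F B}"

definition G_denom :: "nat set \<Rightarrow> family \<Rightarrow> (idx \<Rightarrow> complex) \<Rightarrow> idx set \<Rightarrow> idx \<Rightarrow> complex"
  where "G_denom J F t B g =
    dot_of F g
      - (\<Sum>f\<in>B. dot_of F f * of_real (coord_inner J (vec_of F g) (dual_vec J F B f)))
      - (t g - (\<Sum>f\<in>B. t f * of_real (coord_inner J (vec_of F g) (dual_vec J F B f))))"

definition G_fun ::
  "nat set \<Rightarrow> idx set \<Rightarrow> family \<Rightarrow> (nat \<Rightarrow> real) \<Rightarrow> (nat \<Rightarrow> real) \<Rightarrow> (idx \<Rightarrow> complex) \<Rightarrow> complex"
  where "G_fun J L F \<rho> y t =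
    (\<Sum>B\<in>bases J L F.
       (\<Prod>g\<in>L - B. - t g / G_denom J F t B g) *
       (1 / of_nat (card (cosets J F B))) *
       (\<Sum>W\<in>cosets J F B.
          let w = (SOME w. w \<in> W) in
          \<Prod>f\<in>B. 2 * of_real pi * \<i> * t f *
                  expi ((t f - dot_of F f) * of_real (frac_part J F \<rho> B f (y + w)))
                  / (expi (t f) - 1)))"

(* The formula for G has removable singularities through t = 0: at integral t_f, and where
   one of the linear denominators vanishes. Its Taylor expansion is therefore the power series that
   represents G at all sufficiently small t at which every denominator is nonzero; these t
   are dense near 0, so the coefficients are unique. *)

definition regular_point :: "nat set \<Rightarrow> idx set \<Rightarrow> family \<Rightarrow> (idx \<Rightarrow> complex) \<Rightarrow> bool"
  where "regular_point J L F t \<longleftrightarrow>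
    (\<forall>B\<in>bases J L F. (\<forall>f\<in>B. expi (t f) \<noteq> 1) \<and> (\<forall>g\<in>L - B. G_denom J F t B g \<noteq> 0))"

definition multi_indices :: "idx set \<Rightarrow> (idx \<Rightarrow> nat) set"
  where "multi_indices L = (L \<rightarrow>\<^sub>E UNIV)"

definition taylor_coeffs ::
  "nat set \<Rightarrow> idx set \<Rightarrow> family \<Rightarrow> (nat \<Rightarrow> real) \<Rightarrow> (nat \<Rightarrow> real) \<Rightarrow> ((idx \<Rightarrow> nat) \<Rightarrow> complex) \<Rightarrow> bool"
  where "taylor_coeffs J L F \<rho> y c \<longleftrightarrow>
    (\<exists>\<epsilon>>0. \<forall>t. (\<forall>f\<in>L. norm (t f) < \<epsilon>) \<and> regular_point J L F t \<longrightarrow>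
       ((\<lambda>n. c n * (\<Prod>f\<in>L. t f ^ n f / fact (n f))) has_sum G_fun J L F \<rho> y t)
         (multi_indices L))"

definition D_coeff ::
  "nat set \<Rightarrow> idx set \<Rightarrow> family \<Rightarrow> (nat \<Rightarrow> real) \<Rightarrow> (nat \<Rightarrow> real) \<Rightarrow> (idx \<Rightarrow> nat) \<Rightarrow> complex"
  where "D_coeff J L F \<rho> y n = (THE d. \<exists>c. taylor_coeffs J L F \<rho> y c \<and> d = c n)"

(* \<rho> may depend on the outer summation variables m, because Lambda does. *)

definition T_term ::
  "nat \<Rightarrow> nat \<Rightarrow> nat set \<Rightarrow> (nat \<Rightarrow> nat) \<Rightarrow> (nat \<Rightarrow> nat) \<Rightarrow> (nat \<Rightarrow> real) \<Rightarrow> (nat \<Rightarrow> nat \<Rightarrow> nat)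
    \<Rightarrow> ((nat \<Rightarrow> nat) \<Rightarrow> nat \<Rightarrow> real) \<Rightarrow> (nat \<Rightarrow> nat) \<Rightarrow> complex"
  where "T_term r l J h k y A \<rho> m =
    (let I = rows_meeting l A J; L = Lambda_idx l A J in
       (\<Prod>j\<in>{1..r} - J. expi (- of_real (real (m j) * y j)) / of_nat (m j) ^ h j) *
       (\<Prod>i\<in>{1..l} - I. 1 / of_nat (\<Sum>j\<in>{1..r} - J. A i j * m j) ^ k i) *
       D_coeff J L (Lambda_fam r A J m) (\<rho> m) (coord_proj J y) (restrict (case_sum h k) L) *
       (\<Prod>j\<in>J. 1 / fact (h j)) * (\<Prod>i\<in>I. 1 / fact (k i)))"

definition T_sum ::
  "nat \<Rightarrow> nat \<Rightarrow> nat set \<Rightarrow> (nat \<Rightarrow> nat) \<Rightarrow> (nat \<Rightarrow> nat) \<Rightarrow> (nat \<Rightarrow> real) \<Rightarrow> (nat \<Rightarrow> nat \<Rightarrow> nat)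
    \<Rightarrow> ((nat \<Rightarrow> nat) \<Rightarrow> nat \<Rightarrow> real) \<Rightarrow> complex"
  where "T_sum r l J h k y A \<rho> =
    (let I = rows_meeting l A J in
       (-1) ^ ((\<Sum>j\<in>{1..r} - J. h j) + (\<Sum>i\<in>{1..l} - I. k i) + r + card I) *
       (\<Sum>\<^sub>\<infinity>m\<in>pos_tuples ({1..r} - J). T_term r l J h k y A \<rho> m))"

end

(* A family of linear forms f on Z^J with variables t_f is encoded by the sum over v of
   e(<v,y>) prod_f (-t_f) / (f(v) - t_f): its Taylor coefficients at exponents n_f >= 1 are, up to sign,
   the sums over v of e(<v,y>) prod_f f(v)^(-n_f). Partial fractions turn the product over the family
   into a combination over bases B of products over B, and averaging characters of Z^J / <B> splits the
   sum over Z^J of a product over B into one-variable Lerch sums, which gives the formula for G.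

   The basis sums converge only conditionally, so they are weighted by Fejer weights in the
   coordinates of v. For y off the walls the weighted sums converge to G on a torus of small radii on
   which no denominator of G vanishes; Cauchy's estimate on that torus carries the convergence over to the
   Taylor coefficients and removes the singularities of G at 0. A point y on a wall is approached along rho.
   The parity identity is then inclusion-exclusion over the signs of the coordinates in Z^r. *)

theory Submission
  imports Defs "HOL-Library.Diagonal_Subsequence"
begin

section \<open>Dual bases\<close>

text \<open>Two demands on the weights conflict. A sum over a basis B factors into one-variable
  Lerch sums only if the weights are placed on the forms of B, whereas partial fractions can be
  summed over all B only if the weights do not depend on B. Hence there are two kinds of means:
  \<open>fejer_sum\<close>, weighted in the forms of B, and \<open>box_sum\<close>, weighted in the
  coordinates of v. They are linked by the fact that a weight in v is a convolution in y with the
  Fejer kernel. Sampled on a fine enough finite grid this convolution is exact, so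
  \<open>double_sum\<close>, which carries both weights, is a convex combination of translates of
  \<open>fejer_sum\<close>. Positivity and total mass 1 of the kernel then give bounds that depend
  neither on the cutoff nor on y, and Cauchy's estimate needs exactly these.

  A vanishing form causes no trouble: its factor -t / (0 - t) is the constant 1, which has no
  coefficient at exponents \<ge> 1. At exponents where the lattice sum converges absolutely the
  weights are removed by dominated convergence; the other coefficients are obtained only by
  compactness.\<close>

lemma sum_fun_apply: "(\<Sum>a\<in>S. f a) x = (\<Sum>a\<in>S. f a x)"
  for f :: "'a \<Rightarrow> 'b \<Rightarrow> 'c::comm_monoid_add"
  by (induction S rule: infinite_finite_induct) auto

lemma scaleR_fun_apply [simp]: "(c *\<^sub>R v) x = c *\<^sub>R v x" for v :: "'a \<Rightarrow> 'b::real_vector"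
  by (simp add: scaleR_fun_def)

lemma subspace_coord_space: "subspace (coord_space J)"
  by (auto simp: subspace_def coord_space_def)

lemma coord_inner_add_left: "coord_inner J (u + v) w = coord_inner J u w + coord_inner J v w"
  by (simp add: coord_inner_def sum.distrib algebra_simps)

lemma coord_inner_diff_left: "coord_inner J (u - v) w = coord_inner J u w - coord_inner J v w"
  by (simp add: coord_inner_def sum_subtractf algebra_simps)

lemma coord_inner_scaleR_left: "coord_inner J (c *\<^sub>R u) w = c * coord_inner J u w"
  by (simp add: coord_inner_def sum_distrib_left algebra_simps)

lemma coord_inner_commute: "coord_inner J u v = coord_inner J v u"
  by (simp add: coord_inner_def mult.commute)

lemma coord_inner_sum_left: "coord_inner J (\<Sum>a\<in>S. f a) w = (\<Sum>a\<in>S. coord_inner J (f a) w)"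
  unfolding coord_inner_def sum_fun_apply sum_distrib_right by (rule sum.swap)

lemmas coord_inner_left =
  coord_inner_add_left coord_inner_diff_left coord_inner_scaleR_left coord_inner_sum_left

lemma coord_inner_right:
  "coord_inner J w (u + v) = coord_inner J w u + coord_inner J w v"
  "coord_inner J w (u - v) = coord_inner J w u - coord_inner J w v"
  "coord_inner J w (c *\<^sub>R u) = c * coord_inner J w u"
  "coord_inner J w (\<Sum>a\<in>S. f a) = (\<Sum>a\<in>S. coord_inner J w (f a))"
  by (simp_all only: coord_inner_commute[of J w] coord_inner_left)

definition unitv :: "nat \<Rightarrow> nat \<Rightarrow> real"
  where "unitv x = (\<lambda>i. if i = x then 1 else 0)"

lemma unitv_in_space: "x \<in> J \<Longrightarrow> unitv x \<in> coord_space J"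
  by (auto simp: unitv_def coord_space_def)

lemma coord_inner_unitv: "finite J \<Longrightarrow> x \<in> J \<Longrightarrow> coord_inner J (unitv x) v = v x"
proof -
  assume "finite J" "x \<in> J"
  have "coord_inner J (unitv x) v = (\<Sum>i\<in>J. if i = x then v i else 0)"
    by (auto simp: coord_inner_def unitv_def intro!: sum.cong)
  then show ?thesis using \<open>finite J\<close> \<open>x \<in> J\<close> by simp
qed

lemma unitv_expansion:
  assumes "finite J" "u \<in> coord_space J"
  shows "u = (\<Sum>x\<in>J. u x *\<^sub>R unitv x)"
proof
  fix i
  have "(\<Sum>x\<in>J. u x *\<^sub>R unitv x) i = (\<Sum>x\<in>J. if x = i then u x else 0)"
    by (auto simp: sum_fun_apply unitv_def intro!: sum.cong)
  then show "u i = (\<Sum>x\<in>J. u x *\<^sub>R unitv x) i"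
    using assms by (auto simp: coord_space_def)
qed

lemma coord_inner_nondegenerate:
  assumes "finite J" "u \<in> coord_space J" "v \<in> coord_space J"
    and "\<And>w. w \<in> coord_space J \<Longrightarrow> coord_inner J w u = coord_inner J w v"
  shows "u = v"
proof
  fix x
  show "u x = v x"
    using assms(2,3) assms(4)[of "unitv x"] coord_inner_unitv[OF assms(1), of x]
      unitv_in_space[of x J]
    by (cases "x \<in> J") (simp_all add: coord_space_def)
qed

locale family_basis =
  fixes J :: "nat set" and F :: family and B :: "idx set"
  assumes finite_J: "finite J" and finite_B: "finite B"
    and inj_vec: "inj_on (vec_of F) B"
    and indep_vec: "independent (vec_of F ` B)"
    and span_vec: "span (vec_of F ` B) = coord_space J"
begin

abbreviation dual :: "idx \<Rightarrow> nat \<Rightarrow> real" where "dual \<equiv> dual_vec J F B"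
abbreviation coord :: "(nat \<Rightarrow> real) \<Rightarrow> idx \<Rightarrow> real"
  where "coord u f \<equiv> coord_inner J u (dual f)"

lemma vec_in_space: "f \<in> B \<Longrightarrow> vec_of F f \<in> coord_space J"
  using span_base[of "vec_of F f" "vec_of F ` B"] by (simp add: span_vec)

lemma eq_if_inner_eq:
  assumes "u \<in> coord_space J" "v \<in> coord_space J"
    and "\<And>g. g \<in> B \<Longrightarrow> coord_inner J (vec_of F g) u = coord_inner J (vec_of F g) v"
  shows "u = v"
proof (rule coord_inner_nondegenerate[OF finite_J assms(1,2)])
  fix w assume "w \<in> coord_space J"
  then have "w \<in> span (vec_of F ` B)" by (simp add: span_vec)
  then show "coord_inner J w u = coord_inner J w v"
  proof (induction rule: span_induct)
    case base
    show ?case by (auto simp: subspace_def coord_inner_left) (simp add: coord_inner_def)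
  qed (use assms(3) in auto)
qed

text \<open>The coordinate along \<open>vec_of F f\<close> is a linear functional on
  \<open>coord_space J\<close>; its values at the unit vectors are the components of the vector that
  represents it.\<close>

lemma dual_exists:
  assumes f: "f \<in> B"
  shows "\<exists>v \<in> coord_space J. \<forall>g\<in>B. coord_inner J (vec_of F g) v = (if g = f then 1 else 0)"
proof -
  define v where "v = (\<lambda>x. if x \<in> J then representation (vec_of F ` B) (unitv x) (vec_of F f) else 0)"
  have inner: "coord_inner J u v = representation (vec_of F ` B) u (vec_of F f)"
    if u: "u \<in> coord_space J" for u
  proof -
    have sp: "u x *\<^sub>R unitv x \<in> span (vec_of F ` B)" if "x \<in> J" for x
      using unitv_in_space[OF that] by (simp add: span_vec subspace_coord_space subspace_scale)
    have "representation (vec_of F ` B) u (vec_of F f)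
        = representation (vec_of F ` B) (\<Sum>x\<in>J. u x *\<^sub>R unitv x) (vec_of F f)"
      using unitv_expansion[OF finite_J u] by simp
    also have "\<dots> = (\<Sum>x\<in>J. representation (vec_of F ` B) (u x *\<^sub>R unitv x) (vec_of F f))"
      using sp by (subst representation_sum[OF indep_vec]) (auto simp: sum_fun_apply)
    also have "\<dots> = (\<Sum>x\<in>J. u x * representation (vec_of F ` B) (unitv x) (vec_of F f))"
      using unitv_in_space by (intro sum.cong refl, subst representation_scale[OF indep_vec]) (auto simp: span_vec)
    also have "\<dots> = coord_inner J u v" by (simp add: coord_inner_def v_def)
    finally show ?thesis by simp
  qed
  have "coord_inner J (vec_of F g) v = (if g = f then 1 else 0)" if "g \<in> B" for g
    using that f inj_vec inner[OF vec_in_space[OF that]]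
    by (subst inner) (auto simp: vec_in_space inj_on_def representation_basis[OF indep_vec])
  moreover have "v \<in> coord_space J" by (auto simp: v_def coord_space_def)
  ultimately show ?thesis by blast
qed

lemma dual_unique:
  assumes "v \<in> coord_space J"
    and "\<And>g. g \<in> B \<Longrightarrow> coord_inner J (vec_of F g) v = (if g = f then 1 else 0)"
  shows "dual f = v"
  unfolding dual_vec_def
proof (rule the_equality)
  fix w assume w: "w \<in> coord_space J \<and>
    (\<forall>g\<in>B. coord_inner J (vec_of F g) w = (if g = f then 1 else 0))"
  show "w = v"
    by (rule eq_if_inner_eq) (use w assms in auto)
qed (use assms in auto)

lemma
  assumes "f \<in> B"
  shows dual_in_space: "dual f \<in> coord_space J"
    and coord_vec: "g \<in> B \<Longrightarrow> coord (vec_of F g) f = (if g = f then 1 else 0)"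
proof -
  obtain v where "v \<in> coord_space J"
    "\<forall>g\<in>B. coord_inner J (vec_of F g) v = (if g = f then 1 else 0)"
    using dual_exists[OF assms] by blast
  moreover from this have "dual f = v" by (intro dual_unique) auto
  ultimately show "dual f \<in> coord_space J"
    "g \<in> B \<Longrightarrow> coord (vec_of F g) f = (if g = f then 1 else 0)" by auto
qed

lemma sum_coord_vec:
  assumes "f \<in> B"
  shows "coord (\<Sum>g\<in>B. a g *\<^sub>R vec_of F g) f = a f"
proof -
  have "coord (\<Sum>g\<in>B. a g *\<^sub>R vec_of F g) f = (\<Sum>g\<in>B. if g = f then a g else 0)"
    using assms by (auto simp: coord_inner_left coord_vec intro!: sum.cong)
  then show ?thesis using assms finite_B by simp
qed

lemma expansion:
  assumes "u \<in> coord_space J"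
  shows "u = (\<Sum>f\<in>B. coord u f *\<^sub>R vec_of F f)"
proof -
  from assms have "u \<in> span (vec_of F ` B)" by (simp add: span_vec)
  then obtain b where "u = (\<Sum>x\<in>vec_of F ` B. b x *\<^sub>R x)"
    using finite_B by (auto simp: span_finite)
  then have u: "u = (\<Sum>f\<in>B. b (vec_of F f) *\<^sub>R vec_of F f)"
    by (simp add: sum.reindex[OF inj_vec])
  have "coord u f = b (vec_of F f)" if "f \<in> B" for f
    using sum_coord_vec[OF that, of "\<lambda>f. b (vec_of F f)"] u by simp
  then show ?thesis using u by (metis (no_types, lifting) sum.cong)
qed

lemma dual_expansion:
  assumes "v \<in> coord_space J"
  shows "v = (\<Sum>f\<in>B. coord_inner J (vec_of F f) v *\<^sub>R dual f)"
proof (rule eq_if_inner_eq[OF assms])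
  show "(\<Sum>f\<in>B. coord_inner J (vec_of F f) v *\<^sub>R dual f) \<in> coord_space J"
    using dual_in_space by (intro subspace_sum subspace_scale subspace_coord_space)
next
  fix g assume "g \<in> B"
  then have "coord_inner J (vec_of F g) (\<Sum>f\<in>B. coord_inner J (vec_of F f) v *\<^sub>R dual f)
     = (\<Sum>f\<in>B. if f = g then coord_inner J (vec_of F f) v else 0)"
    by (auto simp: coord_inner_right coord_vec intro!: sum.cong)
  then show "coord_inner J (vec_of F g) v =
      coord_inner J (vec_of F g) (\<Sum>f\<in>B. coord_inner J (vec_of F f) v *\<^sub>R dual f)"
    using \<open>g \<in> B\<close> finite_B by simp
qed

end

text \<open>Recognises a basis from a candidate dual system \<open>\<phi>\<close>: biorthogonality
  forces injectivity and independence, the expansion forces spanning. This suits the exchange step,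
  where the new dual vectors are explicit.\<close>

lemma family_basisI:
  assumes "finite J" "finite B"
    and sp: "\<And>f. f \<in> B \<Longrightarrow> vec_of F f \<in> coord_space J"
    and dual: "\<And>f g. f \<in> B \<Longrightarrow> g \<in> B \<Longrightarrow> coord_inner J (vec_of F g) (\<phi> f) = (if g = f then 1 else 0)"
    and expansion: "\<And>u. u \<in> coord_space J \<Longrightarrow> u = (\<Sum>f\<in>B. coord_inner J u (\<phi> f) *\<^sub>R vec_of F f)"
  shows "family_basis J F B"
proof
  show inj: "inj_on (vec_of F) B"
    by (rule inj_onI) (metis dual zero_neq_one)
  show "independent (vec_of F ` B)"
  proof (rule independent_if_scalars_zero)
    fix a x assume 0: "(\<Sum>x\<in>vec_of F ` B. a x *\<^sub>R x) = 0" and "x \<in> vec_of F ` B"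
    then obtain g where g: "g \<in> B" "x = vec_of F g" by blast
    from 0 have "(\<Sum>f\<in>B. a (vec_of F f) *\<^sub>R vec_of F f) = 0"
      by (simp add: sum.reindex[OF inj])
    then have "0 = coord_inner J (\<Sum>f\<in>B. a (vec_of F f) *\<^sub>R vec_of F f) (\<phi> g)"
      by (simp add: coord_inner_def)
    also have "\<dots> = (\<Sum>f\<in>B. if f = g then a (vec_of F f) else 0)"
      using g by (auto simp: coord_inner_left dual intro!: sum.cong)
    finally show "a x = 0" using g \<open>finite B\<close> by simp
  qed (use \<open>finite B\<close> in auto)
  show "span (vec_of F ` B) = coord_space J"
  proof
    show "span (vec_of F ` B) \<subseteq> coord_space J"
      using sp by (intro span_minimal subspace_coord_space) auto
    show "coord_space J \<subseteq> span (vec_of F ` B)"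
    proof
      fix u assume "u \<in> coord_space J"
      then have "u = (\<Sum>f\<in>B. coord_inner J u (\<phi> f) *\<^sub>R vec_of F f)" by (rule expansion)
      also have "\<dots> \<in> span (vec_of F ` B)"
        by (intro span_sum span_scale span_base) auto
      finally show "u \<in> span (vec_of F ` B)" .
    qed
  qed
qed (use assms in auto)

text \<open>A pivot step: the coordinate functionals of the new basis come from the old ones by
  elimination with the pivot \<open>coord (vec_of F g) f\<close>. The formulas are stated on inner
  products because \<open>G_denom\<close> uses the dual vectors only in that way.\<close>

lemma (in family_basis) exchange:
  assumes f: "f \<in> B" and g: "g \<notin> B" and sp: "vec_of F g \<in> coord_space J"
    and nz: "coord (vec_of F g) f \<noteq> 0"
  defines "B' \<equiv> insert g (B - {f})"
  shows "family_basis J F B'"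
    and "coord_inner J u (dual_vec J F B' g) = coord u f / coord (vec_of F g) f"
    and "h \<in> B - {f} \<Longrightarrow> coord_inner J u (dual_vec J F B' h)
           = coord u h - coord (vec_of F g) h / coord (vec_of F g) f * coord u f"
proof -
  define \<phi> where "\<phi> h = (if h = g then (1 / coord (vec_of F g) f) *\<^sub>R dual f
     else dual h - (coord (vec_of F g) h / coord (vec_of F g) f) *\<^sub>R dual f)" for h
  have \<phi>: "coord_inner J u (\<phi> h) = (if h = g then coord u f / coord (vec_of F g) f
     else coord u h - coord (vec_of F g) h / coord (vec_of F g) f * coord u f)" for u h
    by (simp add: \<phi>_def coord_inner_right)
  have \<phi>_sp: "\<phi> h \<in> coord_space J" if "h \<in> B'" for h
    using that dual_in_space f unfolding \<phi>_def B'_def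
    by (auto intro!: subspace_diff subspace_scale subspace_coord_space)
  have sp': "vec_of F h \<in> coord_space J" if "h \<in> B'" for h
    using that sp vec_in_space by (auto simp: B'_def)
  have dual': "coord_inner J (vec_of F h') (\<phi> h) = (if h' = h then 1 else 0)"
    if "h \<in> B'" "h' \<in> B'" for h h'
    using that f g nz by (auto simp: \<phi> B'_def coord_vec)
  have exp': "u = (\<Sum>h\<in>B'. coord_inner J u (\<phi> h) *\<^sub>R vec_of F h)" if u: "u \<in> coord_space J" for u
  proof -
    \<comment> \<open>\<open>c\<close> is the coordinate of u along the new vector. With it the
      coefficient at f is 0, so the sum may be extended back over all of B.\<close>
    define c where "c = coord u f / coord (vec_of F g) f"
    have "(\<Sum>h\<in>B'. coord_inner J u (\<phi> h) *\<^sub>R vec_of F h) = 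
      c *\<^sub>R vec_of F g + (\<Sum>h\<in>B-{f}. (coord u h - coord (vec_of F g) h * c) *\<^sub>R vec_of F h)"
      unfolding B'_def using g finite_B
      by (subst sum.insert) (auto simp: \<phi> c_def intro!: sum.cong)
    also have "\<dots> = c *\<^sub>R vec_of F g + (\<Sum>h\<in>B. (coord u h - coord (vec_of F g) h * c) *\<^sub>R vec_of F h)"
      using f finite_B nz by (subst (2) sum.remove[of _ f]) (auto simp: c_def)
    also have "\<dots> = c *\<^sub>R vec_of F g + ((\<Sum>h\<in>B. coord u h *\<^sub>R vec_of F h) - 
        c *\<^sub>R (\<Sum>h\<in>B. coord (vec_of F g) h *\<^sub>R vec_of F h))"
      by (simp add: scaleR_left_diff_distrib sum_subtractf scaleR_sum_right mult.commute)
    also have "\<dots> = u" 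
      by (simp add: expansion[OF u, symmetric] expansion[OF sp, symmetric])
    finally show ?thesis by simp
  qed
  have fin': "finite B'" by (simp add: B'_def finite_B)
  interpret B': family_basis J F B'
    using family_basisI[OF finite_J fin' sp' dual' exp'] .
  show "family_basis J F B'" ..
  have eq: "dual_vec J F B' h = \<phi> h" if "h \<in> B'" for h
    using that dual' \<phi>_sp by (intro B'.dual_unique) auto
  show "coord_inner J u (dual_vec J F B' g) = coord u f / coord (vec_of F g) f"
    using eq[of g] by (simp add: B'_def \<phi>)
  show "h \<in> B - {f} \<Longrightarrow> coord_inner J u (dual_vec J F B' h)
           = coord u h - coord (vec_of F g) h / coord (vec_of F g) f * coord u f"
    using g eq[of h] by (auto simp: B'_def \<phi>)
qed

lemma bases_iff:
  assumes "finite J" "finite L"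
  shows "B \<in> bases J L F \<longleftrightarrow> B \<subseteq> L \<and> family_basis J F B"
  using assms finite_subset[of B L] by (auto simp: bases_def family_basis_def)

section \<open>Partial fractions\<close>

text \<open>Lagrange interpolation of the constant polynomial 1: the interpolant has degree at most
  \<open>card E - 1\<close> and agrees with 1 at the \<open>card E\<close> nodes
  \<open>z f\<close>.\<close>

lemma Lagrange_one:
  fixes z :: "'a \<Rightarrow> complex"
  assumes "finite E" "E \<noteq> {}" "inj_on z E"
  shows "(\<Sum>f\<in>E. \<Prod>g\<in>E-{f}. (x - z g) / (z f - z g)) = 1"
proof -
  define p where "p = (\<Sum>f\<in>E. \<Prod>g\<in>E-{f}. smult (1 / (z f - z g)) [:- z g, 1:])"
  have poly_p: "poly p x = (\<Sum>f\<in>E. \<Prod>g\<in>E-{f}. (x - z g) / (z f - z g))" for x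
    by (simp add: p_def poly_sum poly_prod diff_divide_distrib)
  have "p = 1"
  proof (rule poly_eqI_degree[where A = "z ` E"])
    fix w assume "w \<in> z ` E"
    then obtain e where e: "e \<in> E" "w = z e" by blast
    have "(\<Prod>g\<in>E-{f}. (z e - z g) / (z f - z g)) = (if f = e then 1 else 0)" if "f \<in> E" for f
    proof (cases "f = e")
      case True
      have "z e \<noteq> z g" if "g \<in> E - {e}" for g
        using that e inj_onD[OF assms(3), of e g] by auto
      then show ?thesis using True by (auto intro!: prod.neutral)
    next
      case False
      then show ?thesis using e assms(1) by (auto simp: prod_zero_iff)
    qed
    then have "poly p w = (\<Sum>f\<in>E. if f = e then 1 else 0)"
      unfolding poly_p e by (intro sum.cong refl) auto
    then show "poly p w = poly 1 w" using e assms(1) by simp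
  next
    have card: "card (z ` E) = card E" using assms(3) by (rule card_image)
    have "0 < card E" using assms by (simp add: card_gt_0_iff)
    then show "degree (1 :: complex poly) < card (z ` E)" by (simp add: card)
    have "degree (\<Prod>g\<in>E-{f}. smult (1 / (z f - z g)) [:- z g, 1:]) \<le> card E - 1" if "f \<in> E" for f
    proof -
      have "degree (\<Prod>g\<in>E-{f}. smult (1 / (z f - z g)) [:- z g, 1:])
          \<le> sum (degree \<circ> (\<lambda>g. smult (1 / (z f - z g)) [:- z g, 1:])) (E - {f})"
        using assms(1) by (intro degree_prod_sum_le) auto
      also have "\<dots> \<le> (\<Sum>g\<in>E-{f}. 1)" by (intro sum_mono) auto
      also have "\<dots> = card E - 1" using that assms(1) by simp
      finally show ?thesis .
    qed
    then have "degree p \<le> card E - 1"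
      unfolding p_def by (intro degree_sum_le assms)
    then show "degree p < card (z ` E)" using \<open>0 < card E\<close> by (simp add: card)
  qed
  then show ?thesis using poly_p[of x] by simp
qed

text \<open>Consider the affine functions \<open>\<beta> g + x * \<alpha> g\<close> of one parameter
  x. The zero of the f-th one is \<open>z f\<close>, and
  \<open>\<beta> g - \<alpha> g * \<beta> f / \<alpha> f\<close> is the value of the g-th one there.
  Functions with \<open>\<alpha> g = 0\<close> are constant, and what remains is the interpolation
  of 1 evaluated at x = 0.\<close>

lemma rank_one_partial_fractions:
  fixes \<alpha> \<beta> :: "'a \<Rightarrow> complex"
  assumes "finite K" and ex: "\<exists>f\<in>K. \<alpha> f \<noteq> 0" and \<beta>: "\<And>g. g \<in> K \<Longrightarrow> \<beta> g \<noteq> 0"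
    and nz: "\<And>f g. f \<in> K \<Longrightarrow> \<alpha> f \<noteq> 0 \<Longrightarrow> g \<in> K - {f} \<Longrightarrow> \<beta> g - \<alpha> g * \<beta> f / \<alpha> f \<noteq> 0"
  shows "(\<Sum>f\<in>{f\<in>K. \<alpha> f \<noteq> 0}. 1 / \<beta> f * (\<Prod>g\<in>K-{f}. 1 / (\<beta> g - \<alpha> g * \<beta> f / \<alpha> f)))
    = (\<Prod>g\<in>K. 1 / \<beta> g)"
proof -
  define E where "E = {f\<in>K. \<alpha> f \<noteq> 0}"
  define z where "z f = - \<beta> f / \<alpha> f" for f
  have E: "finite E" "E \<noteq> {}" "E \<subseteq> K" using assms by (auto simp: E_def)
  have D: "\<beta> g - \<alpha> g * \<beta> f / \<alpha> f = \<alpha> g * (z f - z g)" if "g \<in> E" for f g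
    using that by (simp add: E_def z_def field_simps)
  \<comment> \<open>Two equal nodes would make a denominator vanish that \<open>nz\<close>
    excludes.\<close>
  have inj: "inj_on z E"
  proof (rule inj_onI, rule ccontr)
    fix f g assume *: "f \<in> E" "g \<in> E" "z f = z g" "f \<noteq> g"
    then show False using nz[of f g] D[of g f] by (auto simp: E_def)
  qed
  have "1 / \<beta> f * (\<Prod>g\<in>K-{f}. 1 / (\<beta> g - \<alpha> g * \<beta> f / \<alpha> f))
      = (\<Prod>g\<in>K. 1 / \<beta> g) * (\<Prod>g\<in>E-{f}. (0 - z g) / (z f - z g))" if f: "f \<in> E" for f
  proof -
    have "f \<in> K" using f E by blast
    have "(\<Prod>g\<in>K-{f}. 1 / (\<beta> g - \<alpha> g * \<beta> f / \<alpha> f))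
       = (\<Prod>g\<in>K-{f}. 1 / \<beta> g * (if g \<in> E then (0 - z g) / (z f - z g) else 1))"
    proof (rule prod.cong[OF refl])
      fix g assume g: "g \<in> K - {f}"
      show "1 / (\<beta> g - \<alpha> g * \<beta> f / \<alpha> f) = 1 / \<beta> g * (if g \<in> E then (0 - z g) / (z f - z g) else 1)"
      proof (cases "g \<in> E")
        case True
        then have "- z g / \<beta> g = 1 / \<alpha> g" using \<beta>[of g] g by (simp add: z_def E_def)
        have "1 / (\<beta> g - \<alpha> g * \<beta> f / \<alpha> f) = (1 / \<alpha> g) / (z f - z g)"
          unfolding D[OF True] by simp
        then show ?thesis
          unfolding \<open>- z g / \<beta> g = 1 / \<alpha> g\<close>[symmetric] using True by simp
      next
        case False
        then show ?thesis using g by (auto simp: E_def)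
      qed
    qed
    also have "\<dots> = (\<Prod>g\<in>K-{f}. 1 / \<beta> g) * (\<Prod>g\<in>K-{f}. if g \<in> E then (0 - z g) / (z f - z g) else 1)"
      by (rule prod.distrib)
    also have "(\<Prod>g\<in>K-{f}. if g \<in> E then (0 - z g) / (z f - z g) else 1)
        = (\<Prod>g\<in>E-{f}. (0 - z g) / (z f - z g))"
      using E \<open>finite K\<close> by (intro prod.mono_neutral_cong_right) auto
    finally show ?thesis
      using \<open>f \<in> K\<close> \<open>finite K\<close> by (simp add: prod.remove[of K f "\<lambda>g. 1 / \<beta> g"])
  qed
  then have "(\<Sum>f\<in>E. 1 / \<beta> f * (\<Prod>g\<in>K-{f}. 1 / (\<beta> g - \<alpha> g * \<beta> f / \<alpha> f)))
      = (\<Prod>g\<in>K. 1 / \<beta> g) * (\<Sum>f\<in>E. \<Prod>g\<in>E-{f}. (0 - z g) / (z f - z g))"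
    by (simp add: sum_distrib_left)
  also have "(\<Sum>f\<in>E. \<Prod>g\<in>E-{f}. (0 - z g) / (z f - z g)) = 1"
    by (rule Lagrange_one[OF E(1,2) inj])
  finally show ?thesis by (simp add: E_def)
qed

definition shifted_form :: "nat set \<Rightarrow> family \<Rightarrow> (idx \<Rightarrow> complex) \<Rightarrow> (nat \<Rightarrow> real) \<Rightarrow> idx \<Rightarrow> complex"
  where "shifted_form J F t v g = of_real (coord_inner J (vec_of F g) v) + dot_of F g - t g"

context family_basis
begin

lemma G_denom_alt:
  "G_denom J F t B g = (dot_of F g - t g) - (\<Sum>f\<in>B. (dot_of F f - t f) * of_real (coord (vec_of F g) f))"
  by (simp add: G_denom_def algebra_simps sum_subtractf)

text \<open>Expressing the affine form of g through those of B leaves the constant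
  \<open>G_denom\<close>. So the denominators of G are the values of the remaining forms at the
  point where all shifted forms of B vanish.\<close>

lemma shifted_form_decomp:
  assumes "vec_of F g \<in> coord_space J"
  shows "shifted_form J F t v g
    = G_denom J F t B g + (\<Sum>f\<in>B. of_real (coord (vec_of F g) f) * shifted_form J F t v f)"
proof -
  have "coord_inner J (vec_of F g) v
      = coord_inner J (\<Sum>f\<in>B. coord (vec_of F g) f *\<^sub>R vec_of F f) v"
    using expansion[OF assms] by simp
  also have "\<dots> = (\<Sum>f\<in>B. coord (vec_of F g) f * coord_inner J (vec_of F f) v)"
    by (simp add: coord_inner_left)
  finally show ?thesis
    by (simp add: shifted_form_def G_denom_alt algebra_simps sum.distrib sum_subtractf)
qed

text \<open>Replacing f by g moves the common zero of the forms of B along the line on which the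
  forms of \<open>B - {f}\<close> still vanish. On this line the form of h is affine with slope
  proportional to \<open>coord (vec_of F h) f\<close>, and the new point is the zero of the form of
  g.\<close>

lemma G_denom_exchange:
  assumes f: "f \<in> B" and g: "g \<notin> B" and sp: "vec_of F g \<in> coord_space J"
    and nz: "coord (vec_of F g) f \<noteq> 0"
  shows "G_denom J F t (insert g (B - {f})) h
    = G_denom J F t B h - of_real (coord (vec_of F h) f) / of_real (coord (vec_of F g) f) * G_denom J F t B g"
proof -
  define a where "a g = dot_of F g - t g" for g
  define c :: "idx \<Rightarrow> idx \<Rightarrow> complex" where "c h f = of_real (coord (vec_of F h) f)" for h f
  define R where "R = B - {f}"
  have R: "B = insert f R" "f \<notin> R" "finite R" "g \<notin> R" using f g finite_B by (auto simp: R_def)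
  interpret B': family_basis J F "insert g R"
    unfolding R_def by (rule exchange(1)[OF assms])
  have nz': "c g f \<noteq> 0" using nz by (simp add: c_def)
  define S where "S h = (\<Sum>e\<in>R. a e * c h e)" for h
  have "(\<Sum>e\<in>R. a e * (c h e - c g e / c g f * c h f)) = S h - c h f / c g f * S g"
    by (simp add: S_def right_diff_distrib sum_subtractf sum_distrib_left mult_ac)
  then have eq: "G_denom J F t (insert g R) h
      = a h - (a g * (c h f / c g f) + (S h - c h f / c g f * S g))"
    unfolding B'.G_denom_alt using R exchange(2,3)[OF assms]
    by (simp add: a_def[symmetric] c_def R_def[symmetric])
  have eq': "G_denom J F t B h = a h - (a f * c h f + S h)" for h
    unfolding G_denom_alt a_def[symmetric] c_def[symmetric] S_def using R by simp
  show ?thesis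
    using nz' unfolding R_def[symmetric] c_def[symmetric] eq eq' by (simp add: field_simps)
qed

lemma G_denom_self: "g \<in> B \<Longrightarrow> G_denom J F t B g = 0"
proof -
  assume g: "g \<in> B"
  have "(\<Sum>f\<in>B. (dot_of F f - t f) * of_real (coord (vec_of F g) f))
     = (\<Sum>f\<in>B. if f = g then dot_of F f - t f else 0)"
    using g by (auto simp: coord_vec intro!: sum.cong)
  then show ?thesis using g finite_B by (simp add: G_denom_alt)
qed

end


lemma finite_bases: "finite L \<Longrightarrow> finite (bases J L F)"
  by (rule finite_subset[of _ "Pow L"]) (auto simp: bases_def)

text \<open>Start of the induction for \<open>partial_fractions\<close>. A basis inside B that omits
  some g would make the dual vector of g orthogonal to a spanning set, hence 0.\<close>

lemma (in family_basis) bases_self: "bases J B F = {B}"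
proof -
  have "B' = B" if "B' \<in> bases J B F" for B'
  proof (rule ccontr)
    assume "B' \<noteq> B"
    with that obtain g where g: "g \<in> B" "g \<notin> B'" "B' \<subseteq> B"
      by (auto simp: bases_iff[OF finite_J finite_B])
    interpret B': family_basis J F B'
      using that by (auto simp: bases_iff[OF finite_J finite_B])
    have "coord_inner J (vec_of F h) (dual g) = coord_inner J (vec_of F h) 0" if "h \<in> B'" for h
      using that g coord_vec[OF g(1), of h] by (auto simp: coord_inner_def)
    then have "dual g = 0"
      using dual_in_space[OF g(1)] by (intro B'.eq_if_inner_eq) (auto simp: coord_space_def)
    then show False
      using coord_vec[OF g(1) g(1)] by (simp add: coord_inner_def)
  qed
  moreover have "B \<in> bases J B F"
    by (simp add: bases_iff[OF finite_J finite_B] family_basis_axioms)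
  ultimately show ?thesis by blast
qed

text \<open>Multiply the identity for L by \<open>\<phi> g0 / d B g0\<close>, which is 1 plus a
  combination of the \<open>\<phi> f\<close> with f in B. The 1 reproduces the old identity. The
  other terms are regrouped by \<open>R = B - {f}\<close>: for fixed R they are cancelled by the
  single new basis \<open>insert g0 R\<close>, and this cancellation is
  \<open>rank_one_partial_fractions\<close> on the line where the forms of R vanish.\<close>

lemma partial_fractions_insert:
  assumes J: "finite J" and L: "finite L" "g0 \<notin> L"
    and sp: "\<And>g. g \<in> insert g0 L \<Longrightarrow> vec_of F g \<in> coord_space J"
    and ne: "bases J L F \<noteq> {}"
    and reg: "\<And>B g. B \<in> bases J (insert g0 L) F \<Longrightarrow> g \<in> insert g0 L - B \<Longrightarrow> G_denom J F t B g \<noteq> 0"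
    and IH: "(\<Sum>B\<in>bases J L F. \<Prod>g\<in>L-B. shifted_form J F t v g / G_denom J F t B g) = 1"
  shows "(\<Sum>B\<in>bases J (insert g0 L) F. \<Prod>g\<in>insert g0 L-B.
            shifted_form J F t v g / G_denom J F t B g) = 1"
proof -
  define d where "d = G_denom J F t"
  define \<phi> where "\<phi> = shifted_form J F t v"
  define c where "c B f = complex_of_real (coord_inner J (vec_of F g0) (dual_vec J F B f))" for B f
  \<comment> \<open>The slope of the form of f on the line where the forms of R vanish, normalised
    so that the form of \<open>g0\<close> has slope 1.\<close>
  define \<alpha> where "\<alpha> R f = complex_of_real (coord_inner J (vec_of F f) (dual_vec J F (insert g0 R) g0))" for R f
  define Rs where "Rs = {R. g0 \<notin> R \<and> insert g0 R \<in> bases J (insert g0 L) F}"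
  have L1: "finite (insert g0 L)" using L by simp
  note bases_iff_L = bases_iff[OF J L(1)] and bases_iff_L1 = bases_iff[OF J L1]
  have split: "bases J (insert g0 L) F = bases J L F \<union> insert g0 ` Rs"
  proof
    show "bases J (insert g0 L) F \<subseteq> bases J L F \<union> insert g0 ` Rs"
    proof
      fix B assume B: "B \<in> bases J (insert g0 L) F"
      show "B \<in> bases J L F \<union> insert g0 ` Rs"
      proof (cases "g0 \<in> B")
        case True
        then have "insert g0 (B - {g0}) = B" by blast
        then have "B - {g0} \<in> Rs" using B by (simp add: Rs_def)
        then show ?thesis using \<open>insert g0 (B - {g0}) = B\<close> by (metis UnI2 imageI)
      next
        case False
        then show ?thesis using B by (auto simp: bases_iff_L bases_iff_L1)
      qed
    qed
    show "bases J L F \<union> insert g0 ` Rs \<subseteq> bases J (insert g0 L) F"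
      by (auto simp: bases_iff_L bases_iff_L1 Rs_def)
  qed
  have disj: "bases J L F \<inter> insert g0 ` Rs = {}" using L by (auto simp: bases_iff_L)
  have inj: "inj_on (insert g0) Rs" by (auto simp: inj_on_def Rs_def)
  have fin0: "finite (bases J L F)" by (rule finite_bases[OF L(1)])
  have Rs_sub: "R \<subseteq> L" if "R \<in> Rs" for R using that by (auto simp: Rs_def bases_iff_L1)
  have fin_Rs: "finite Rs" by (rule finite_subset[of _ "Pow L"]) (use Rs_sub L in auto)
  have term0: "(\<Prod>g\<in>insert g0 L-B. \<phi> g / d B g) = (\<Prod>g\<in>L-B. \<phi> g / d B g)
      + (\<Sum>f\<in>{f\<in>B. c B f \<noteq> 0}. c B f * \<phi> f / d B g0 * (\<Prod>g\<in>L-B. \<phi> g / d B g))"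
    if B: "B \<in> bases J L F" for B
  proof -
    interpret family_basis J F B using B by (simp add: bases_iff_L)
    have "d B g0 \<noteq> 0" unfolding d_def
      by (rule reg) (use B L in \<open>auto simp: bases_iff_L bases_iff_L1\<close>)
    moreover have "\<phi> g0 = d B g0 + (\<Sum>f\<in>B. c B f * \<phi> f)"
      using shifted_form_decomp[OF sp[of g0], of t v] by (simp add: \<phi>_def d_def c_def)
    ultimately have "\<phi> g0 / d B g0 = 1 + (\<Sum>f\<in>B. c B f * \<phi> f / d B g0)"
      by (simp add: add_divide_distrib sum_divide_distrib)
    also have "(\<Sum>f\<in>B. c B f * \<phi> f / d B g0) = (\<Sum>f\<in>{f\<in>B. c B f \<noteq> 0}. c B f * \<phi> f / d B g0)"
      using finite_B by (intro sum.mono_neutral_right) auto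
    finally have "\<phi> g0 / d B g0 = 1 + (\<Sum>f\<in>{f\<in>B. c B f \<noteq> 0}. c B f * \<phi> f / d B g0)" .
    moreover have "insert g0 L - B = insert g0 (L - B)" using B L by (auto simp: bases_iff_L)
    ultimately show ?thesis using L by (simp add: distrib_right sum_distrib_right)
  qed
  have cancel: "(\<Sum>f\<in>{f\<in>L-R. \<alpha> R f \<noteq> 0}. c (insert f R) f * \<phi> f / d (insert f R) g0 *
        (\<Prod>g\<in>L-insert f R. \<phi> g / d (insert f R) g))
      + (\<Prod>g\<in>insert g0 L-insert g0 R. \<phi> g / d (insert g0 R) g) = 0"
    if R: "R \<in> Rs" for R
  proof -
    have g0R: "g0 \<notin> R" and RL: "R \<subseteq> L" using R Rs_sub by (auto simp: Rs_def)
    interpret B': family_basis J F "insert g0 R" using R by (simp add: Rs_def bases_iff_L1)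
    define \<beta> where "\<beta> = d (insert g0 R)"
    have R_eq: "insert g0 R - {g0} = R" using g0R by blast
    \<comment> \<open>If all slopes vanished, the dual vector of \<open>g0\<close> would be
      orthogonal to every vector of L, but L contains a basis.\<close>
    have ex: "\<exists>f\<in>L-R. \<alpha> R f \<noteq> 0"
    proof (rule ccontr)
      assume no: "\<not> (\<exists>f\<in>L-R. \<alpha> R f \<noteq> 0)"
      have 0: "coord_inner J (vec_of F f) (B'.dual g0) = 0" if "f \<in> L" for f
        using that no g0R by (cases "f \<in> R") (auto simp: \<alpha>_def B'.coord_vec)
      obtain B0 where B0: "B0 \<in> bases J L F" using ne by blast
      interpret B0: family_basis J F B0 using B0 by (simp add: bases_iff_L)
      have "B'.dual g0 = 0"
        using B'.dual_in_space[of g0] B0 0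
        by (intro B0.eq_if_inner_eq) (auto simp: coord_space_def bases_iff_L, auto simp: coord_inner_def)
      then show False using B'.coord_vec[of g0 g0] by (simp add: coord_inner_def)
    qed
    have basis: "insert f R \<in> bases J L F" if "f \<in> L - R" "\<alpha> R f \<noteq> 0" for f
      using that RL B'.exchange(1)[of g0 f] sp[of f] L
      by (auto simp: R_eq \<alpha>_def bases_iff_L)
    have \<beta>_nz: "\<beta> g \<noteq> 0" if "g \<in> L - R" for g
      unfolding \<beta>_def d_def by (rule reg) (use that R L in \<open>auto simp: Rs_def\<close>)
    have d_eq: "d (insert f R) g = \<beta> g - \<alpha> R g * \<beta> f / \<alpha> R f" if "f \<in> L - R" "\<alpha> R f \<noteq> 0" for f g
      using that B'.G_denom_exchange[of g0 f t g] sp[of f] L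
      by (auto simp: R_eq \<alpha>_def d_def \<beta>_def)
    have c_eq: "c (insert f R) f = 1 / \<alpha> R f" if "f \<in> L - R" "\<alpha> R f \<noteq> 0" for f
    proof -
      have "f \<noteq> g0" using that L by blast
      then show ?thesis
        using that B'.exchange(2)[of g0 f "vec_of F g0"] sp[of f]
        by (auto simp: R_eq \<alpha>_def c_def B'.coord_vec)
    qed
    have d_g0: "d (insert f R) g0 = - \<beta> f / \<alpha> R f" if "f \<in> L - R" "\<alpha> R f \<noteq> 0" for f
    proof -
      have "\<beta> g0 = 0" "\<alpha> R g0 = 1"
        using B'.G_denom_self[of g0 t] B'.coord_vec[of g0 g0] by (auto simp: \<beta>_def d_def \<alpha>_def)
      then show ?thesis using d_eq[OF that, of g0] by simp
    qed
    have "(\<Sum>f\<in>{f\<in>L-R. \<alpha> R f \<noteq> 0}. c (insert f R) f * \<phi> f / d (insert f R) g0 *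
        (\<Prod>g\<in>L-insert f R. \<phi> g / d (insert f R) g))
      = (\<Sum>f\<in>{f\<in>L-R. \<alpha> R f \<noteq> 0}. - (\<Prod>g\<in>L-R. \<phi> g) *
          (1 / \<beta> f * (\<Prod>g\<in>L-R-{f}. 1 / (\<beta> g - \<alpha> R g * \<beta> f / \<alpha> R f))))"
    proof (rule sum.cong[OF refl])
      fix f assume "f \<in> {f\<in>L-R. \<alpha> R f \<noteq> 0}"
      then have f: "f \<in> L - R" "\<alpha> R f \<noteq> 0" by auto
      have "(\<Prod>g\<in>L-insert f R. \<phi> g / d (insert f R) g)
          = (\<Prod>g\<in>L-R-{f}. \<phi> g) * (\<Prod>g\<in>L-R-{f}. 1 / (\<beta> g - \<alpha> R g * \<beta> f / \<alpha> R f))"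
        unfolding prod.distrib[symmetric] by (rule prod.cong) (auto simp: d_eq[OF f])
      moreover have "(\<Prod>g\<in>L-R. \<phi> g) = \<phi> f * (\<Prod>g\<in>L-R-{f}. \<phi> g)"
        using f L by (intro prod.remove) auto
      ultimately show "c (insert f R) f * \<phi> f / d (insert f R) g0 *
          (\<Prod>g\<in>L-insert f R. \<phi> g / d (insert f R) g) = - (\<Prod>g\<in>L-R. \<phi> g) *
          (1 / \<beta> f * (\<Prod>g\<in>L-R-{f}. 1 / (\<beta> g - \<alpha> R g * \<beta> f / \<alpha> R f)))"
        using f by (simp add: c_eq d_g0)
    qed
    also have "\<dots> = - (\<Prod>g\<in>L-R. \<phi> g) * (\<Prod>g\<in>L-R. 1 / \<beta> g)"
    proof -
      have nz: "\<beta> g - \<alpha> R g * \<beta> f / \<alpha> R f \<noteq> 0"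
        if f: "f \<in> L - R" "\<alpha> R f \<noteq> 0" and "g \<in> L - R - {f}" for f g
        unfolding d_eq[OF f, symmetric] d_def
        by (rule reg) (use that basis[OF f] split in auto)
      show ?thesis
        unfolding sum_distrib_left[symmetric]
        using rank_one_partial_fractions[of "L - R" "\<alpha> R" \<beta>] ex \<beta>_nz nz L by simp
    qed
    also have "\<dots> = - (\<Prod>g\<in>L-R. \<phi> g / \<beta> g)"
      by (simp add: prod.distrib[symmetric])
    also have "(\<Prod>g\<in>L-R. \<phi> g / \<beta> g) = (\<Prod>g\<in>insert g0 L-insert g0 R. \<phi> g / \<beta> g)"
      using L RL by (intro prod.cong) auto
    finally show ?thesis by (simp add: \<beta>_def)
  qed
  \<comment> \<open>\<open>c B f \<noteq> 0\<close> says that exchanging f for \<open>g0\<close> in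
    B gives a basis, and \<open>\<alpha> R f \<noteq> 0\<close> says the same of the exchange back
    from \<open>insert g0 R\<close>; so the two index sets correspond under
    \<open>R = B - {f}\<close>.\<close>
  have reindex: "(\<Sum>(B, f)\<in>Sigma (bases J L F) (\<lambda>B. {f\<in>B. c B f \<noteq> 0}).
        c B f * \<phi> f / d B g0 * (\<Prod>g\<in>L-B. \<phi> g / d B g))
     = (\<Sum>(R, f)\<in>Sigma Rs (\<lambda>R. {f\<in>L-R. \<alpha> R f \<noteq> 0}). c (insert f R) f * \<phi> f / d (insert f R) g0 *
        (\<Prod>g\<in>L-insert f R. \<phi> g / d (insert f R) g))"
  proof (rule sum.reindex_bij_witness[where i = "\<lambda>(R, f). (insert f R, f)" and j = "\<lambda>(B, f). (B - {f}, f)"])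
    fix x assume "x \<in> Sigma (bases J L F) (\<lambda>B. {f\<in>B. c B f \<noteq> 0})"
    then obtain B f where x: "x = (B, f)" and B: "B \<in> bases J L F" and f: "f \<in> B" "c B f \<noteq> 0" by auto
    interpret family_basis J F B using B by (simp add: bases_iff_L)
    have BL: "B \<subseteq> L" using B by (simp add: bases_iff_L)
    have g0: "g0 \<notin> B" using BL L by blast
    have nz: "coord (vec_of F g0) f \<noteq> 0" using f by (simp add: c_def)
    note ex = exchange[OF f(1) g0 sp[of g0] nz, simplified]
    have "\<alpha> (B - {f}) f \<noteq> 0"
      using f nz by (auto simp: \<alpha>_def ex(2) coord_vec)
    moreover have "B - {f} \<in> Rs" using ex(1) g0 BL by (auto simp: Rs_def bases_iff_L1)
    ultimately show "(case x of (B, f) \<Rightarrow> (B - {f}, f)) \<in> Sigma Rs (\<lambda>R. {f\<in>L-R. \<alpha> R f \<noteq> 0})"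
      using f BL by (auto simp: x)
    show "(case case x of (B, f) \<Rightarrow> (B - {f}, f) of (R, f) \<Rightarrow> (insert f R, f)) = x"
      using f by (simp add: x insert_absorb)
    show "(case case x of (B, f) \<Rightarrow> (B - {f}, f) of (R, f) \<Rightarrow> c (insert f R) f * \<phi> f / d (insert f R) g0 *
        (\<Prod>g\<in>L-insert f R. \<phi> g / d (insert f R) g)) =
        (case x of (B, f) \<Rightarrow> c B f * \<phi> f / d B g0 * (\<Prod>g\<in>L-B. \<phi> g / d B g))"
      using f by (simp add: x insert_absorb)
  next
    fix x assume "x \<in> Sigma Rs (\<lambda>R. {f\<in>L-R. \<alpha> R f \<noteq> 0})"
    then obtain R f where x: "x = (R, f)" and R: "R \<in> Rs" and f: "f \<in> L - R" "\<alpha> R f \<noteq> 0" by auto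
    interpret B': family_basis J F "insert g0 R" using R by (simp add: Rs_def bases_iff_L1)
    have g0R: "g0 \<notin> R" and RL: "R \<subseteq> L" using R Rs_sub by (auto simp: Rs_def)
    have R_eq: "insert g0 R - {g0} = R" using g0R by blast
    have nz: "B'.coord (vec_of F f) g0 \<noteq> 0" using f by (simp add: \<alpha>_def)
    have "f \<notin> insert g0 R" using f L by auto
    note ex = B'.exchange[OF _ this sp[of f] nz, unfolded R_eq, simplified]
    have "c (insert f R) f \<noteq> 0"
      using f nz ex(2)[of "vec_of F g0"] by (auto simp: c_def B'.coord_vec)
    moreover have "insert f R \<in> bases J L F" using ex(1) f RL by (auto simp: bases_iff_L)
    ultimately show "(case x of (R, f) \<Rightarrow> (insert f R, f)) \<in> Sigma (bases J L F) (\<lambda>B. {f\<in>B. c B f \<noteq> 0})"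
      by (auto simp: x)
    show "(case case x of (R, f) \<Rightarrow> (insert f R, f) of (B, f) \<Rightarrow> (B - {f}, f)) = x"
      using f by (auto simp: x)
  qed
  have "(\<Sum>B\<in>bases J (insert g0 L) F. \<Prod>g\<in>insert g0 L-B. \<phi> g / d B g)
    = (\<Sum>B\<in>bases J L F. \<Prod>g\<in>insert g0 L-B. \<phi> g / d B g)
      + (\<Sum>R\<in>Rs. \<Prod>g\<in>insert g0 L-insert g0 R. \<phi> g / d (insert g0 R) g)"
    unfolding split using fin0 fin_Rs disj by (simp add: sum.union_disjoint sum.reindex[OF inj])
  also have "(\<Sum>B\<in>bases J L F. \<Prod>g\<in>insert g0 L-B. \<phi> g / d B g) = 1 +
      (\<Sum>B\<in>bases J L F. \<Sum>f\<in>{f\<in>B. c B f \<noteq> 0}. c B f * \<phi> f / d B g0 * (\<Prod>g\<in>L-B. \<phi> g / d B g))"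
    using IH[folded \<phi>_def d_def] by (simp add: term0 sum.distrib cong: sum.cong)
  also have "(\<Sum>B\<in>bases J L F. \<Sum>f\<in>{f\<in>B. c B f \<noteq> 0}. c B f * \<phi> f / d B g0 * (\<Prod>g\<in>L-B. \<phi> g / d B g))
     = (\<Sum>R\<in>Rs. \<Sum>f\<in>{f\<in>L-R. \<alpha> R f \<noteq> 0}. c (insert f R) f * \<phi> f / d (insert f R) g0 *
        (\<Prod>g\<in>L-insert f R. \<phi> g / d (insert f R) g))"
    using reindex fin0 fin_Rs L(1)
    by (subst (1 2) sum.Sigma) (auto simp: bases_iff_L family_basis_def)
  finally show ?thesis
    using cancel by (simp add: add.assoc sum.distrib[symmetric] \<phi>_def d_def)
qed

theorem partial_fractions:
  assumes J: "finite J" and L: "finite L"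
    and sp: "\<And>g. g \<in> L \<Longrightarrow> vec_of F g \<in> coord_space J"
    and ne: "bases J L F \<noteq> {}"
    and reg: "\<And>B g. B \<in> bases J L F \<Longrightarrow> g \<in> L - B \<Longrightarrow> G_denom J F t B g \<noteq> 0"
  shows "(\<Sum>B\<in>bases J L F. \<Prod>g\<in>L-B. shifted_form J F t v g / G_denom J F t B g) = 1"
proof -
  obtain B0 where B0: "B0 \<in> bases J L F" using ne by blast
  interpret B0: family_basis J F B0 using B0 by (simp add: bases_iff[OF J L])
  have B0L: "B0 \<subseteq> L" using B0 by (simp add: bases_def)
  have mono: "bases J M F \<subseteq> bases J M' F" if "M \<subseteq> M'" for M M'
    using that by (auto simp: bases_def)
  \<comment> \<open>Forms are added to one fixed basis \<open>B0\<close>, so that every intermediate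
    family contains a basis, as the insertion step requires.\<close>
  have "(\<Sum>B\<in>bases J (S \<union> B0) F. \<Prod>g\<in>S \<union> B0-B. shifted_form J F t v g / G_denom J F t B g) = 1"
    if "finite S" "S \<subseteq> L - B0" for S
    using that
  proof (induction S rule: finite_induct)
    case empty
    then show ?case by (simp add: B0.bases_self)
  next
    case (insert g S)
    have "B0 \<in> bases J (S \<union> B0) F"
      using mono[of B0 "S \<union> B0"] B0.bases_self by auto
    moreover have sub: "insert g (S \<union> B0) \<subseteq> L" using insert.prems B0L by auto
    ultimately show ?case
      using insert mono[OF sub] L sp reg J
      by (simp, intro partial_fractions_insert) (auto intro: finite_subset simp: B0.finite_B subset_eq)
  qed
  from this[of "L - B0"] L B0L show ?thesis by (simp add: Un_absorb2)
qed

section \<open>Fejer means in one variable\<close>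

lemma expi_add: "expi (a + b) = expi a * expi b"
  by (simp add: expi_def ring_distribs exp_add)

lemma expi_diff: "expi (a - b) = expi a / expi b"
  by (simp add: expi_def ring_distribs exp_diff)

lemma expi_minus: "expi (- a) = 1 / expi a"
  by (simp add: expi_def exp_minus inverse_eq_divide)

lemma expi_0 [simp]: "expi 0 = 1"
  by (simp add: expi_def)

lemma expi_nonzero [simp]: "expi a \<noteq> 0"
  by (simp add: expi_def)

lemma expi_sum: "finite S \<Longrightarrow> expi (\<Sum>x\<in>S. f x) = (\<Prod>x\<in>S. expi (f x))"
  by (induction S rule: finite_induct) (simp_all add: expi_add)

lemma expi_of_nat_mult: "expi (of_nat n * a) = expi a ^ n"
  by (simp add: expi_def exp_of_nat_mult[symmetric] mult_ac)

lemma norm_expi_of_real [simp]: "norm (expi (of_real x)) = 1"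
  by (simp add: expi_def mult.assoc)

lemma expi_of_real_eq_1_iff: "expi (of_real x) = 1 \<longleftrightarrow> x \<in> \<int>"
proof -
  have "expi (of_real x) = 1 \<longleftrightarrow> (\<exists>n::int. 2 * pi * x = of_int (2 * n) * pi)"
    by (simp add: expi_def exp_eq_1)
  also have "\<dots> \<longleftrightarrow> (\<exists>n::int. x = of_int n)" by auto
  finally show ?thesis by (auto simp: Ints_def)
qed

lemma expi_int: "z \<in> \<int> \<Longrightarrow> expi z = 1"
proof -
  assume "z \<in> \<int>"
  then obtain n :: int where "z = of_real (of_int n)" by (auto elim: Ints_cases)
  then show ?thesis by (simp only: expi_of_real_eq_1_iff) simp
qed

lemma expi_of_int [simp]: "expi (of_int n) = 1"
  by (rule expi_int) simp

lemma continuous_on_expi [continuous_intros]: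
  "continuous_on S f \<Longrightarrow> continuous_on S (\<lambda>x. expi (f x))"
  unfolding expi_def by (intro continuous_intros)

lemma tendsto_expi [tendsto_intros]: "(f \<longlongrightarrow> a) G \<Longrightarrow> ((\<lambda>x. expi (f x)) \<longlongrightarrow> expi a) G"
  unfolding expi_def by (intro tendsto_intros)

lemma norm_expi_le: "norm (expi z) \<le> exp (2 * pi * norm z)"
  unfolding expi_def by (rule order_trans[OF norm_exp]) (simp add: norm_mult)

lemma has_integral_expi:
  assumes "a \<noteq> 0"
  shows "((\<lambda>z. expi (a * of_real z)) has_integral (expi a - 1) / (2 * of_real pi * \<i> * a)) {0..1::real}"
proof -
  have deriv: "((\<lambda>w. exp (2 * of_real pi * \<i> * (a * w)) / (2 * of_real pi * \<i> * a)) has_field_derivative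
      exp (2 * of_real pi * \<i> * (a * w))) (at w)" for w
    using assms by (auto intro!: derivative_eq_intros)
  have "((\<lambda>z. expi (a * of_real z)) has_integral
      expi (a * of_real 1) / (2 * of_real pi * \<i> * a) - expi (a * of_real 0) / (2 * of_real pi * \<i> * a)) {0..1}"
    unfolding expi_def
    by (rule fundamental_theorem_of_calculus)
      (use has_vector_derivative_real_field[OF deriv] in auto)
  then show ?thesis by (simp add: diff_divide_distrib)
qed

section \<open>The Fejer kernel\<close>

definition fejer_weight :: "nat \<Rightarrow> int \<Rightarrow> real"
  where "fejer_weight N k = (if \<bar>k\<bar> < int N then 1 - \<bar>real_of_int k\<bar> / real N else 0)"

text \<open>Written as a normalised square so that nonnegativity is visible; the period is
  1.\<close>

definition fejer_kernel :: "nat \<Rightarrow> real \<Rightarrow> real"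
  where "fejer_kernel N x = (norm (\<Sum>a<N. expi (of_real (real a * x))))\<^sup>2 / real N"

lemma fejer_weight_nonneg: "0 \<le> fejer_weight N k"
  and fejer_weight_le_1: "fejer_weight N k \<le> 1"
  by (auto simp: fejer_weight_def divide_simps)

lemma fejer_weight_0: "N > 0 \<Longrightarrow> fejer_weight N 0 = 1"
  by (simp add: fejer_weight_def)

lemma fejer_weight_tendsto: "(\<lambda>N. fejer_weight N k) \<longlonglongrightarrow> 1"
proof -
  have "(\<lambda>N. 1 - \<bar>real_of_int k\<bar> / real N) \<longlonglongrightarrow> 1 - 0"
    by (intro tendsto_intros lim_const_over_n)
  moreover have "\<forall>\<^sub>F N in sequentially. 1 - \<bar>real_of_int k\<bar> / real N = fejer_weight N k"
    using eventually_gt_at_top[of "nat \<bar>k\<bar>"]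
    by eventually_elim (auto simp: fejer_weight_def)
  ultimately show ?thesis by (simp add: Lim_transform_eventually)
qed

text \<open>Origin of the triangular shape of \<open>fejer_weight\<close>: in the squared
  exponential sum a frequency occurs once for each pair of indices with that difference.\<close>

lemma card_difference_pairs:
  assumes "\<bar>k\<bar> < int N"
  shows "real (card {p \<in> {..<N} \<times> {..<N}. int (fst p) - int (snd p) = k}) = real N - \<bar>real_of_int k\<bar>"
proof -
  let ?S = "{p \<in> {..<N} \<times> {..<N}. int (fst p) - int (snd p) = k}"
  have "bij_betw (\<lambda>b. (b + nat k, b + nat (- k))) {..<N - nat \<bar>k\<bar>} ?S"
    by (rule bij_betw_byWitness[where f' = "\<lambda>(a, b). min a b"]) (use assms in auto)
  from bij_betw_same_card[OF this] show ?thesis using assms by (simp add: of_nat_diff)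
qed

lemma fejer_kernel_expansion:
  assumes "N > 0"
  shows "of_real (fejer_kernel N x)
    = (\<Sum>k\<in>{-int N<..<int N}. of_real (fejer_weight N k) * expi (of_real (real_of_int k * x)))"
proof -
  let ?e = "\<lambda>a. expi (of_real (real a * x))"
  have cnj: "cnj (?e b) = expi (of_real (- (real b * x)))" for b
    by (simp add: expi_def exp_cnj)
  have "of_real (fejer_kernel N x) = (\<Sum>a<N. ?e a) * cnj (\<Sum>b<N. ?e b) / of_nat N"
    unfolding complex_norm_square[symmetric] by (simp add: fejer_kernel_def)
  also have "(\<Sum>a<N. ?e a) * cnj (\<Sum>b<N. ?e b)
      = (\<Sum>p\<in>{..<N} \<times> {..<N}. expi (of_real (real_of_int (int (fst p) - int (snd p)) * x)))"
    unfolding cnj_sum sum_product sum.cartesian_product cnj expi_add[symmetric]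
    by (rule sum.cong) (auto simp: algebra_simps)
  also have "\<dots> = (\<Sum>k\<in>{-int N<..<int N}. \<Sum>p\<in>{p \<in> {..<N} \<times> {..<N}. int (fst p) - int (snd p) = k}.
        expi (of_real (real_of_int (int (fst p) - int (snd p)) * x)))"
    by (rule sum.group[symmetric]) auto
  also have "\<dots> = (\<Sum>k\<in>{-int N<..<int N}. of_real (real N - \<bar>real_of_int k\<bar>) * expi (of_real (real_of_int k * x)))"
  proof (rule sum.cong[OF refl])
    fix k assume "k \<in> {-int N<..<int N}"
    then have k: "\<bar>k\<bar> < int N" by auto
    have "(\<Sum>p\<in>{p \<in> {..<N} \<times> {..<N}. int (fst p) - int (snd p) = k}.
          expi (of_real (real_of_int (int (fst p) - int (snd p)) * x)))
        = (\<Sum>p\<in>{p \<in> {..<N} \<times> {..<N}. int (fst p) - int (snd p) = k}. expi (of_real (real_of_int k * x)))"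
    proof (rule sum.cong[OF refl])
      fix p assume "p \<in> {p \<in> {..<N} \<times> {..<N}. int (fst p) - int (snd p) = k}"
      then have "int (fst p) - int (snd p) = k" by simp
      then show "expi (of_real (real_of_int (int (fst p) - int (snd p)) * x))
          = expi (of_real (real_of_int k * x))" by (simp only:)
    qed
    then show "(\<Sum>p\<in>{p \<in> {..<N} \<times> {..<N}. int (fst p) - int (snd p) = k}.
          expi (of_real (real_of_int (int (fst p) - int (snd p)) * x)))
        = of_real (real N - \<bar>real_of_int k\<bar>) * expi (of_real (real_of_int k * x))"
      unfolding sum_constant card_difference_pairs[OF k, symmetric] by simp
  qed
  also have "\<dots> / of_nat N = (\<Sum>k\<in>{-int N<..<int N}. of_real (fejer_weight N k) * expi (of_real (real_of_int k * x)))"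
    unfolding sum_divide_distrib
    using assms by (intro sum.cong refl) (auto simp: fejer_weight_def field_simps)
  finally show ?thesis .
qed

lemma fejer_kernel_nonneg: "0 \<le> fejer_kernel N x"
  by (simp add: fejer_kernel_def)

lemma fejer_kernel_le:
  assumes "expi (of_real x) \<noteq> 1"
  shows "fejer_kernel N x \<le> 4 / (norm (expi (of_real x) - 1))\<^sup>2 / real N"
proof -
  let ?z = "expi (of_real x)"
  have "(\<Sum>a<N. expi (of_real (real a * x))) = (\<Sum>a<N. ?z ^ a)"
    by (simp add: expi_of_nat_mult[symmetric])
  also have "\<dots> = (?z ^ N - 1) / (?z - 1)"
    using assms by (simp add: geometric_sum)
  finally have "norm (\<Sum>a<N. expi (of_real (real a * x))) = norm (?z ^ N - 1) / norm (?z - 1)"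
    by (simp add: norm_divide)
  also have "\<dots> \<le> 2 / norm (?z - 1)"
  proof (rule divide_right_mono)
    have "norm (?z ^ N - 1) \<le> norm (?z ^ N) + norm (1::complex)" by (rule norm_triangle_ineq4)
    then show "norm (?z ^ N - 1) \<le> 2" by (simp add: norm_power)
  qed simp
  finally have "(norm (\<Sum>a<N. expi (of_real (real a * x))))\<^sup>2 \<le> (2 / norm (?z - 1))\<^sup>2"
    by (intro power_mono) auto
  then show ?thesis
    unfolding fejer_kernel_def by (intro divide_right_mono) (auto simp: power_divide)
qed

text \<open>On this range x stays away from the integers, so by compactness
  \<open>expi (of_real x) - 1\<close> is bounded away from 0.\<close>

lemma fejer_kernel_tail:
  assumes "0 < \<eta>"
  obtains C where "0 \<le> C" "\<And>x N. \<eta> \<le> \<bar>x\<bar> \<Longrightarrow> \<bar>x\<bar> \<le> 1 - \<eta> \<Longrightarrow> fejer_kernel N x \<le> C / real N"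
proof -
  define S where "S = {-(1-\<eta>)..-\<eta>} \<union> {\<eta>..1-\<eta>}"
  have ne: "expi (of_real x) \<noteq> 1" if "x \<in> S" for x
  proof
    assume "expi (of_real x) = 1"
    then obtain n :: int where "x = of_int n" by (auto simp: expi_of_real_eq_1_iff elim: Ints_cases)
    with that assms have "0 < \<bar>real_of_int n\<bar>" "\<bar>real_of_int n\<bar> < 1" by (auto simp: S_def)
    then show False by (simp flip: of_int_abs)
  qed
  have "compact S" unfolding S_def by (intro compact_Un compact_Icc)
  moreover have "continuous_on S (\<lambda>x. 4 / (norm (expi (of_real x) - 1))\<^sup>2)"
    by (intro continuous_intros) (use ne in auto)
  ultimately have "bounded ((\<lambda>x. 4 / (norm (expi (of_real x) - 1))\<^sup>2) ` S)"
    by (intro compact_imp_bounded compact_continuous_image)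
  then obtain C where C: "\<And>x. x \<in> S \<Longrightarrow> 4 / (norm (expi (of_real x) - 1))\<^sup>2 \<le> C"
    unfolding bounded_iff ball_simps(9) real_norm_def by (meson abs_le_D1)
  show ?thesis
  proof
    \<comment> \<open>For \<open>\<eta> > 1 / 2\<close> the set S is empty and the bound C may be
      negative, hence the maximum with 0.\<close>
    show "0 \<le> max C 0" by simp
    fix x N assume "\<eta> \<le> \<bar>x\<bar>" "\<bar>x\<bar> \<le> 1 - \<eta>"
    then have x: "x \<in> S" by (auto simp: S_def)
    have "fejer_kernel N x \<le> 4 / (norm (expi (of_real x) - 1))\<^sup>2 / real N"
      by (rule fejer_kernel_le[OF ne[OF x]])
    also have "\<dots> \<le> max C 0 / real N" using C[OF x] by (intro divide_right_mono) auto
    finally show "fejer_kernel N x \<le> max C 0 / real N" .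
  qed
qed

text \<open>On the unit interval this is the function whose k-th Fourier coefficient is 1 / (k - t).
  Its Fourier series is therefore the one-variable sum of e(k x) / (k - t), and
  \<open>lerch_fejer\<close> is the N-th Fejer mean of that series.\<close>

definition lerch_fun :: "complex \<Rightarrow> real \<Rightarrow> complex"
  where "lerch_fun t x = - (2 * of_real pi * \<i>) * expi (t * of_real x) / (expi t - 1)"

definition lerch_fejer :: "complex \<Rightarrow> nat \<Rightarrow> real \<Rightarrow> complex"
  where "lerch_fejer t N x = (\<Sum>k\<in>{-int N<..<int N}.
     of_real (fejer_weight N k) * expi (of_real (real_of_int k * x)) / (of_int k - t))"

lemma lerch_fejer_shift: "n \<in> \<int> \<Longrightarrow> lerch_fejer t N (x + n) = lerch_fejer t N x"
proof -
  assume "n \<in> \<int>"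
  then have "expi (of_real (real_of_int k * n)) = 1" for k
    by (simp only: expi_of_real_eq_1_iff) (intro Ints_mult Ints_of_int)
  then show ?thesis
    by (simp add: lerch_fejer_def ring_distribs expi_add)
qed

lemma
  assumes "N > 0"
  shows has_integral_of_real_fejer_kernel:
      "((\<lambda>z. complex_of_real (fejer_kernel N (x - z))) has_integral 1) {0..1}"
    and has_integral_fejer_kernel: "((\<lambda>z. fejer_kernel N (x - z)) has_integral 1) {0..1}"
proof -
  have eq: "of_real (fejer_kernel N (x - z)) = (\<Sum>k\<in>{-int N<..<int N}.
      of_real (fejer_weight N k) * expi (of_real (real_of_int k * x)) * expi (- of_int k * of_real z))" for z
    by (simp add: fejer_kernel_expansion[OF assms] right_diff_distrib expi_diff expi_minus)
  have int: "((\<lambda>z. expi (- of_int k * of_real z)) has_integral (if k = 0 then 1 else 0)) {0..1::real}" for k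
  proof (cases "k = 0")
    case True
    then show ?thesis using has_integral_const_real[of "1::complex" 0 1] by simp
  next
    case False
    then show ?thesis using has_integral_expi[of "- of_int k"] by (simp add: expi_minus)
  qed
  have "((\<lambda>z. complex_of_real (fejer_kernel N (x - z))) has_integral (\<Sum>k\<in>{-int N<..<int N}.
      of_real (fejer_weight N k) * expi (of_real (real_of_int k * x)) * (if k = 0 then 1 else 0))) {0..1}"
    unfolding eq by (intro has_integral_sum has_integral_mult_right int) auto
  also have "(\<Sum>k\<in>{-int N<..<int N}.
      of_real (fejer_weight N k) * expi (of_real (real_of_int k * x)) * (if k = 0 then 1 else 0))
     = (\<Sum>k\<in>{-int N<..<int N}. if k = 0 then 1 else 0 :: complex)"
    using assms by (intro sum.cong) (auto simp: fejer_weight_0)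
  also have "\<dots> = 1" using assms by simp
  finally show *: "((\<lambda>z. complex_of_real (fejer_kernel N (x - z))) has_integral 1) {0..1}" .
  show "((\<lambda>z. fejer_kernel N (x - z)) has_integral 1) {0..1}"
    using has_integral_linear[OF * bounded_linear_Re] by (simp add: o_def)
qed

text \<open>The Fejer mean is the convolution of \<open>lerch_fun\<close> with the kernel over one
  period: integrating each exponential against \<open>lerch_fun\<close> yields its Fourier
  coefficient.\<close>

lemma lerch_fejer_has_integral:
  assumes "N > 0" "expi t \<noteq> 1"
  shows "((\<lambda>z. lerch_fun t z * of_real (fejer_kernel N (x - z))) has_integral lerch_fejer t N x) {0..1}"
proof -
  have eq: "lerch_fun t z * of_real (fejer_kernel N (x - z)) = (\<Sum>k\<in>{-int N<..<int N}.
      of_real (fejer_weight N k) * expi (of_real (real_of_int k * x)) *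
      (- (2 * of_real pi * \<i>) / (expi t - 1)) * expi ((t - of_int k) * of_real z))" for z
    unfolding fejer_kernel_expansion[OF assms(1)] lerch_fun_def sum_distrib_left
    by (intro sum.cong refl) (simp add: right_diff_distrib left_diff_distrib expi_diff)
  have int: "((\<lambda>z. expi ((t - of_int k) * of_real z)) has_integral
      (expi t - 1) / (2 * of_real pi * \<i> * (t - of_int k))) {0..1::real}" for k
  proof -
    have "t \<noteq> of_int k" using assms(2) by auto
    then show ?thesis using has_integral_expi[of "t - of_int k"] by (simp add: expi_diff)
  qed
  have "((\<lambda>z. lerch_fun t z * of_real (fejer_kernel N (x - z))) has_integral
    (\<Sum>k\<in>{-int N<..<int N}.
      of_real (fejer_weight N k) * expi (of_real (real_of_int k * x)) *
      (- (2 * of_real pi * \<i>) / (expi t - 1)) * ((expi t - 1) / (2 * of_real pi * \<i> * (t - of_int k))))) {0..1}"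
    unfolding eq by (intro has_integral_sum has_integral_mult_right int) auto
  also have "(\<Sum>k\<in>{-int N<..<int N}.
      of_real (fejer_weight N k) * expi (of_real (real_of_int k * x)) *
      (- (2 * of_real pi * \<i>) / (expi t - 1)) * ((expi t - 1) / (2 * of_real pi * \<i> * (t - of_int k))))
     = lerch_fejer t N x"
    unfolding lerch_fejer_def
  proof (intro sum.cong refl)
    fix k
    have "t \<noteq> of_int k" using assms(2) by auto
    then show "of_real (fejer_weight N k) * expi (of_real (real_of_int k * x)) *
      (- (2 * of_real pi * \<i>) / (expi t - 1)) * ((expi t - 1) / (2 * of_real pi * \<i> * (t - of_int k)))
      = of_real (fejer_weight N k) * expi (of_real (real_of_int k * x)) / (of_int k - t)"
      using assms(2) by (simp add: divide_simps) (simp add: algebra_simps)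
  qed
  finally show ?thesis .
qed

lemma norm_lerch_fun_le:
  assumes "0 \<le> x" "x \<le> 1"
  shows "norm (lerch_fun t x) \<le> 2 * pi * exp (2 * pi * norm t) / norm (expi t - 1)"
proof -
  have "norm (expi (t * of_real x)) \<le> exp (2 * pi * norm (t * of_real x))" by (rule norm_expi_le)
  also have "\<dots> \<le> exp (2 * pi * norm t)"
    using assms by (auto simp: norm_mult intro!: mult_left_le mult_left_mono)
  finally show ?thesis
    by (auto simp: lerch_fun_def norm_divide norm_mult intro!: divide_right_mono)
qed

text \<open>Averaging against a nonnegative kernel of integral 1 cannot exceed the bound of the
  function on [0, 1]. This is the reason for Fejer weights: unweighted partial sums have no
  nonnegative kernel, and the bound is needed uniformly in N and x, also at the jumps.\<close>

lemma norm_lerch_fejer_le: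
  assumes "expi t \<noteq> 1"
  shows "norm (lerch_fejer t N x) \<le> 2 * pi * exp (2 * pi * norm t) / norm (expi t - 1)"
proof (cases "N = 0")
  case False
  then have N: "N > 0" by simp
  let ?M = "2 * pi * exp (2 * pi * norm t) / norm (expi t - 1)"
  have 1: "((\<lambda>z. ?M * fejer_kernel N (x - z)) has_integral ?M * 1) {0..1}"
    by (intro has_integral_mult_right has_integral_fejer_kernel N)
  have "norm (integral {0..1} (\<lambda>z. lerch_fun t z * of_real (fejer_kernel N (x - z))))
      \<le> integral {0..1} (\<lambda>z. ?M * fejer_kernel N (x - z))"
  proof (rule integral_norm_bound_integral)
    fix z :: real assume "z \<in> {0..1}"
    then show "norm (lerch_fun t z * of_real (fejer_kernel N (x - z))) \<le> ?M * fejer_kernel N (x - z)"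
      using norm_lerch_fun_le[of z t] fejer_kernel_nonneg[of N "x - z"]
      unfolding norm_mult by (intro mult_mono) auto
  qed (use 1 lerch_fejer_has_integral[OF N assms] in \<open>auto simp: integrable_on_def\<close>)
  then show ?thesis
    unfolding integral_unique[OF 1] integral_unique[OF lerch_fejer_has_integral[OF N assms]] by simp
qed (simp add: lerch_fejer_def)

text \<open>An approximate identity argument in which N and x vary together, since the means are
  later evaluated at points that move towards the limit point. The point \<open>x0\<close> is
  interior because the periodic extension of \<open>lerch_fun\<close> jumps at the integers.\<close>

lemma lerch_fejer_tendsto_unit:
  assumes t: "expi t \<noteq> 1" and x0: "0 < x0" "x0 < 1"
  shows "((\<lambda>(N, x). lerch_fejer t N x) \<longlongrightarrow> lerch_fun t x0) (sequentially \<times>\<^sub>F nhds x0)"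
proof (rule tendstoI)
  fix \<epsilon> :: real assume \<epsilon>: "0 < \<epsilon>"
  let ?M = "2 * pi * exp (2 * pi * norm t) / norm (expi t - 1)"
  have "continuous_on UNIV (lerch_fun t)"
    unfolding lerch_fun_def by (intro continuous_intros) (use t in auto)
  then have "isCont (lerch_fun t) x0" by (simp add: continuous_on_eq_continuous_at)
  then obtain \<delta>0 where \<delta>0: "0 < \<delta>0" "\<And>z. dist z x0 < \<delta>0 \<Longrightarrow> dist (lerch_fun t z) (lerch_fun t x0) < \<epsilon> / 2"
    using \<epsilon> unfolding continuous_at_eps_delta by (metis half_gt_zero)
  \<comment> \<open>Half of \<open>\<delta>0\<close> makes every z at distance at least
    \<open>\<delta>0\<close> from \<open>x0\<close> lie at distance at least \<open>\<delta>\<close>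
    from x. The other two bounds keep \<open>\<bar>x - z\<bar> \<le> 1 - \<delta>\<close> for z in
    [0, 1], so that the tail estimate of the kernel applies.\<close>
  define \<delta> where "\<delta> = min (\<delta>0 / 2) (min (x0 / 2) ((1 - x0) / 2))"
  have \<delta>: "0 < \<delta>" "2 * \<delta> \<le> \<delta>0" "\<delta> \<le> x0 / 2" "\<delta> \<le> (1 - x0) / 2"
    using \<delta>0(1) x0 by (auto simp: \<delta>_def min_def)
  obtain C where C: "0 \<le> C" "\<And>x N. \<delta> \<le> \<bar>x\<bar> \<Longrightarrow> \<bar>x\<bar> \<le> 1 - \<delta> \<Longrightarrow> fejer_kernel N x \<le> C / real N"
    using fejer_kernel_tail[OF \<delta>(1)] by blast
  have main: "norm (lerch_fejer t N x - lerch_fun t x0) \<le> \<epsilon> / 2 + 2 * ?M * (C / real N)"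
    if N: "N > 0" and x: "dist x x0 < \<delta>" for N x
  proof -
    have I: "((\<lambda>z. (lerch_fun t z - lerch_fun t x0) * of_real (fejer_kernel N (x - z))) has_integral
        lerch_fejer t N x - lerch_fun t x0 * 1) {0..1}"
      unfolding left_diff_distrib
      by (intro has_integral_diff has_integral_mult_right
          lerch_fejer_has_integral has_integral_of_real_fejer_kernel N t)
    have I2: "((\<lambda>z. \<epsilon> / 2 * fejer_kernel N (x - z) + 2 * ?M * (C / real N)) has_integral
        \<epsilon> / 2 * 1 + 2 * ?M * (C / real N)) {0..1}"
      using has_integral_const_real[of "2 * ?M * (C / real N)" 0 1]

      by (intro has_integral_add[OF has_integral_mult_right[OF has_integral_fejer_kernel[OF N]]]) simp
    have "norm (integral {0..1} (\<lambda>z. (lerch_fun t z - lerch_fun t x0) * of_real (fejer_kernel N (x - z))))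
       \<le> integral {0..1} (\<lambda>z. \<epsilon> / 2 * fejer_kernel N (x - z) + 2 * ?M * (C / real N))"
    proof (rule integral_norm_bound_integral)
      fix z :: real assume z: "z \<in> {0..1}"
      have Mpos: "0 \<le> ?M" by simp
      show "norm ((lerch_fun t z - lerch_fun t x0) * of_real (fejer_kernel N (x - z)))
         \<le> \<epsilon> / 2 * fejer_kernel N (x - z) + 2 * ?M * (C / real N)"
      proof (cases "dist z x0 < \<delta>0")
        case True
        have "norm (lerch_fun t z - lerch_fun t x0) * fejer_kernel N (x - z) \<le> \<epsilon> / 2 * fejer_kernel N (x - z)"
          using \<delta>0(2)[OF True] by (intro mult_right_mono fejer_kernel_nonneg) (simp add: dist_norm)
        then show ?thesis
          using Mpos C(1) by (simp add: norm_mult fejer_kernel_nonneg add_increasing2)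
      next
        case False
        have "norm (lerch_fun t z - lerch_fun t x0) \<le> norm (lerch_fun t z) + norm (lerch_fun t x0)"
          by (rule norm_triangle_ineq4)
        also have "\<dots> \<le> ?M + ?M"
          using z x0 by (intro add_mono norm_lerch_fun_le) auto
        finally have "norm (lerch_fun t z - lerch_fun t x0) \<le> 2 * ?M" by linarith
        moreover have "fejer_kernel N (x - z) \<le> C / real N"
          using False \<delta> x z x0 by (intro C(2)) (auto simp: dist_real_def)
        ultimately have "norm (lerch_fun t z - lerch_fun t x0) * fejer_kernel N (x - z) \<le> 2 * ?M * (C / real N)"
          using Mpos by (intro mult_mono) (auto simp: fejer_kernel_nonneg)
        then show ?thesis
          using \<epsilon> fejer_kernel_nonneg[of N "x - z"]
          by (simp add: norm_mult fejer_kernel_nonneg add_increasing)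
      qed
    qed (use I I2 in \<open>auto simp: integrable_on_def\<close>)
    then show ?thesis unfolding integral_unique[OF I] integral_unique[OF I2] by simp
  qed
  have "(\<lambda>N. 2 * ?M * (C / real N)) \<longlonglongrightarrow> 2 * ?M * 0"
    by (intro tendsto_intros lim_const_over_n)
  then have "\<forall>\<^sub>F N in sequentially. 2 * ?M * (C / real N) < \<epsilon> / 2"
    using \<epsilon> by (intro order_tendstoD(2)[of _ 0]) auto
  then have "\<forall>\<^sub>F N in sequentially. 2 * ?M * (C / real N) < \<epsilon> / 2 \<and> N > 0"
    using eventually_gt_at_top[of 0] by eventually_elim auto
  moreover have "\<forall>\<^sub>F x in nhds x0. dist x x0 < \<delta>"
    using \<delta>(1) by (auto simp: eventually_nhds_metric)
  ultimately have "\<forall>\<^sub>F p in sequentially \<times>\<^sub>F nhds x0. (2 * ?M * (C / real (fst p)) < \<epsilon> / 2 \<and> fst p > 0) \<and> dist (snd p) x0 < \<delta>"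
    by (rule eventually_prodI)
  then show "\<forall>\<^sub>F p in sequentially \<times>\<^sub>F nhds x0. dist (case p of (N, x) \<Rightarrow> lerch_fejer t N x) (lerch_fun t x0) < \<epsilon>"
  proof eventually_elim
    case (elim p)
    then show ?case
      using main[of "fst p" "snd p"] by (simp add: case_prod_unfold dist_norm)
  qed
qed

lemma lerch_fejer_tendsto:
  assumes t: "expi t \<noteq> 1" and x0: "x0 \<notin> \<int>"
  shows "((\<lambda>(N, x). lerch_fejer t N x) \<longlongrightarrow> lerch_fun t (frac x0)) (sequentially \<times>\<^sub>F nhds x0)"
proof -
  have f: "0 < frac x0" "frac x0 < 1"
    using x0 by (auto simp: frac_gt_0_iff frac_lt_1)
  have "((\<lambda>x. x - of_int \<lfloor>x0\<rfloor>) \<longlongrightarrow> x0 - of_int \<lfloor>x0\<rfloor>) (nhds x0)"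
    by (intro tendsto_diff tendsto_const filterlim_ident)
  then have "filterlim (\<lambda>p. (fst p, snd p - of_int \<lfloor>x0\<rfloor>)) (sequentially \<times>\<^sub>F nhds (frac x0)) (sequentially \<times>\<^sub>F nhds x0)"
    unfolding frac_def
    by (intro filterlim_Pair filterlim_compose[OF _ filterlim_snd] filterlim_fst)
  from filterlim_compose[OF lerch_fejer_tendsto_unit[OF t f] this]
  have "((\<lambda>p. lerch_fejer t (fst p) (snd p + - of_int \<lfloor>x0\<rfloor>)) \<longlongrightarrow> lerch_fun t (frac x0)) (sequentially \<times>\<^sub>F nhds x0)"
    by simp
  then show ?thesis
    by (subst (asm) lerch_fejer_shift) (auto simp: case_prod_unfold)
qed

section \<open>Cosets and lattice characters\<close>

lemma coord_lattice_add: "u \<in> coord_lattice J \<Longrightarrow> v \<in> coord_lattice J \<Longrightarrow> u + v \<in> coord_lattice J"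
  and coord_lattice_diff: "u \<in> coord_lattice J \<Longrightarrow> v \<in> coord_lattice J \<Longrightarrow> u - v \<in> coord_lattice J"
  by (auto simp: coord_lattice_def coord_space_def)

lemma coord_lattice_scale: "u \<in> coord_lattice J \<Longrightarrow> of_int k *\<^sub>R u \<in> coord_lattice J"
  by (auto simp: coord_lattice_def coord_space_def)

lemma coord_lattice_sum: "(\<And>a. a \<in> S \<Longrightarrow> f a \<in> coord_lattice J) \<Longrightarrow> (\<Sum>a\<in>S. f a) \<in> coord_lattice J"
  by (auto simp: coord_lattice_def coord_space_def sum_fun_apply intro!: sum.neutral)

lemma coord_inner_Ints: "u \<in> coord_lattice J \<Longrightarrow> v \<in> coord_lattice J \<Longrightarrow> coord_inner J u v \<in> \<int>"
  by (auto simp: coord_inner_def coord_lattice_def)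

lemma unitv_in_lattice: "x \<in> J \<Longrightarrow> unitv x \<in> coord_lattice J"
  by (auto simp: coord_lattice_def unitv_def coord_space_def)

lemma coord_lattice_imp_space: "v \<in> coord_lattice J \<Longrightarrow> v \<in> coord_space J"
  by (simp add: coord_lattice_def)

lemma finite_bounded_lattice:
  assumes "finite J"
  shows "finite {v \<in> coord_lattice J. \<forall>j\<in>J. \<bar>v j\<bar> \<le> C}"
proof (rule finite_subset)
  let ?h = "\<lambda>g j. if j \<in> J then real_of_int (g j) else 0"
  show "{v \<in> coord_lattice J. \<forall>j\<in>J. \<bar>v j\<bar> \<le> C} \<subseteq> ?h ` (J \<rightarrow>\<^sub>E {-\<lceil>C\<rceil>..\<lceil>C\<rceil>})"
  proof
    fix v assume v: "v \<in> {v \<in> coord_lattice J. \<forall>j\<in>J. \<bar>v j\<bar> \<le> C}"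
    define g where "g = restrict (\<lambda>j. \<lfloor>v j\<rfloor>) J"
    have "v = ?h g"
      using v by (auto simp: g_def coord_lattice_def coord_space_def fun_eq_iff)
    moreover have "g \<in> J \<rightarrow>\<^sub>E {-\<lceil>C\<rceil>..\<lceil>C\<rceil>}"
    proof -
      have "- \<lceil>C\<rceil> \<le> \<lfloor>v j\<rfloor> \<and> \<lfloor>v j\<rfloor> \<le> \<lceil>C\<rceil>" if "j \<in> J" for j
      proof -
        have "\<bar>v j\<bar> \<le> C" using v that by auto
        then show ?thesis by linarith
      qed
      then show ?thesis by (auto simp: g_def)
    qed
    ultimately show "v \<in> ?h ` (J \<rightarrow>\<^sub>E {-\<lceil>C\<rceil>..\<lceil>C\<rceil>})" by blast
  qed
  show "finite (?h ` (J \<rightarrow>\<^sub>E {-\<lceil>C\<rceil>..\<lceil>C\<rceil>}))"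
    using assms by (intro finite_imageI finite_PiE) auto
qed

locale lattice_basis = family_basis +
  assumes vec_in_lattice: "f \<in> B \<Longrightarrow> vec_of F f \<in> coord_lattice J"
    and dot_Ints: "f \<in> B \<Longrightarrow> dot_of F f \<in> \<int>"
begin

definition coset_rel :: "((nat \<Rightarrow> real) \<times> (nat \<Rightarrow> real)) set"
  where "coset_rel = {(u, v). u \<in> coord_lattice J \<and> v \<in> coord_lattice J \<and> u - v \<in> gen_lattice F B}"

definition coset :: "(nat \<Rightarrow> real) \<Rightarrow> (nat \<Rightarrow> real) set" where "coset u = coset_rel `` {u}"
text \<open>The same choice of representative as in \<open>G_fun\<close>, so that the two match by
  definition.\<close>

definition rep :: "(nat \<Rightarrow> real) set \<Rightarrow> nat \<Rightarrow> real" where "rep W = (SOME w. w \<in> W)"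

lemma gen_lattice_iff:
  assumes "v \<in> coord_space J"
  shows "v \<in> gen_lattice F B \<longleftrightarrow> (\<forall>f\<in>B. coord v f \<in> \<int>)"
proof
  assume "v \<in> gen_lattice F B"
  then obtain c :: "idx \<Rightarrow> int" where "v = (\<Sum>f\<in>B. of_int (c f) *\<^sub>R vec_of F f)"
    by (auto simp: gen_lattice_def)
  then show "\<forall>f\<in>B. coord v f \<in> \<int>" by (auto simp: sum_coord_vec)
next
  assume "\<forall>f\<in>B. coord v f \<in> \<int>"
  then have "\<forall>f\<in>B. of_int \<lfloor>coord v f\<rfloor> = coord v f" by auto
  then have "v = (\<Sum>f\<in>B. of_int \<lfloor>coord v f\<rfloor> *\<^sub>R vec_of F f)"
    by (subst expansion[OF assms]) (auto intro!: sum.cong)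
  then show "v \<in> gen_lattice F B" unfolding gen_lattice_def by (intro CollectI exI)
qed

lemma coset_rel_iff: "(u, v) \<in> coset_rel \<longleftrightarrow>
    u \<in> coord_lattice J \<and> v \<in> coord_lattice J \<and> (\<forall>f\<in>B. coord u f - coord v f \<in> \<int>)"
  by (auto simp: coset_rel_def gen_lattice_iff coord_lattice_diff coord_lattice_imp_space coord_inner_left)

lemma equiv_coset_rel: "equiv (coord_lattice J) coset_rel"
proof (rule equivI)
  show "coset_rel \<subseteq> coord_lattice J \<times> coord_lattice J" by (auto simp: coset_rel_def)
  show "refl_on (coord_lattice J) coset_rel" by (auto simp: refl_on_def coset_rel_iff)
  show "sym coset_rel"
  proof (rule symI)
    fix u v assume "(u, v) \<in> coset_rel"
    then show "(v, u) \<in> coset_rel"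
      by (auto simp: coset_rel_iff) (metis Ints_minus minus_diff_eq)
  qed
  show "trans coset_rel"
  proof (rule transI)
    fix u v w assume "(u, v) \<in> coset_rel" "(v, w) \<in> coset_rel"
    moreover from this have "coord u f - coord w f \<in> \<int>" if "f \<in> B" for f
      using that Ints_add[of "coord u f - coord v f" "coord v f - coord w f"]
      by (auto simp: coset_rel_iff)
    ultimately show "(u, w) \<in> coset_rel" by (auto simp: coset_rel_iff)
  qed
qed

lemma cosets_eq: "cosets J F B = coord_lattice J // coset_rel"
  by (simp add: cosets_def coset_rel_def)

lemma coset_in_cosets: "u \<in> coord_lattice J \<Longrightarrow> coset u \<in> cosets J F B"
  by (simp add: coset_def cosets_eq quotientI)

lemma coset_eq_iff:
  "u \<in> coord_lattice J \<Longrightarrow> v \<in> coord_lattice J \<Longrightarrow> coset u = coset v \<longleftrightarrow> (u, v) \<in> coset_rel"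
  unfolding coset_def by (rule eq_equiv_class_iff[OF equiv_coset_rel])

lemma rep:
  assumes "W \<in> cosets J F B"
  shows rep_in_lattice: "rep W \<in> coord_lattice J" and coset_rep: "coset (rep W) = W"
proof -
  from assms obtain u where u: "u \<in> coord_lattice J" "W = coset u"
    by (auto simp: cosets_eq coset_def elim: quotientE)
  then have "u \<in> W"
    using equiv_class_self[OF equiv_coset_rel] by (simp add: coset_def)
  then have "rep W \<in> W" unfolding rep_def by (rule someI[where P = "\<lambda>w. w \<in> W"])
  then have *: "(u, rep W) \<in> coset_rel" using u by (simp add: coset_def)
  then show "rep W \<in> coord_lattice J" by (simp add: coset_rel_iff)
  then show "coset (rep W) = W" using * u coset_eq_iff by metis
qed

lemma rep_coset: "u \<in> coord_lattice J \<Longrightarrow> (u, rep (coset u)) \<in> coset_rel"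
  using rep[OF coset_in_cosets] coset_eq_iff by metis

text \<open>Subtracting the integer parts of the coordinates gives each coset a representative in
  the half-open parallelepiped spanned by B, and C bounds the entries of its points.\<close>

lemma finite_cosets: "finite (cosets J F B)"
proof (rule finite_subset)
  define C where "C = (\<Sum>j\<in>J. \<Sum>f\<in>B. \<bar>vec_of F f j\<bar>)"
  show "cosets J F B \<subseteq> coset ` {v \<in> coord_lattice J. \<forall>j\<in>J. \<bar>v j\<bar> \<le> C}"
  proof
    fix W assume W: "W \<in> cosets J F B"
    define u where "u = rep W"
    have u: "u \<in> coord_lattice J" and uW: "coset u = W" using rep[OF W] by (auto simp: u_def)
    define v where "v = u - (\<Sum>f\<in>B. of_int \<lfloor>coord u f\<rfloor> *\<^sub>R vec_of F f)"
    have v: "v \<in> coord_lattice J"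
      unfolding v_def using u vec_in_lattice
      by (intro coord_lattice_diff coord_lattice_sum coord_lattice_scale) auto
    have coord_v: "coord v f = frac (coord u f)" if "f \<in> B" for f
      using that by (simp add: v_def coord_inner_diff_left sum_coord_vec frac_def)
    have "coset u = coset v"
      using u v by (simp add: coset_eq_iff coset_rel_iff coord_v frac_def)
    moreover have "\<bar>v j\<bar> \<le> C" if "j \<in> J" for j
    proof -
      have "v j = (\<Sum>f\<in>B. coord v f * vec_of F f j)"
        by (subst (1) expansion[OF coord_lattice_imp_space[OF v]]) (simp add: sum_fun_apply)
      also have "\<bar>\<dots>\<bar> \<le> (\<Sum>f\<in>B. \<bar>coord v f * vec_of F f j\<bar>)" by (rule sum_abs)
      also have "\<dots> \<le> (\<Sum>f\<in>B. \<bar>vec_of F f j\<bar>)"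
      proof (rule sum_mono)
        fix f assume "f \<in> B"
        then have "\<bar>coord v f\<bar> \<le> 1"
          using frac_lt_1[of "coord u f"] by (simp add: coord_v)
        then show "\<bar>coord v f * vec_of F f j\<bar> \<le> \<bar>vec_of F f j\<bar>"
          by (simp add: abs_mult mult_left_le_one_le)
      qed
      also have "\<dots> \<le> C"
        unfolding C_def by (rule member_le_sum[OF that _ finite_J]) (simp add: sum_nonneg)
      finally show ?thesis .
    qed
    ultimately show "W \<in> coset ` {v \<in> coord_lattice J. \<forall>j\<in>J. \<bar>v j\<bar> \<le> C}"
      using v uW by blast
  qed
  show "finite (coset ` {v \<in> coord_lattice J. \<forall>j\<in>J. \<bar>v j\<bar> \<le> C})"
    by (intro finite_imageI finite_bounded_lattice finite_J)
qed

lemma card_cosets_pos: "card (cosets J F B) > 0"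
proof -
  have "0 \<in> coord_lattice J" by (auto simp: coord_lattice_def coord_space_def)
  then show ?thesis using finite_cosets coset_in_cosets by (auto simp: card_gt_0_iff)
qed

text \<open>Translation by a lattice vector on which the character is nontrivial permutes the cosets
  and multiplies the sum by a number different from 1.\<close>

lemma character_average:
  assumes v: "v \<in> coord_space J" and int: "\<And>f. f \<in> B \<Longrightarrow> coord_inner J (vec_of F f) v \<in> \<int>"
  shows "(\<Sum>W\<in>cosets J F B. expi (of_real (coord_inner J (rep W) v)))
    = (if v \<in> coord_lattice J then of_nat (card (cosets J F B)) else 0)"
proof (cases "v \<in> coord_lattice J")
  case True
  then have "expi (of_real (coord_inner J (rep W) v)) = 1" if "W \<in> cosets J F B" for W
    using coord_inner_Ints[OF rep_in_lattice[OF that] True] by (simp only: expi_of_real_eq_1_iff)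
  then show ?thesis using True by simp
next
  case False
  define \<psi> where "\<psi> w = expi (of_real (coord_inner J w v))" for w
  have \<psi>_add: "\<psi> (u + w) = \<psi> u * \<psi> w" for u w
    by (simp add: \<psi>_def coord_inner_left expi_add)
  have \<psi>_rel: "\<psi> u = \<psi> w" if "(u, w) \<in> coset_rel" for u w
  proof -
    have "u - w \<in> gen_lattice F B" using that by (simp add: coset_rel_def)
    then obtain c :: "idx \<Rightarrow> int" where c: "u - w = (\<Sum>f\<in>B. of_int (c f) *\<^sub>R vec_of F f)"
      by (auto simp: gen_lattice_def)
    have "coord_inner J (u - w) v \<in> \<int>"
      unfolding c coord_inner_left using int by (intro Ints_sum Ints_mult) auto
    then have "\<psi> (u - w) = 1" unfolding \<psi>_def by (simp only: expi_of_real_eq_1_iff)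
    then show ?thesis using \<psi>_add[of "u - w" w] by simp
  qed
  obtain x where x: "v x \<notin> \<int>" using v False by (auto simp: coord_lattice_def)
  then have xJ: "x \<in> J" using v by (auto simp: coord_space_def)
  define w0 where "w0 = unitv x"
  have w0: "w0 \<in> coord_lattice J" using unitv_in_lattice[OF xJ] by (simp add: w0_def)
  have "\<psi> w0 \<noteq> 1"
    using x xJ by (simp add: \<psi>_def expi_of_real_eq_1_iff w0_def coord_inner_unitv[OF finite_J])
  have shift: "(rep (coset (rep W + s)), rep W + s) \<in> coset_rel"
    if "W \<in> cosets J F B" "s \<in> coord_lattice J" for W s
    using rep_coset[of "rep W + s"] rep_in_lattice[OF that(1)] that(2) equiv_coset_rel
    by (auto simp: coord_lattice_add equiv_def dest: symD)
  have inv: "coset (rep (coset (rep W + s)) - s) = W"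
    if W: "W \<in> cosets J F B" and s: "s \<in> coord_lattice J" for W s
  proof -
    have "coset (rep (coset (rep W + s)) - s) = coset (rep W)"
      using shift[OF W s] rep_in_lattice[OF W] s
      by (auto simp: coset_rel_iff coord_inner_left coset_eq_iff coord_lattice_diff diff_diff_eq add.commute)
    then show ?thesis using coset_rep[OF W] by simp
  qed
  have "uminus w0 \<in> coord_lattice J" using coord_lattice_scale[OF w0, of "-1"] by simp
  note inv' = inv[OF _ this] and cl = coset_in_cosets coord_lattice_add coord_lattice_diff rep_in_lattice
  have "(\<Sum>W\<in>cosets J F B. \<psi> (rep W + w0)) = (\<Sum>W\<in>cosets J F B. \<psi> (rep W))"
    by (rule sum.reindex_bij_witness[where i = "\<lambda>W. coset (rep W - w0)" and j = "\<lambda>W. coset (rep W + w0)"])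
      (use inv[OF _ w0] inv' w0 \<psi>_rel[OF shift[OF _ w0]] in \<open>auto intro!: cl\<close>)
  then have "(1 - \<psi> w0) * (\<Sum>W\<in>cosets J F B. \<psi> (rep W)) = 0"
    by (simp add: left_diff_distrib \<psi>_add sum_distrib_left[symmetric] mult.commute)
  then show ?thesis using \<open>\<psi> w0 \<noteq> 1\<close> False by (simp add: \<psi>_def)
qed

end

section \<open>Fejer means of the basis sums\<close>

text \<open>A real number, to which floors and absolute values apply; for integral
  \<open>dot_of\<close> taking the real part loses nothing.\<close>

definition lin_form :: "nat set \<Rightarrow> family \<Rightarrow> (nat \<Rightarrow> real) \<Rightarrow> idx \<Rightarrow> real"
  where "lin_form J F v f = coord_inner J (vec_of F f) v + Re (dot_of F f)"

definition char_at :: "nat set \<Rightarrow> (nat \<Rightarrow> real) \<Rightarrow> (nat \<Rightarrow> real) \<Rightarrow> complex"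
  where "char_at J y v = expi (of_real (coord_inner J y v))"

lemma Ints_complex_Re: "z \<in> \<int> \<Longrightarrow> of_real (Re z) = z" "z \<in> \<int> \<Longrightarrow> Re z \<in> \<int>" for z :: complex
  by (auto elim!: Ints_cases)

context lattice_basis
begin

text \<open>The phase with \<open>dot_of F f\<close> shifts the frequencies of the f-th Lerch mean
  by the constant of the form, so that the summation index of that mean becomes the value
  \<open>lin_form J F v f\<close>.\<close>

definition fejer_sum :: "(idx \<Rightarrow> complex) \<Rightarrow> nat \<Rightarrow> (nat \<Rightarrow> real) \<Rightarrow> complex"
  where "fejer_sum t N y = 1 / of_nat (card (cosets J F B)) *
    (\<Sum>W\<in>cosets J F B. \<Prod>f\<in>B.
      expi (- dot_of F f * of_real (coord (y + rep W) f)) * lerch_fejer (t f) N (coord (y + rep W) f))"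

definition lerch_sum :: "(idx \<Rightarrow> complex) \<Rightarrow> (nat \<Rightarrow> real) \<Rightarrow> complex"
  where "lerch_sum t y = 1 / of_nat (card (cosets J F B)) *
    (\<Sum>W\<in>cosets J F B. \<Prod>f\<in>B.
      expi (- dot_of F f * of_real (coord (y + rep W) f)) * lerch_fun (t f) (frac (coord (y + rep W) f)))"

definition support_box :: "nat \<Rightarrow> (nat \<Rightarrow> real) set"
  where "support_box N = {v \<in> coord_lattice J. \<forall>f\<in>B. \<bar>lin_form J F v f\<bar> < real N}"

lemma lin_form_Ints: "v \<in> coord_lattice J \<Longrightarrow> f \<in> B \<Longrightarrow> lin_form J F v f \<in> \<int>"
  unfolding lin_form_def
  by (intro Ints_add coord_inner_Ints vec_in_lattice Ints_complex_Re dot_Ints)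

text \<open>After multiplying out, a choice \<kappa> of one frequency per form corresponds to the
  vector \<open>v \<kappa>\<close> in the span of the dual basis at which the forms take the values
  \<kappa>. The average over the cosets is a character sum that keeps exactly those
  \<open>v \<kappa>\<close> with integral coordinates.\<close>

lemma fejer_sum_expansion:
  "fejer_sum t N y = (\<Sum>v\<in>support_box N. char_at J y v *
     (\<Prod>f\<in>B. of_real (fejer_weight N \<lfloor>lin_form J F v f\<rfloor>) / (of_real (lin_form J F v f) - t f)))"
proof -
  define e where "e f = \<lfloor>Re (dot_of F f)\<rfloor>" for f
  have e: "dot_of F f = of_int (e f)" "Re (dot_of F f) = of_int (e f)" if "f \<in> B" for f
    using dot_Ints[OF that] by (auto simp: e_def elim!: Ints_cases)
  define K where "K = B \<rightarrow>\<^sub>E {-int N<..<int N}"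
  define v where "v \<kappa> = (\<Sum>f\<in>B. real_of_int (\<kappa> f - e f) *\<^sub>R dual f)" for \<kappa>
  define a where "a \<kappa> = (\<Prod>f\<in>B. of_real (fejer_weight N (\<kappa> f)) / (of_int (\<kappa> f) - t f))" for \<kappa>
  have fin_K: "finite K" unfolding K_def by (intro finite_PiE finite_B) auto
  have v_sp: "v \<kappa> \<in> coord_space J" for \<kappa>
    unfolding v_def using dual_in_space by (intro subspace_sum subspace_scale subspace_coord_space)
  have inner_v: "coord_inner J (vec_of F f) (v \<kappa>) = of_int (\<kappa> f - e f)" if "f \<in> B" for f \<kappa>
  proof -
    have "coord_inner J (vec_of F f) (v \<kappa>) = (\<Sum>g\<in>B. if g = f then of_int (\<kappa> g - e g) else 0)"
      unfolding v_def coord_inner_right using that by (intro sum.cong) (auto simp: coord_vec)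
    then show ?thesis using that finite_B by simp
  qed
  have lin_v: "lin_form J F (v \<kappa>) f = of_int (\<kappa> f)" if "f \<in> B" for f \<kappa>
    using that by (simp add: lin_form_def inner_v e)
  have prod_eq: "(\<Prod>f\<in>B. expi (- dot_of F f * of_real (coord u f)) * lerch_fejer (t f) N (coord u f))
      = (\<Sum>\<kappa>\<in>K. a \<kappa> * char_at J u (v \<kappa>))" for u
  proof -
    have "(\<Prod>f\<in>B. expi (- dot_of F f * of_real (coord u f)) * lerch_fejer (t f) N (coord u f))
        = (\<Prod>f\<in>B. \<Sum>k\<in>{-int N<..<int N}. of_real (fejer_weight N k) / (of_int k - t f) *
            expi (of_real (of_int (k - e f) * coord u f)))"
    proof (rule prod.cong[OF refl])
      fix f assume f: "f \<in> B"
      have eq: "expi (of_real (of_int (k - e f) * c)) = expi (of_real (of_int k * c)) * expi (- of_int (e f) * of_real c)"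
        for k c by (simp add: left_diff_distrib expi_diff expi_minus)
      show "expi (- dot_of F f * of_real (coord u f)) * lerch_fejer (t f) N (coord u f)
        = (\<Sum>k\<in>{-int N<..<int N}. of_real (fejer_weight N k) / (of_int k - t f) *
            expi (of_real (of_int (k - e f) * coord u f)))"
        unfolding lerch_fejer_def sum_distrib_left eq e[OF f]
        by (intro sum.cong refl) (simp add: mult_ac)
    qed
    also have "\<dots> = (\<Sum>\<kappa>\<in>K. \<Prod>f\<in>B. of_real (fejer_weight N (\<kappa> f)) / (of_int (\<kappa> f) - t f) *
            expi (of_real (of_int (\<kappa> f - e f) * coord u f)))"
      unfolding K_def by (rule prod_sum_PiE) (auto simp: finite_B)
    also have "\<dots> = (\<Sum>\<kappa>\<in>K. a \<kappa> * char_at J u (v \<kappa>))"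
    proof (rule sum.cong[OF refl])
      fix \<kappa>
      have "coord_inner J u (v \<kappa>) = (\<Sum>f\<in>B. of_int (\<kappa> f - e f) * coord u f)"
        by (simp add: v_def coord_inner_right)
      then show "(\<Prod>f\<in>B. of_real (fejer_weight N (\<kappa> f)) / (of_int (\<kappa> f) - t f) *
            expi (of_real (of_int (\<kappa> f - e f) * coord u f))) = a \<kappa> * char_at J u (v \<kappa>)"
        using finite_B
        by (simp only: char_at_def a_def prod.distrib of_real_sum expi_sum)
    qed
    finally show ?thesis .
  qed
  have "(\<Sum>W\<in>cosets J F B. \<Sum>\<kappa>\<in>K. a \<kappa> * char_at J (y + rep W) (v \<kappa>))
      = (\<Sum>\<kappa>\<in>K. a \<kappa> * char_at J y (v \<kappa>) * (\<Sum>W\<in>cosets J F B. expi (of_real (coord_inner J (rep W) (v \<kappa>)))))"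
    unfolding sum.swap[of _ K]
    by (simp add: sum_distrib_left char_at_def coord_inner_left expi_add mult.assoc)
  also have "\<dots> = (\<Sum>\<kappa>\<in>K. if v \<kappa> \<in> coord_lattice J then a \<kappa> * char_at J y (v \<kappa>) * of_nat (card (cosets J F B)) else 0)"
    by (intro sum.cong refl) (simp add: character_average v_sp inner_v)
  finally have "fejer_sum t N y = (\<Sum>\<kappa>\<in>K. if v \<kappa> \<in> coord_lattice J then a \<kappa> * char_at J y (v \<kappa>) else 0)"
    unfolding fejer_sum_def prod_eq using card_cosets_pos
    by (simp add: sum_distrib_left if_distrib[of "\<lambda>x. _ * x"] cong: if_cong)
  also have "\<dots> = (\<Sum>\<kappa>\<in>{\<kappa>\<in>K. v \<kappa> \<in> coord_lattice J}. a \<kappa> * char_at J y (v \<kappa>))"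
    by (rule sum.inter_filter[OF fin_K, symmetric])
  also have "\<dots> = (\<Sum>u\<in>support_box N. char_at J y u *
     (\<Prod>f\<in>B. of_real (fejer_weight N \<lfloor>lin_form J F u f\<rfloor>) / (of_real (lin_form J F u f) - t f)))"
  proof (rule sum.reindex_bij_witness[where i = "\<lambda>u. restrict (\<lambda>f. \<lfloor>lin_form J F u f\<rfloor>) B" and j = v])
    fix \<kappa> assume \<kappa>: "\<kappa> \<in> {\<kappa>\<in>K. v \<kappa> \<in> coord_lattice J}"
    then have \<kappa>B: "\<kappa> \<in> B \<rightarrow>\<^sub>E {-int N<..<int N}" by (simp add: K_def)
    show "restrict (\<lambda>f. \<lfloor>lin_form J F (v \<kappa>) f\<rfloor>) B = \<kappa>"
    proof
      fix f
      show "restrict (\<lambda>f. \<lfloor>lin_form J F (v \<kappa>) f\<rfloor>) B f = \<kappa> f"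
        using PiE_arb[OF \<kappa>B, of f] by (cases "f \<in> B") (simp_all add: lin_v)
    qed
    have "\<bar>lin_form J F (v \<kappa>) f\<bar> < real N" if "f \<in> B" for f
    proof -
      have "\<bar>\<kappa> f\<bar> < int N" using PiE_mem[OF \<kappa>B that] by auto
      then show ?thesis unfolding lin_v[OF that] by linarith
    qed
    then show "v \<kappa> \<in> support_box N" using \<kappa> by (auto simp: support_box_def)
    show "char_at J y (v \<kappa>) *
     (\<Prod>f\<in>B. of_real (fejer_weight N \<lfloor>lin_form J F (v \<kappa>) f\<rfloor>) / (of_real (lin_form J F (v \<kappa>) f) - t f))
      = a \<kappa> * char_at J y (v \<kappa>)"
      by (simp add: lin_v a_def)
  next
    fix u assume u: "u \<in> support_box N"
    define \<kappa> where "\<kappa> = restrict (\<lambda>f. \<lfloor>lin_form J F u f\<rfloor>) B"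
    have \<kappa>: "of_int (\<kappa> f) = lin_form J F u f" if "f \<in> B" for f
      using u that lin_form_Ints by (auto simp: \<kappa>_def support_box_def)
    have "v \<kappa> = u"
    proof (rule eq_if_inner_eq[OF v_sp])
      show "u \<in> coord_space J" using u by (simp add: support_box_def coord_lattice_imp_space)
      show "coord_inner J (vec_of F g) (v \<kappa>) = coord_inner J (vec_of F g) u" if "g \<in> B" for g
        using that by (simp add: inner_v \<kappa>) (simp add: lin_form_def e)
    qed
    moreover have "\<kappa> f \<in> {-int N<..<int N}" if "f \<in> B" for f
    proof -
      have "\<bar>real_of_int (\<kappa> f)\<bar> < real N" using u that by (simp add: \<kappa> support_box_def)
      then have "\<bar>\<kappa> f\<bar> < int N" by linarith
      then show ?thesis by auto
    qed
    then have "\<kappa> \<in> K" by (auto simp: K_def \<kappa>_def)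
    ultimately show "v (restrict (\<lambda>f. \<lfloor>lin_form J F u f\<rfloor>) B) = u"
      and "restrict (\<lambda>f. \<lfloor>lin_form J F u f\<rfloor>) B \<in> {\<kappa>\<in>K. v \<kappa> \<in> coord_lattice J}"
      using u by (auto simp: \<kappa>_def[symmetric] support_box_def)
  qed
  finally show ?thesis .
qed

lemma norm_fejer_sum_le:
  assumes "\<And>f. f \<in> B \<Longrightarrow> expi (t f) \<noteq> 1"
  shows "norm (fejer_sum t N y) \<le> (\<Prod>f\<in>B. 2 * pi * exp (2 * pi * norm (t f)) / norm (expi (t f) - 1))"
    (is "_ \<le> ?M")
proof -
  have "norm (\<Prod>f\<in>B. expi (- dot_of F f * of_real (coord (y + rep W) f)) *
      lerch_fejer (t f) N (coord (y + rep W) f)) \<le> ?M" for W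
    unfolding prod_norm[symmetric]
  proof (rule prod_mono, intro conjI)
    fix f assume f: "f \<in> B"
    have "norm (expi (- dot_of F f * of_real (coord (y + rep W) f))) = 1"
      by (subst Ints_complex_Re(1)[OF dot_Ints[OF f], symmetric])
        (simp flip: of_real_minus of_real_mult)
    then show "norm (expi (- dot_of F f * of_real (coord (y + rep W) f)) *
        lerch_fejer (t f) N (coord (y + rep W) f)) \<le> 2 * pi * exp (2 * pi * norm (t f)) / norm (expi (t f) - 1)"
      using norm_lerch_fejer_le[OF assms[OF f]] by (simp add: norm_mult)
  qed simp
  then have "norm (\<Sum>W\<in>cosets J F B. \<Prod>f\<in>B.
      expi (- dot_of F f * of_real (coord (y + rep W) f)) * lerch_fejer (t f) N (coord (y + rep W) f))
      \<le> of_nat (card (cosets J F B)) * ?M"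
    by (rule sum_norm_bound)
  then show ?thesis
    using card_cosets_pos by (simp add: fejer_sum_def norm_mult norm_divide field_simps)
qed

text \<open>The walls are the hyperplanes on which a fractional part in G jumps.\<close>

definition off_walls :: "(nat \<Rightarrow> real) \<Rightarrow> bool"
  where "off_walls y \<longleftrightarrow> (\<forall>W\<in>cosets J F B. \<forall>f\<in>B. coord (y + rep W) f \<notin> \<int>)"

text \<open>Each factor converges jointly in its cutoff and its argument, so the point may move
  along with the cutoff; the grid averages need this.\<close>

lemma fejer_sum_tendsto:
  assumes t: "\<And>f. f \<in> B \<Longrightarrow> expi (t f) \<noteq> 1" and y: "off_walls y"
    and z: "\<And>j. j \<in> J \<Longrightarrow> ((\<lambda>p. z p j) \<longlongrightarrow> y j) G" and N: "filterlim N sequentially G"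
  shows "((\<lambda>p. fejer_sum t (N p) (z p)) \<longlongrightarrow> lerch_sum t y) G"
  unfolding fejer_sum_def lerch_sum_def
proof (intro tendsto_mult tendsto_const tendsto_sum tendsto_prod)
  fix W f assume W: "W \<in> cosets J F B" and f: "f \<in> B"
  have lim: "((\<lambda>p. coord (z p + rep W) f) \<longlongrightarrow> coord (y + rep W) f) G"
    unfolding coord_inner_def by (intro tendsto_intros) (use z in \<open>auto intro!: tendsto_intros\<close>)
  then show "((\<lambda>p. expi (- dot_of F f * of_real (coord (z p + rep W) f))) \<longlongrightarrow>
      expi (- dot_of F f * of_real (coord (y + rep W) f))) G"
    by (intro tendsto_intros)
  have "coord (y + rep W) f \<notin> \<int>" using y W f by (simp add: off_walls_def)
  from filterlim_compose[OF lerch_fejer_tendsto[OF t[OF f] this] filterlim_Pair[OF N lim]]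
  show "((\<lambda>p. lerch_fejer (t f) (N p) (coord (z p + rep W) f)) \<longlongrightarrow>
      lerch_fun (t f) (frac (coord (y + rep W) f))) G"
    by simp
qed

end

section \<open>Averaging over a finite grid\<close>

text \<open>Quadrature weights: the Fejer kernel sampled at 2 L + 1 equally spaced points of a
  period centred at 0. With them the convolution with the kernel becomes a finite sum.\<close>

definition grid_weight :: "nat \<Rightarrow> nat \<Rightarrow> int \<Rightarrow> real"
  where "grid_weight N L a = fejer_kernel N (of_int a / real (2 * L + 1)) / real (2 * L + 1)"

lemma grid_weight_nonneg: "0 \<le> grid_weight N L a"
  by (simp add: grid_weight_def fejer_kernel_nonneg)

lemma grid_character_sum:
  assumes "\<bar>k\<bar> < 2 * int L + 1"
  shows "(\<Sum>a\<in>{-int L..int L}. expi (of_real (of_int k * (of_int a / real (2 * L + 1)))))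
    = (if k = 0 then of_nat (2 * L + 1) else 0)"
proof (cases "k = 0")
  case False
  define M where "M = 2 * L + 1"
  define z where "z = expi (of_real (of_int k / real M))"
  have zM: "z ^ M = 1"
    unfolding z_def expi_of_nat_mult[symmetric] by (simp add: M_def)
  have "z \<noteq> 1"
  proof
    assume "z = 1"
    then have "of_int k / real M \<in> \<int>" unfolding z_def by (simp only: expi_of_real_eq_1_iff)
    then obtain n :: int where n: "of_int k / real M = of_int n" by (elim Ints_cases)
    then have "real_of_int k = of_int (n * int M)" by (simp add: M_def field_simps)
    then have "k = n * int M" by linarith
    moreover from this False have "\<bar>n\<bar> \<ge> 1" by auto
    ultimately have "\<bar>k\<bar> \<ge> int M"
      using mult_right_mono[of 1 "\<bar>n\<bar>" "int M"] by (simp add: abs_mult)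
    then show False using assms by (simp add: M_def)
  qed
  have "(\<Sum>a\<in>{-int L..int L}. expi (of_real (of_int k * (of_int a / real M))))
      = (\<Sum>b<M. expi (of_real (of_int k * (of_int (int b - int L) / real M))))"
    by (rule sum.reindex_bij_witness[where i = "\<lambda>b. int b - int L" and j = "\<lambda>a. nat (a + int L)"])
      (auto simp: M_def)
  also have "\<dots> = (\<Sum>b<M. expi (of_real (- (of_int k * real L / real M))) * z ^ b)"
  proof (rule sum.cong[OF refl])
    fix b
    have "of_int k * (of_int (int b - int L) / real M) = - (of_int k * real L / real M) + real b * (of_int k / real M)"
      by (simp add: divide_inverse algebra_simps)
    then have "complex_of_real (of_int k * (of_int (int b - int L) / real M))
        = of_real (- (of_int k * real L / real M)) + of_nat b * of_real (of_int k / real M)"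
      by (metis of_real_add of_real_mult of_real_of_nat_eq)
    then show "expi (of_real (of_int k * (of_int (int b - int L) / real M)))
        = expi (of_real (- (of_int k * real L / real M))) * z ^ b"
      unfolding z_def expi_of_nat_mult[symmetric] expi_add[symmetric] by (simp only:)
  qed
  also have "\<dots> = 0"
    using \<open>z \<noteq> 1\<close> zM by (simp add: sum_distrib_left[symmetric] geometric_sum)
  finally show ?thesis using False by (simp add: M_def)
qed simp

text \<open>The quadrature is exact: the frequencies \<open>k' - k\<close> that occur are smaller
  than 2 L + 1 in absolute value, so only the frequency 0 is divisible by 2 L + 1.\<close>

lemma grid_weight_sum:
  assumes "N > 0" "\<bar>k\<bar> + int N \<le> 2 * int L + 1"
  shows "(\<Sum>a\<in>{-int L..int L}. of_real (grid_weight N L a) * expi (- of_real (of_int k * (of_int a / real (2 * L + 1)))))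
    = of_real (fejer_weight N k)"
proof -
  define M where "M = real (2 * L + 1)"
  have "M > 0" by (simp add: M_def)
  have "(\<Sum>a\<in>{-int L..int L}. of_real (grid_weight N L a) * expi (- of_real (of_int k * (of_int a / M))))
    = (\<Sum>a\<in>{-int L..int L}. \<Sum>k'\<in>{-int N<..<int N}. of_real (fejer_weight N k' / M) *
         expi (of_real (of_int (k' - k) * (of_int a / M))))"
  proof (rule sum.cong[OF refl])
    fix a
    have eq: "expi (of_real (of_int (k' - k) * x)) = expi (of_real (of_int k' * x)) * expi (- of_real (of_int k * x))"
      for k' x by (simp add: left_diff_distrib expi_diff expi_minus)
    show "of_real (grid_weight N L a) * expi (- of_real (of_int k * (of_int a / M)))
      = (\<Sum>k'\<in>{-int N<..<int N}. of_real (fejer_weight N k' / M) * expi (of_real (of_int (k' - k) * (of_int a / M))))"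
      unfolding grid_weight_def M_def[symmetric] of_real_divide fejer_kernel_expansion[OF assms(1)] eq
      by (simp add: sum_distrib_left sum_divide_distrib mult_ac)
  qed
  also have "\<dots> = (\<Sum>k'\<in>{-int N<..<int N}. of_real (fejer_weight N k' / M) *
         (\<Sum>a\<in>{-int L..int L}. expi (of_real (of_int (k' - k) * (of_int a / M)))))"
    by (subst sum.swap) (simp add: sum_distrib_left)
  also have "\<dots> = (\<Sum>k'\<in>{-int N<..<int N}. if k' = k then of_real (fejer_weight N k') else 0)"
  proof (rule sum.cong[OF refl])
    fix k' assume "k' \<in> {-int N<..<int N}"
    then have "\<bar>k' - k\<bar> < 2 * int L + 1" using assms by auto
    from grid_character_sum[OF this]
    have g: "(\<Sum>a\<in>{-int L..int L}. expi (of_real (of_int (k' - k) * (of_int a / M))))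
        = (if k' - k = 0 then of_real M else 0)"
      unfolding M_def by (simp only: of_real_of_nat_eq)
    show "of_real (fejer_weight N k' / M) *
         (\<Sum>a\<in>{-int L..int L}. expi (of_real (of_int (k' - k) * (of_int a / M))))
       = (if k' = k then of_real (fejer_weight N k') else 0)"
      unfolding g using \<open>M > 0\<close> by simp
  qed
  also have "\<dots> = of_real (fejer_weight N k)"
    by (auto simp: fejer_weight_def)
  finally show ?thesis by (simp add: M_def)
qed

lemma grid_weight_total:
  assumes "N > 0" "N \<le> 2 * L + 1"
  shows "(\<Sum>a\<in>{-int L..int L}. grid_weight N L a) = 1"
proof -
  have "complex_of_real (\<Sum>a\<in>{-int L..int L}. grid_weight N L a) = of_real 1"
    using grid_weight_sum[of N 0 L] assms by (simp add: fejer_weight_0)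
  then show ?thesis by (simp only: of_real_eq_iff)
qed

definition grid :: "nat set \<Rightarrow> nat \<Rightarrow> (nat \<Rightarrow> int) set"
  where "grid J L = J \<rightarrow>\<^sub>E {-int L..int L}"

definition grid_prod :: "nat set \<Rightarrow> nat \<Rightarrow> nat \<Rightarrow> (nat \<Rightarrow> int) \<Rightarrow> real"
  where "grid_prod J N L a = (\<Prod>j\<in>J. grid_weight N L (a j))"

definition grid_shift :: "nat set \<Rightarrow> nat \<Rightarrow> (nat \<Rightarrow> int) \<Rightarrow> nat \<Rightarrow> real"
  where "grid_shift J L a = (\<lambda>j. if j \<in> J then of_int (a j) / real (2 * L + 1) else 0)"

definition box_weight :: "nat set \<Rightarrow> nat \<Rightarrow> (nat \<Rightarrow> real) \<Rightarrow> real"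
  where "box_weight J N v = (\<Prod>j\<in>J. fejer_weight N \<lfloor>v j\<rfloor>)"

lemma grid_prod_nonneg: "0 \<le> grid_prod J N L a"
  by (simp add: grid_prod_def prod_nonneg grid_weight_nonneg)

lemma finite_grid: "finite J \<Longrightarrow> finite (grid J L)"
  by (simp add: grid_def finite_PiE)

lemma grid_prod_total:
  assumes "finite J" "N > 0" "N \<le> 2 * L + 1"
  shows "(\<Sum>a\<in>grid J L. grid_prod J N L a) = 1"
  unfolding grid_def grid_prod_def
  by (subst prod_sum_PiE[symmetric]) (use assms in \<open>auto simp: grid_weight_total\<close>)

text \<open>This trades a Fejer weight in the coordinates of v for an average over translates of y.
  The size condition on v excludes aliasing in every coordinate.\<close>

lemma grid_average_char:
  assumes "finite J" "N > 0" and v: "v \<in> coord_lattice J" "\<And>j. j \<in> J \<Longrightarrow> \<bar>v j\<bar> + real N \<le> 2 * real L + 1"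
  shows "(\<Sum>a\<in>grid J L. of_real (grid_prod J N L a) * char_at J (y - grid_shift J L a) v)
    = of_real (box_weight J N v) * char_at J y v"
proof -
  have floor_v: "real_of_int \<lfloor>v j\<rfloor> = v j" for j using v(1) by (simp add: coord_lattice_def)
  have char: "char_at J (y - grid_shift J L a) v =
      char_at J y v * (\<Prod>j\<in>J. expi (- of_real (of_int \<lfloor>v j\<rfloor> * (of_int (a j) / real (2 * L + 1)))))" for a
  proof -
    have "coord_inner J (grid_shift J L a) v = (\<Sum>j\<in>J. of_int \<lfloor>v j\<rfloor> * (of_int (a j) / real (2 * L + 1)))"
      unfolding coord_inner_def by (intro sum.cong) (auto simp: grid_shift_def floor_v)
    then show ?thesis
      unfolding char_at_def coord_inner_diff_left expi_sum[OF assms(1), symmetric] expi_add[symmetric]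
      by (intro arg_cong[where f = expi]) (simp add: sum_negf)
  qed
  have "(\<Sum>a\<in>grid J L. of_real (grid_prod J N L a) * char_at J (y - grid_shift J L a) v)
     = char_at J y v * (\<Sum>a\<in>grid J L. \<Prod>j\<in>J. of_real (grid_weight N L (a j)) *
         expi (- of_real (of_int \<lfloor>v j\<rfloor> * (of_int (a j) / real (2 * L + 1)))))"
    unfolding char grid_prod_def sum_distrib_left by (simp only: prod.distrib of_real_prod mult_ac)
  also have "(\<Sum>a\<in>grid J L. \<Prod>j\<in>J. of_real (grid_weight N L (a j)) *
         expi (- of_real (of_int \<lfloor>v j\<rfloor> * (of_int (a j) / real (2 * L + 1)))))
     = (\<Prod>j\<in>J. \<Sum>b\<in>{-int L..int L}. of_real (grid_weight N L b) *
         expi (- of_real (of_int \<lfloor>v j\<rfloor> * (of_int b / real (2 * L + 1)))))"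
    unfolding grid_def by (rule prod_sum_PiE[symmetric]) (use assms in auto)
  also have "\<dots> = (\<Prod>j\<in>J. of_real (fejer_weight N \<lfloor>v j\<rfloor>))"
  proof (rule prod.cong[OF refl], rule grid_weight_sum[OF assms(2)])
    fix j assume "j \<in> J"
    then have "\<bar>real_of_int \<lfloor>v j\<rfloor>\<bar> + real N \<le> 2 * real L + 1" using v(2) by (simp add: floor_v)
    then show "\<bar>\<lfloor>v j\<rfloor>\<bar> + int N \<le> 2 * int L + 1" by linarith
  qed
  finally show ?thesis by (simp add: box_weight_def mult.commute del: minus_apply)
qed

text \<open>A union bound over the coordinates: the mass with the j-th coordinate far out is a
  one-dimensional tail, because the other coordinates have total mass 1. A tail consists of at most
  2 L + 1 grid points, each of weight at most C / N / (2 L + 1). Grid points lie within 1/2 of 0, so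
  \<open>\<eta> \<le> 1 / 2\<close> puts the far ones in the range of the kernel estimate.\<close>

lemma grid_tail:
  assumes J: "finite J" and N: "N > 0" "N \<le> 2 * L + 1" and \<eta>: "\<eta> \<le> 1 / 2"
    and C: "\<And>x. \<eta> \<le> \<bar>x\<bar> \<Longrightarrow> \<bar>x\<bar> \<le> 1 - \<eta> \<Longrightarrow> fejer_kernel N x \<le> C / real N"
    and "0 \<le> C"
  shows "(\<Sum>a\<in>{a\<in>grid J L. \<exists>j\<in>J. \<eta> \<le> \<bar>grid_shift J L a j\<bar>}. grid_prod J N L a)
      \<le> real (card J) * (C / real N)"
proof -
  define M where "M = real (2 * L + 1)"
  have M: "M > 0" by (simp add: M_def)
  define w where "w j a = (if \<eta> \<le> \<bar>of_int a / M\<bar> then grid_weight N L a else 0)" for j :: nat and a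
  have w_nonneg: "0 \<le> w j a" for j a by (simp add: w_def grid_weight_nonneg)
  have w_le: "w j a \<le> C / real N / M" if "a \<in> {-int L..int L}" for j a
  proof (cases "\<eta> \<le> \<bar>of_int a / M\<bar>")
    case True
    have "\<bar>real_of_int a\<bar> \<le> real L" using that by (auto simp: abs_le_iff)
    then have "\<bar>of_int a / M\<bar> \<le> 1 / 2" using M by (simp add: abs_divide M_def field_simps)
    then have "\<bar>of_int a / M\<bar> \<le> 1 - \<eta>" using \<eta> by linarith
    then have "fejer_kernel N (of_int a / M) \<le> C / real N" by (rule C[OF True])
    from divide_right_mono[OF this, of M] show ?thesis
      using True M unfolding w_def grid_weight_def M_def[symmetric] by simp
  qed (use \<open>0 \<le> C\<close> M in \<open>simp add: w_def\<close>)
  have sum_w: "(\<Sum>a\<in>{-int L..int L}. w j a) \<le> C / real N" for j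
  proof -
    have "(\<Sum>a\<in>{-int L..int L}. w j a) \<le> of_nat (card {-int L..int L}) * (C / real N / M)"
      by (rule sum_bounded_above) (rule w_le)
    also have "real (card {-int L..int L}) = M" by (simp add: M_def)
    also have "M * (C / real N / M) = C / real N" using M by simp
    finally show ?thesis .
  qed
  have "(\<Sum>a\<in>{a\<in>grid J L. \<exists>j\<in>J. \<eta> \<le> \<bar>grid_shift J L a j\<bar>}. grid_prod J N L a)
      = (\<Sum>a\<in>grid J L. if \<exists>j\<in>J. \<eta> \<le> \<bar>grid_shift J L a j\<bar> then grid_prod J N L a else 0)"
    by (rule sum.inter_filter[OF finite_grid[OF J]])
  also have "\<dots> \<le> (\<Sum>a\<in>grid J L. \<Sum>j\<in>J. \<Prod>i\<in>J. if i = j then w j (a i) else grid_weight N L (a i))"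
  proof (rule sum_mono)
    fix a
    have nonneg: "0 \<le> (\<Prod>i\<in>J. if i = j then w j (a i) else grid_weight N L (a i))" for j
      by (auto intro!: prod_nonneg simp: w_nonneg grid_weight_nonneg)
    show "(if \<exists>j\<in>J. \<eta> \<le> \<bar>grid_shift J L a j\<bar> then grid_prod J N L a else 0)
       \<le> (\<Sum>j\<in>J. \<Prod>i\<in>J. if i = j then w j (a i) else grid_weight N L (a i))"
    proof (cases "\<exists>j\<in>J. \<eta> \<le> \<bar>grid_shift J L a j\<bar>")
      case True
      then obtain j where j: "j \<in> J" "\<eta> \<le> \<bar>of_int (a j) / M\<bar>" by (auto simp: grid_shift_def M_def)
      then have "grid_prod J N L a = (\<Prod>i\<in>J. if i = j then w j (a i) else grid_weight N L (a i))"
        by (auto simp: grid_prod_def w_def intro!: prod.cong)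
      also have "\<dots> \<le> (\<Sum>j\<in>J. \<Prod>i\<in>J. if i = j then w j (a i) else grid_weight N L (a i))"
        by (rule member_le_sum[OF j(1) nonneg J])
      finally show ?thesis using True by simp
    qed (simp add: sum_nonneg nonneg)
  qed
  also have "\<dots> = (\<Sum>j\<in>J. \<Sum>a\<in>grid J L. \<Prod>i\<in>J. if i = j then w j (a i) else grid_weight N L (a i))"
    by (rule sum.swap)
  also have "\<dots> \<le> (\<Sum>j\<in>J. C / real N)"
  proof (rule sum_mono)
    fix j assume j: "j \<in> J"
    have "(\<Sum>a\<in>grid J L. \<Prod>i\<in>J. if i = j then w j (a i) else grid_weight N L (a i))
       = (\<Prod>i\<in>J. \<Sum>b\<in>{-int L..int L}. if i = j then w j b else grid_weight N L b)"
      unfolding grid_def by (rule prod_sum_PiE[symmetric]) (use J in auto)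
    also have "\<dots> = (\<Prod>i\<in>J. if i = j then (\<Sum>b\<in>{-int L..int L}. w j b) else 1)"
      by (intro prod.cong refl) (simp add: grid_weight_total[OF N])
    also have "\<dots> \<le> C / real N" using j J sum_w by simp
    finally show "(\<Sum>a\<in>grid J L. \<Prod>i\<in>J. if i = j then w j (a i) else grid_weight N L (a i)) \<le> C / real N" .
  qed
  finally show ?thesis by simp
qed

text \<open>The total weight is 1, so the difference is the weighted mean of
  \<open>\<phi> a - v\<close>; grid points near 0 contribute at most \<epsilon>, the others at most
  K times the tail mass.\<close>

lemma grid_average_near:
  fixes \<phi> :: "(nat \<Rightarrow> int) \<Rightarrow> complex"
  assumes J: "finite J" and N: "N > 0" "N \<le> 2 * L + 1" and \<eta>: "\<eta> \<le> 1 / 2"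
    and C: "\<And>x. \<eta> \<le> \<bar>x\<bar> \<Longrightarrow> \<bar>x\<bar> \<le> 1 - \<eta> \<Longrightarrow> fejer_kernel N x \<le> C / real N"
    and "0 \<le> C" "0 \<le> \<epsilon>"
    and far: "\<And>a. a \<in> grid J L \<Longrightarrow> norm (\<phi> a - v) \<le> K"
    and near: "\<And>a. a \<in> grid J L \<Longrightarrow> (\<forall>j\<in>J. \<bar>grid_shift J L a j\<bar> < \<eta>) \<Longrightarrow> norm (\<phi> a - v) \<le> \<epsilon>"
    and "0 \<le> K"
  shows "norm ((\<Sum>a\<in>grid J L. of_real (grid_prod J N L a) * \<phi> a) - v)
     \<le> \<epsilon> + K * (real (card J) * (C / real N))"
proof -
  let ?bad = "\<lambda>a. \<exists>j\<in>J. \<eta> \<le> \<bar>grid_shift J L a j\<bar>"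
  note total = grid_prod_total[OF J N]
  have "(\<Sum>a\<in>grid J L. of_real (grid_prod J N L a) * \<phi> a) - v
      = (\<Sum>a\<in>grid J L. of_real (grid_prod J N L a) * \<phi> a) - of_real (\<Sum>a\<in>grid J L. grid_prod J N L a) * v"
    by (simp add: total)
  also have "\<dots> = (\<Sum>a\<in>grid J L. of_real (grid_prod J N L a) * (\<phi> a - v))"
    by (simp add: right_diff_distrib sum_subtractf sum_distrib_right)
  also have "norm \<dots> \<le> (\<Sum>a\<in>grid J L. grid_prod J N L a * \<epsilon> + K * (if ?bad a then grid_prod J N L a else 0))"
  proof (rule sum_norm_le)
    fix a assume a: "a \<in> grid J L"
    have "norm (of_real (grid_prod J N L a) * (\<phi> a - v)) = grid_prod J N L a * norm (\<phi> a - v)"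
      by (simp add: norm_mult grid_prod_nonneg)
    also have "\<dots> \<le> grid_prod J N L a * \<epsilon> + K * (if ?bad a then grid_prod J N L a else 0)"
    proof (cases "?bad a")
      case True
      then show ?thesis
        using far[OF a] grid_prod_nonneg[of J N L a] \<open>0 \<le> \<epsilon>\<close>
        by (simp add: mult.commute[of K] add_increasing mult_left_mono)
    next
      case False
      then show ?thesis
        using near[OF a] grid_prod_nonneg[of J N L a] unfolding if_not_P[OF False]
        by (simp add: not_le mult_left_mono)
    qed
    finally show "norm (of_real (grid_prod J N L a) * (\<phi> a - v)) \<le>
      grid_prod J N L a * \<epsilon> + K * (if ?bad a then grid_prod J N L a else 0)" .
  qed
  also have "\<dots> = \<epsilon> + K * (\<Sum>a\<in>{a\<in>grid J L. ?bad a}. grid_prod J N L a)"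
    unfolding sum.inter_filter[OF finite_grid[OF J]]
    by (simp add: sum.distrib sum_distrib_right[symmetric] sum_distrib_left[symmetric] total)
  also have "\<dots> \<le> \<epsilon> + K * (real (card J) * (C / real N))"
    using grid_tail[OF J N \<eta> C \<open>0 \<le> C\<close>] \<open>0 \<le> K\<close> by (intro add_left_mono mult_left_mono) auto
  finally show ?thesis .
qed

definition lattice_box :: "nat set \<Rightarrow> nat \<Rightarrow> (nat \<Rightarrow> real) set"
  where "lattice_box J N = {v \<in> coord_lattice J. \<forall>j\<in>J. \<bar>v j\<bar> < real N}"

lemma finite_lattice_box: "finite J \<Longrightarrow> finite (lattice_box J N)"
  by (rule finite_subset[OF _ finite_bounded_lattice[of J "real N"]]) (auto simp: lattice_box_def less_imp_le)

lemma box_weight_eq_0: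
  assumes "finite J" "v \<in> coord_lattice J" "v \<notin> lattice_box J N"
  shows "box_weight J N v = 0"
proof -
  obtain j where j: "j \<in> J" "real N \<le> \<bar>v j\<bar>"
    using assms by (auto simp: lattice_box_def not_less)
  moreover have "real_of_int \<lfloor>v j\<rfloor> = v j" using assms(2) by (simp add: coord_lattice_def)
  ultimately have "int N \<le> \<bar>\<lfloor>v j\<rfloor>\<bar>" by linarith
  then have "fejer_weight N \<lfloor>v j\<rfloor> = 0" by (simp add: fejer_weight_def)
  then show ?thesis using assms(1) j(1) by (auto simp: box_weight_def)
qed

lemma box_weight_nonneg: "0 \<le> box_weight J N v"
  and box_weight_le_1: "box_weight J N v \<le> 1"
  by (auto simp: box_weight_def fejer_weight_nonneg fejer_weight_le_1 intro!: prod_nonneg prod_le_1)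

lemma box_weight_tendsto: "(\<lambda>N. box_weight J N v) \<longlonglongrightarrow> 1"
proof -
  have "(\<lambda>N. \<Prod>j\<in>J. fejer_weight N \<lfloor>v j\<rfloor>) \<longlonglongrightarrow> (\<Prod>j\<in>J. 1)"
    by (intro tendsto_intros fejer_weight_tendsto)
  then show ?thesis by (simp add: box_weight_def)
qed

section \<open>Basis sums weighted in the coordinates of v\<close>

context lattice_basis
begin

definition box_sum :: "(idx \<Rightarrow> complex) \<Rightarrow> (nat \<Rightarrow> real) \<Rightarrow> nat \<Rightarrow> complex"
  where "box_sum t y N = (\<Sum>v\<in>lattice_box J N. of_real (box_weight J N v) * char_at J y v *
     (\<Prod>f\<in>B. 1 / (of_real (lin_form J F v f) - t f)))"

text \<open>Bounds on the forms of B bound v through its expansion in the dual basis;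
  \<open>D f\<close> allows for the constant term of the form.\<close>

lemma finite_support_box: "finite (support_box N)"
proof (rule finite_subset)
  define D where "D f = real N + \<bar>Re (dot_of F f)\<bar>" for f
  define C where "C = (\<Sum>j\<in>J. \<Sum>f\<in>B. D f * \<bar>dual f j\<bar>)"
  have D0: "0 \<le> D f" for f by (simp add: D_def)
  show "support_box N \<subseteq> {v \<in> coord_lattice J. \<forall>j\<in>J. \<bar>v j\<bar> \<le> C}"
  proof
    fix v assume v: "v \<in> support_box N"
    then have vl: "v \<in> coord_lattice J" by (simp add: support_box_def)
    have "\<bar>v j\<bar> \<le> C" if "j \<in> J" for j
    proof -
      have "v j = (\<Sum>f\<in>B. coord_inner J (vec_of F f) v * dual f j)"
        by (subst (1) dual_expansion[OF coord_lattice_imp_space[OF vl]]) (simp add: sum_fun_apply)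
      also have "\<bar>\<dots>\<bar> \<le> (\<Sum>f\<in>B. \<bar>coord_inner J (vec_of F f) v * dual f j\<bar>)" by (rule sum_abs)
      also have "\<dots> \<le> (\<Sum>f\<in>B. D f * \<bar>dual f j\<bar>)"
      proof (rule sum_mono)
        fix f assume "f \<in> B"
        then have "\<bar>lin_form J F v f\<bar> < real N" using v by (simp add: support_box_def)
        then have "\<bar>coord_inner J (vec_of F f) v\<bar> \<le> D f" by (simp add: lin_form_def D_def)
        then show "\<bar>coord_inner J (vec_of F f) v * dual f j\<bar> \<le> D f * \<bar>dual f j\<bar>"
          by (simp add: abs_mult mult_right_mono)
      qed
      also have "\<dots> \<le> C"
        unfolding C_def by (rule member_le_sum[OF that _ finite_J]) (auto intro!: sum_nonneg mult_nonneg_nonneg D0)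
      finally show ?thesis .
    qed
    then show "v \<in> {v \<in> coord_lattice J. \<forall>j\<in>J. \<bar>v j\<bar> \<le> C}" using vl by blast
  qed
  show "finite {v \<in> coord_lattice J. \<forall>j\<in>J. \<bar>v j\<bar> \<le> C}"
    by (rule finite_bounded_lattice[OF finite_J])
qed

text \<open>Carries both weights and thereby links the two means: it tends to \<open>box_sum\<close>
  as \<open>N'\<close> grows, and for fixed \<open>N'\<close> and N > 0 it is a grid average of
  \<open>fejer_sum\<close>.\<close>

definition double_sum :: "(idx \<Rightarrow> complex) \<Rightarrow> (nat \<Rightarrow> real) \<Rightarrow> nat \<Rightarrow> nat \<Rightarrow> complex"
  where "double_sum t y N N' = (\<Sum>v\<in>lattice_box J N. of_real (box_weight J N v) * char_at J y v *
     (\<Prod>f\<in>B. of_real (fejer_weight N' \<lfloor>lin_form J F v f\<rfloor>) / (of_real (lin_form J F v f) - t f)))"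

lemma double_sum_tendsto: "(\<lambda>N'. double_sum t y N N') \<longlonglongrightarrow> box_sum t y N"
  unfolding double_sum_def box_sum_def divide_inverse
  by (intro tendsto_sum tendsto_mult tendsto_const tendsto_prod)
    (use tendsto_of_real[OF fejer_weight_tendsto] in auto)

lemma double_sum_grid:
  assumes N: "N > 0"
  obtains L where "N \<le> 2 * L + 1"
    "double_sum t y N N' = (\<Sum>a\<in>grid J L. of_real (grid_prod J N L a) * fejer_sum t N' (y - grid_shift J L a))"
proof -
  define b where "b v = (\<Prod>f\<in>B. of_real (fejer_weight N' \<lfloor>lin_form J F v f\<rfloor>) / (of_real (lin_form J F v f) - t f))" for v
  have "finite ((\<lambda>(v, j). \<bar>v j\<bar>) ` (support_box N' \<times> J))"
    using finite_support_box finite_J by auto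
  then obtain C where C: "\<And>v j. v \<in> support_box N' \<Longrightarrow> j \<in> J \<Longrightarrow> \<bar>v j\<bar> \<le> C"
    using bdd_above_finite by (fastforce simp: bdd_above_def)
  \<comment> \<open>C bounds all coordinates on the finite support of the expansion of
    \<open>fejer_sum\<close>, so this grid is fine enough for every frequency that occurs.\<close>
  define L where "L = nat \<lceil>C\<rceil> + N"
  have L: "\<bar>v j\<bar> + real N \<le> 2 * real L + 1" if "v \<in> support_box N'" "j \<in> J" for v j
  proof -
    have "C \<le> real (nat \<lceil>C\<rceil>)" by linarith
    then have "\<bar>v j\<bar> \<le> real (nat \<lceil>C\<rceil>)" using C[OF that] by linarith
    moreover have "0 \<le> real (nat \<lceil>C\<rceil>)" "0 \<le> real N" by simp_all
    ultimately show ?thesis unfolding L_def of_nat_add by argo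
  qed
  have "(\<Sum>a\<in>grid J L. of_real (grid_prod J N L a) * fejer_sum t N' (y - grid_shift J L a))
     = (\<Sum>a\<in>grid J L. \<Sum>v\<in>support_box N'. of_real (grid_prod J N L a) * char_at J (y - grid_shift J L a) v * b v)"
    by (simp add: fejer_sum_expansion b_def sum_distrib_left mult_ac)
  also have "\<dots> = (\<Sum>v\<in>support_box N'. (\<Sum>a\<in>grid J L. of_real (grid_prod J N L a) * char_at J (y - grid_shift J L a) v) * b v)"
    by (subst sum.swap) (simp add: sum_distrib_right)
  also have "\<dots> = (\<Sum>v\<in>support_box N'. of_real (box_weight J N v) * char_at J y v * b v)"
    using L by (intro sum.cong refl arg_cong2[where f = "(*)"] grid_average_char finite_J N)
      (auto simp: support_box_def)
  also have "\<dots> = (\<Sum>v\<in>support_box N' \<inter> lattice_box J N. of_real (box_weight J N v) * char_at J y v * b v)"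
    using finite_support_box box_weight_eq_0[OF finite_J]
    by (intro sum.mono_neutral_right) (auto simp: support_box_def)
  also have "\<dots> = (\<Sum>v\<in>lattice_box J N. of_real (box_weight J N v) * char_at J y v * b v)"
  proof (rule sum.mono_neutral_left[OF finite_lattice_box[OF finite_J]])
    show "\<forall>v\<in>lattice_box J N - support_box N' \<inter> lattice_box J N.
        of_real (box_weight J N v) * char_at J y v * b v = 0"
    proof
      fix v assume v: "v \<in> lattice_box J N - support_box N' \<inter> lattice_box J N"
      then obtain f where f: "f \<in> B" "real N' \<le> \<bar>lin_form J F v f\<bar>"
        by (auto simp: support_box_def lattice_box_def not_less)
      moreover have "real_of_int \<lfloor>lin_form J F v f\<rfloor> = lin_form J F v f"
        using lin_form_Ints[OF _ f(1)] v by (simp add: lattice_box_def)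
      ultimately have "int N' \<le> \<bar>\<lfloor>lin_form J F v f\<rfloor>\<bar>" by linarith
      then have "fejer_weight N' \<lfloor>lin_form J F v f\<rfloor> = 0" by (simp add: fejer_weight_def)
      then have "b v = 0" using f(1) finite_B by (auto simp: b_def)
      then show "of_real (box_weight J N v) * char_at J y v * b v = 0" by simp
    qed
  qed auto
  finally show ?thesis
    using that[of L] by (simp add: double_sum_def b_def L_def)
qed

text \<open>A grid average of \<open>fejer_sum\<close> inherits its uniform bound, and the bound
  survives the limit in \<open>N'\<close>.\<close>

lemma norm_box_sum_le:
  assumes "\<And>f. f \<in> B \<Longrightarrow> expi (t f) \<noteq> 1"
  shows "norm (box_sum t y N) \<le> (\<Prod>f\<in>B. 2 * pi * exp (2 * pi * norm (t f)) / norm (expi (t f) - 1))"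
    (is "_ \<le> ?M")
\<comment> \<open>The grid average requires N > 0. For N = 0 the box is empty, except for empty J,
  where the sum does not depend on N.\<close>
proof (cases "N = 0 \<and> J \<noteq> {}")
  case True
  then have "lattice_box J N = {}" by (auto simp: lattice_box_def)
  then show ?thesis by (simp add: box_sum_def prod_nonneg)
next
  case not_trivial: False
  have bound: "norm (double_sum t y N N') \<le> ?M" if N: "N > 0" for N N'
  proof -
    obtain L where L: "N \<le> 2 * L + 1"
      "double_sum t y N N' = (\<Sum>a\<in>grid J L. of_real (grid_prod J N L a) * fejer_sum t N' (y - grid_shift J L a))"
      using double_sum_grid[OF N] by blast
    have "norm (double_sum t y N N') \<le> (\<Sum>a\<in>grid J L. grid_prod J N L a * ?M)"
      unfolding L(2)
    proof (rule sum_norm_le)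
      fix a
      show "norm (of_real (grid_prod J N L a) * fejer_sum t N' (y - grid_shift J L a)) \<le> grid_prod J N L a * ?M"
        using norm_fejer_sum_le[OF assms, of "\<lambda>f. f" N' "y - grid_shift J L a"] grid_prod_nonneg[of J N L a]
        by (simp add: norm_mult mult_left_mono)
    qed
    also have "\<dots> = ?M"
      by (simp add: sum_distrib_right[symmetric] grid_prod_total[OF finite_J N L(1)])
    finally show ?thesis .
  qed
  have "norm (box_sum t y N) \<le> ?M" if N: "N > 0" for N
    by (rule LIMSEQ_le_const2[OF tendsto_norm[OF double_sum_tendsto]]) (use bound[OF N] in auto)
  moreover have "box_sum t y 0 = box_sum t y 1" if "J = {}"
    unfolding box_sum_def lattice_box_def box_weight_def using that by simp
  ultimately show ?thesis using not_trivial by (cases "N = 0") auto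
qed

text \<open>\<open>N'\<close> goes to infinity before N. For fixed N, \<open>double_sum\<close>
  averages values of \<open>fejer_sum\<close> near y, which are close to \<open>lerch_sum\<close>
  for large \<open>N'\<close>, and values elsewhere, which are bounded and carry mass of order 1 /
  N.\<close>

theorem box_sum_tendsto:
  assumes t: "\<And>f. f \<in> B \<Longrightarrow> expi (t f) \<noteq> 1" and y: "off_walls y"
  shows "(\<lambda>N. box_sum t y N) \<longlonglongrightarrow> lerch_sum t y"
proof (rule LIMSEQ_I)
  fix \<epsilon> :: real assume \<epsilon>: "0 < \<epsilon>"
  define M where "M = (\<Prod>f\<in>B. 2 * pi * exp (2 * pi * norm (t f)) / norm (expi (t f) - 1))"
  define K where "K = M + norm (lerch_sum t y)"
  have K: "0 \<le> K" by (auto simp: K_def M_def intro!: add_nonneg_nonneg prod_nonneg)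
  \<comment> \<open>Only the coordinates in J matter for convergence of the points, hence a filter
    pulled back along this distance instead of a neighbourhood filter of functions.\<close>
  define \<delta> where "\<delta> z = (\<Sum>j\<in>J. \<bar>z j - y j\<bar>)" for z :: "nat \<Rightarrow> real"
  define G where "G = sequentially \<times>\<^sub>F filtercomap \<delta> (nhds 0)"
  have "((\<lambda>p. fejer_sum t (fst p) (snd p)) \<longlongrightarrow> lerch_sum t y) G"
  proof (rule fejer_sum_tendsto[OF t y])
    show "filterlim fst sequentially G" unfolding G_def by (rule filterlim_fst)
    fix j assume j: "j \<in> J"
    have "((\<lambda>p. \<delta> (snd p)) \<longlongrightarrow> 0) G"
      unfolding G_def by (rule filterlim_compose[OF filterlim_filtercomap filterlim_snd])
    then have "((\<lambda>p. snd p j - y j) \<longlongrightarrow> 0) G"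
    proof (rule Lim_null_comparison[rotated])
      show "\<forall>\<^sub>F p in G. norm (snd p j - y j) \<le> \<delta> (snd p)"
        unfolding \<delta>_def using j finite_J by (intro always_eventually allI) (auto intro!: member_le_sum[where f = "\<lambda>j. \<bar>_ j - y j\<bar>"])
    qed
    then show "((\<lambda>p. snd p j) \<longlongrightarrow> y j) G" by (rule LIM_zero_cancel)
  qed auto
  then have "\<forall>\<^sub>F p in G. dist (fejer_sum t (fst p) (snd p)) (lerch_sum t y) < \<epsilon> / 4"
    using \<epsilon> by (intro tendstoD) auto
  then obtain P Q where P: "eventually P sequentially" and Q: "eventually Q (filtercomap \<delta> (nhds 0))"
    and PQ: "\<And>N z. P N \<Longrightarrow> Q z \<Longrightarrow> dist (fejer_sum t N z) (lerch_sum t y) < \<epsilon> / 4"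
    unfolding G_def by (auto simp: eventually_prod_filter)
  from Q obtain e where e: "e > 0" "\<And>z. \<bar>\<delta> z\<bar> < e \<Longrightarrow> Q z"
    by (auto simp: eventually_filtercomap eventually_nhds_metric dist_real_def)
  \<comment> \<open>The bound 1/2 serves the tail estimate; the other one makes the sum of
    \<open>card J\<close> coordinate distances smaller than e.\<close>
  define \<eta> where "\<eta> = min (1 / 2) (e / (real (card J) + 1))"
  have \<eta>: "0 < \<eta>" "\<eta> \<le> 1 / 2" using e(1) unfolding \<eta>_def by (auto simp del: min_less_iff_conj min.bounded_iff simp: min_def)
  have near: "Q z" if "\<forall>j\<in>J. \<bar>z j - y j\<bar> < \<eta>" for z
  proof (rule e(2))
    have "\<delta> z \<le> (\<Sum>j\<in>J. e / (real (card J) + 1))"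
      unfolding \<delta>_def using that by (intro sum_mono) (auto simp: \<eta>_def intro: less_imp_le)
    also have "\<dots> < e" using e(1) by (simp add: field_simps)
    finally show "\<bar>\<delta> z\<bar> < e" by (simp add: \<delta>_def sum_nonneg)
  qed
  obtain C where C: "0 \<le> C" "\<And>x N. \<eta> \<le> \<bar>x\<bar> \<Longrightarrow> \<bar>x\<bar> \<le> 1 - \<eta> \<Longrightarrow> fejer_kernel N x \<le> C / real N"
    using fejer_kernel_tail[OF \<eta>(1)] by blast
  have main: "norm (box_sum t y N - lerch_sum t y) \<le> \<epsilon> / 4 + K * (real (card J) * (C / real N))" if N: "N > 0" for N
  proof (rule LIMSEQ_le_const2)
    show "(\<lambda>N'. norm (double_sum t y N N' - lerch_sum t y)) \<longlonglongrightarrow> norm (box_sum t y N - lerch_sum t y)"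
      by (intro tendsto_intros double_sum_tendsto)
    from P obtain N0 where N0: "\<And>N'. N' \<ge> N0 \<Longrightarrow> P N'" by (auto simp: eventually_sequentially)
    have "norm (double_sum t y N N' - lerch_sum t y) \<le> \<epsilon> / 4 + K * (real (card J) * (C / real N))" if N': "N' \<ge> N0" for N'
    proof -
      obtain L where L: "N \<le> 2 * L + 1"
        "double_sum t y N N' = (\<Sum>a\<in>grid J L. of_real (grid_prod J N L a) * fejer_sum t N' (y - grid_shift J L a))"
        using double_sum_grid[OF N] by blast
      show ?thesis
        unfolding L(2)
      proof (rule grid_average_near[OF finite_J N L(1) \<eta>(2) C(2) C(1) _ _ _ K])
        fix a
        have "norm (fejer_sum t N' (y - grid_shift J L a) - lerch_sum t y)
           \<le> norm (fejer_sum t N' (y - grid_shift J L a)) + norm (lerch_sum t y)" by (rule norm_triangle_ineq4)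
        also have "\<dots> \<le> K"
          using norm_fejer_sum_le[OF t, of "\<lambda>f. f" N' "y - grid_shift J L a"] by (simp add: K_def M_def)
        finally show "norm (fejer_sum t N' (y - grid_shift J L a) - lerch_sum t y) \<le> K" .
        assume "\<forall>j\<in>J. \<bar>grid_shift J L a j\<bar> < \<eta>"
        then have "Q (y - grid_shift J L a)" by (intro near) auto
        from PQ[OF N0[OF N'] this]
        show "norm (fejer_sum t N' (y - grid_shift J L a) - lerch_sum t y) \<le> \<epsilon> / 4"
          by (simp add: dist_norm)
      qed (use \<epsilon> in auto)
    qed
    then show "\<exists>N0. \<forall>N'\<ge>N0. norm (double_sum t y N N' - lerch_sum t y) \<le> \<epsilon> / 4 + K * (real (card J) * (C / real N))"
      by blast
  qed
  have "(\<lambda>N. K * (real (card J) * (C / real N))) \<longlonglongrightarrow> K * (real (card J) * 0)"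
    by (intro tendsto_intros lim_const_over_n)
  then have "\<forall>\<^sub>F N in sequentially. K * (real (card J) * (C / real N)) < \<epsilon> / 4"
    using \<epsilon> by (intro order_tendstoD(2)[of _ 0]) auto
  then have "\<forall>\<^sub>F N in sequentially. norm (box_sum t y N - lerch_sum t y) < \<epsilon>"
    using eventually_gt_at_top[of 0]
  proof eventually_elim
    case (elim N)
    then show ?case using main[of N] \<epsilon> by linarith
  qed
  then show "\<exists>N0. \<forall>N\<ge>N0. norm (box_sum t y N - lerch_sum t y) < \<epsilon>"
    by (simp add: eventually_sequentially)
qed

end

section \<open>Power series in several variables\<close>

text \<open>Dominated convergence for the counting measure, transferred from the Lebesgue
  integral.\<close>

lemma tendsto_infsum_dominated:
  fixes f :: "nat \<Rightarrow> 'a \<Rightarrow> complex"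
  assumes g: "g summable_on A" and bound: "\<And>j x. x \<in> A \<Longrightarrow> norm (f j x) \<le> g x"
    and lim: "\<And>x. x \<in> A \<Longrightarrow> (\<lambda>j. f j x) \<longlonglongrightarrow> h x"
  shows "h summable_on A" "(\<lambda>j. infsum (f j) A) \<longlonglongrightarrow> infsum h A"
proof -
  have g0: "0 \<le> g x" if "x \<in> A" for x using bound[OF that, of 0] norm_ge_zero[of "f 0 x"] by linarith
  have hb: "norm (h x) \<le> g x" if "x \<in> A" for x
    by (rule LIMSEQ_le_const2[OF tendsto_norm[OF lim[OF that]]]) (use bound[OF that] in auto)
  have abs: "Infinite_Set_Sum.abs_summable_on w A" if "\<And>x. x \<in> A \<Longrightarrow> norm (w x) \<le> g x" for w :: "'a \<Rightarrow> complex"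
  proof -
    have "(\<lambda>x. norm (w x)) summable_on A"
      by (rule summable_on_comparison_test[OF g]) (use that in auto)
    then show ?thesis by (simp only: abs_summable_equivalent)
  qed
  have "(\<lambda>x. norm (g x)) summable_on A \<longleftrightarrow> g summable_on A"
    by (rule summable_on_cong) (use g0 in auto)
  then have "Infinite_Set_Sum.abs_summable_on g A"
    unfolding abs_summable_equivalent[symmetric] using g by simp
  then have "integrable (count_space A) g" by (simp add: Infinite_Set_Sum.abs_summable_on_def)
  then have "(\<lambda>j. infsetsum (f j) A) \<longlonglongrightarrow> infsetsum h A"
    unfolding infsetsum_def
    by (intro integral_dominated_convergence[where w = g]) (use bound lim in auto)
  then show "(\<lambda>j. infsum (f j) A) \<longlonglongrightarrow> infsum h A"
    using abs[OF hb] abs[OF bound] by (simp add: infsetsum_infsum)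
  show "h summable_on A"
    using abs[OF hb] abs_summable_equivalent abs_summable_summable by blast
qed

lemma has_sum_sum_pointwise:
  fixes f :: "'s \<Rightarrow> 'a \<Rightarrow> complex"
  assumes "finite S" "\<And>s. s \<in> S \<Longrightarrow> (f s has_sum a s) A"
  shows "((\<lambda>x. \<Sum>s\<in>S. f s x) has_sum (\<Sum>s\<in>S. a s)) A"
  using assms by (induction S rule: finite_induct) (auto intro: has_sum_add)

lemma has_sum_prod_multi_indices:
  fixes a :: "idx \<Rightarrow> nat \<Rightarrow> complex"
  assumes L: "finite L" and a: "\<And>f. f \<in> L \<Longrightarrow> (\<lambda>k. norm (a f k)) summable_on UNIV"
    and s: "\<And>f. f \<in> L \<Longrightarrow> (a f has_sum s f) UNIV"
  shows "(\<lambda>n. norm (\<Prod>f\<in>L. a f (n f))) summable_on multi_indices L"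
    and "((\<lambda>n. \<Prod>f\<in>L. a f (n f)) has_sum (\<Prod>f\<in>L. s f)) (multi_indices L)"
proof -
  have "Infinite_Set_Sum.abs_summable_on (\<lambda>n. \<Prod>f\<in>L. a f (n f)) (multi_indices L)"
    unfolding multi_indices_def
    by (intro Infinite_Set_Sum.abs_summable_on_prod_PiE L) (use a in \<open>auto simp: abs_summable_equivalent[symmetric]\<close>)
  then show *: "(\<lambda>n. norm (\<Prod>f\<in>L. a f (n f))) summable_on multi_indices L"
    by (simp only: abs_summable_equivalent)
  have "infsum (\<lambda>n. \<Prod>f\<in>L. a f (n f)) (multi_indices L) = (\<Prod>f\<in>L. infsum (a f) UNIV)"
    unfolding multi_indices_def by (rule infsum_prod_PiE_abs[OF L]) (rule a)
  also have "\<dots> = (\<Prod>f\<in>L. s f)" using s by (intro prod.cong refl infsumI)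
  finally show "((\<lambda>n. \<Prod>f\<in>L. a f (n f)) has_sum (\<Prod>f\<in>L. s f)) (multi_indices L)"
    using abs_summable_summable[OF *] by (simp add: has_sum_iff)
qed

lemma countable_multi_indices: "finite L \<Longrightarrow> countable (multi_indices L)"
  unfolding multi_indices_def by (intro countable_PiE) auto

lemma geometric_has_sum:
  fixes x :: complex
  assumes "norm x < 1"
  shows "(\<lambda>k. norm (x ^ k)) summable_on UNIV" "((\<lambda>k. x ^ k) has_sum 1 / (1 - x)) UNIV"
proof -
  have "summable (\<lambda>k. norm (x ^ k))" using assms by (simp add: norm_power summable_geometric)
  then show *: "(\<lambda>k. norm (x ^ k)) summable_on UNIV"
    by (subst summable_on_UNIV_nonneg_real_iff) auto
  show "((\<lambda>k. x ^ k) has_sum 1 / (1 - x)) UNIV"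
    using geometric_sums[OF assms] * by (intro norm_summable_imp_has_sum) (auto simp: summable_on_UNIV_nonneg_real_iff)
qed

lemma roots_of_unity_sum:
  assumes "N > 0"
  shows "(\<Sum>s<N. expi (of_real (real s * of_int k / real N))) = (if int N dvd k then of_nat N else 0)"
proof -
  define z where "z = expi (of_real (of_int k / real N))"
  have z_iff: "z = 1 \<longleftrightarrow> int N dvd k"
  proof -
    have "z = 1 \<longleftrightarrow> of_int k / real N \<in> \<int>" unfolding z_def by (rule expi_of_real_eq_1_iff)
    also have "\<dots> \<longleftrightarrow> (\<exists>n::int. real_of_int k = of_int (int N * n))"
      using assms by (auto simp: Ints_def field_simps)
    also have "\<dots> \<longleftrightarrow> int N dvd k" by (simp only: of_int_eq_iff dvd_def)
    finally show ?thesis .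
  qed
  have zN: "z ^ N = 1"
    unfolding z_def expi_of_nat_mult[symmetric] using assms by simp
  have "(\<Sum>s<N. expi (of_real (real s * of_int k / real N))) = (\<Sum>s<N. z ^ s)"
    unfolding z_def expi_of_nat_mult[symmetric] by simp
  also have "\<dots> = (if int N dvd k then of_nat N else 0)"
    using zN z_iff by (cases "z = 1") (auto simp: geometric_sum)
  finally show ?thesis .
qed

text \<open>Averaging over the points \<open>\<delta> \<cdot> \<omega>\<close> with \<open>N\<close>-th roots of unity \<open>\<omega>\<close> isolates the coefficients with
  indices congruent to \<open>n0\<close> modulo \<open>N\<close>; only \<open>n0\<close> itself survives as \<open>N\<close> grows.\<close>

lemma cauchy_estimate:
  fixes b :: "(idx \<Rightarrow> nat) \<Rightarrow> complex"
  assumes L: "finite L" and \<delta>: "\<And>f. f \<in> L \<Longrightarrow> \<delta> f > 0"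
    and b: "(\<lambda>n. norm (b n) * (\<Prod>f\<in>L. \<delta> f ^ n f)) summable_on multi_indices L"
    and H: "\<And>t. (\<forall>f\<in>L. norm (t f) = \<delta> f) \<Longrightarrow>
      norm (\<Sum>\<^sub>\<infinity>n\<in>multi_indices L. b n * (\<Prod>f\<in>L. t f ^ n f)) \<le> M"
    and n0: "n0 \<in> multi_indices L"
  shows "norm (b n0) * (\<Prod>f\<in>L. \<delta> f ^ n0 f) \<le> M"
proof -
  define a where "a n = b n * of_real (\<Prod>f\<in>L. \<delta> f ^ n f)" for n
  have norm_a: "norm (a n) = norm (b n) * (\<Prod>f\<in>L. \<delta> f ^ n f)" for n
  proof -
    have "0 \<le> (\<Prod>f\<in>L. \<delta> f ^ n f)" using \<delta> by (intro prod_nonneg) (auto intro: less_imp_le)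
    then show ?thesis unfolding a_def norm_mult norm_of_real by simp
  qed
  have a_sum: "(\<lambda>n. norm (a n)) summable_on multi_indices L" using b by (simp only: norm_a)
  define c where "c N n = (if \<forall>f\<in>L. int N dvd int (n f) - int (n0 f) then a n else 0)" for N n
  have bound: "norm (infsum (c N) (multi_indices L)) \<le> M" if N: "N > 0" for N
  proof -
    define S where "S = L \<rightarrow>\<^sub>E {..<N}"
    define \<omega> where "\<omega> s f = expi (of_real (real (s f) / real N))" for s :: "idx \<Rightarrow> nat" and f
    define t where "t s f = of_real (\<delta> f) * \<omega> s f" for s f
    define u where "u s = (\<Prod>f\<in>L. expi (- of_real (real (s f) * real (n0 f) / real N)))" for s :: "idx \<Rightarrow> nat"
    have S: "finite S" "card S = N ^ card L"
      using L by (auto simp: S_def finite_PiE card_PiE)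
    have norm_\<omega>: "norm (\<omega> s f) = 1" for s f by (simp only: \<omega>_def norm_expi_of_real)
    have term_eq: "b n * (\<Prod>f\<in>L. t s f ^ n f) = a n * (\<Prod>f\<in>L. \<omega> s f ^ n f)" for s n
      by (simp add: t_def a_def power_mult_distrib prod.distrib)
    have summ: "(\<lambda>n. b n * (\<Prod>f\<in>L. t s f ^ n f)) summable_on multi_indices L" for s
      unfolding term_eq
      by (rule abs_summable_summable, rule summable_on_comparison_test[OF a_sum])
        (auto simp: norm_mult norm_\<omega> norm_power simp flip: prod_norm)
    have *: "((\<lambda>n. \<Sum>s\<in>S. u s * (b n * (\<Prod>f\<in>L. t s f ^ n f))) has_sum
        (\<Sum>s\<in>S. u s * (\<Sum>\<^sub>\<infinity>n\<in>multi_indices L. b n * (\<Prod>f\<in>L. t s f ^ n f)))) (multi_indices L)"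
      by (intro has_sum_sum_pointwise has_sum_cmult_right has_sum_infsum summ S)
    have "(\<Sum>s\<in>S. u s * (b n * (\<Prod>f\<in>L. t s f ^ n f))) = of_nat (N ^ card L) * c N n" for n
    proof -
      have eq: "u s * (\<Prod>f\<in>L. \<omega> s f ^ n f)
          = (\<Prod>f\<in>L. expi (of_real (real (s f) * of_int (int (n f) - int (n0 f)) / real N)))" for s
        unfolding u_def prod.distrib[symmetric]
      proof (rule prod.cong[OF refl])
        fix f
        have "complex_of_real (real (s f) * of_int (int (n f) - int (n0 f)) / real N)
           = - of_real (real (s f) * real (n0 f) / real N) + of_nat (n f) * of_real (real (s f) / real N)"
          by (simp add: diff_divide_distrib right_diff_distrib mult.commute)
        then show "expi (- of_real (real (s f) * real (n0 f) / real N)) * \<omega> s f ^ n f =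
          expi (of_real (real (s f) * of_int (int (n f) - int (n0 f)) / real N))"
          unfolding \<omega>_def expi_of_nat_mult[symmetric] expi_add[symmetric] by (simp only:)
      qed
      have "(\<Sum>s\<in>S. u s * (b n * (\<Prod>f\<in>L. t s f ^ n f))) = a n * (\<Sum>s\<in>S. u s * (\<Prod>f\<in>L. \<omega> s f ^ n f))"
        by (simp add: term_eq sum_distrib_left mult_ac)
      also have "(\<Sum>s\<in>S. u s * (\<Prod>f\<in>L. \<omega> s f ^ n f))
          = (\<Prod>f\<in>L. \<Sum>s<N. expi (of_real (real s * of_int (int (n f) - int (n0 f)) / real N)))"
        unfolding eq S_def by (rule prod_sum_PiE[symmetric]) (use L in auto)
      also have "\<dots> = (\<Prod>f\<in>L. if int N dvd int (n f) - int (n0 f) then of_nat N else 0)"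
        by (simp only: roots_of_unity_sum[OF N])
      also have "\<dots> = (if \<forall>f\<in>L. int N dvd int (n f) - int (n0 f) then of_nat (N ^ card L) else 0)"
      proof (cases "\<forall>f\<in>L. int N dvd int (n f) - int (n0 f)")
        case False
        then show ?thesis using L by (auto intro!: prod_zero)
      qed simp
      finally show ?thesis by (simp add: c_def)
    qed
    with * have "((\<lambda>n. of_nat (N ^ card L) * c N n) has_sum
        (\<Sum>s\<in>S. u s * (\<Sum>\<^sub>\<infinity>n\<in>multi_indices L. b n * (\<Prod>f\<in>L. t s f ^ n f)))) (multi_indices L)"
      by simp
    then have "of_nat (N ^ card L) * infsum (c N) (multi_indices L)
       = (\<Sum>s\<in>S. u s * (\<Sum>\<^sub>\<infinity>n\<in>multi_indices L. b n * (\<Prod>f\<in>L. t s f ^ n f)))"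
      unfolding infsum_cmult_right'[symmetric] by (rule infsumI)
    also have "norm \<dots> \<le> of_nat (card S) * M"
    proof (rule sum_norm_bound)
      fix s
      have "norm (u s) = 1"
      proof -
        have "norm (expi (- of_real x)) = 1" for x using norm_expi_of_real[of "- x"] by simp
        then show ?thesis unfolding u_def prod_norm[symmetric] by (simp only: prod.neutral_const)
      qed
      moreover have "norm (\<Sum>\<^sub>\<infinity>n\<in>multi_indices L. b n * (\<Prod>f\<in>L. t s f ^ n f)) \<le> M"
        using \<delta> by (intro H) (auto simp: t_def norm_\<omega> norm_mult less_imp_le)
      ultimately show "norm (u s * (\<Sum>\<^sub>\<infinity>n\<in>multi_indices L. b n * (\<Prod>f\<in>L. t s f ^ n f))) \<le> M"
        by (simp add: norm_mult)
    qed
    finally show ?thesis using N S by (simp add: norm_mult norm_power)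
  qed
  have "(\<lambda>N. infsum (c (Suc N)) (multi_indices L)) \<longlonglongrightarrow> infsum (\<lambda>n. if n = n0 then a n else 0) (multi_indices L)"
  proof (rule tendsto_infsum_dominated(2)[OF a_sum])
    show "norm (c (Suc N) n) \<le> norm (a n)" for N n by (simp add: c_def)
    fix n assume n: "n \<in> multi_indices L"
    show "(\<lambda>N. c (Suc N) n) \<longlonglongrightarrow> (if n = n0 then a n else 0)"
    proof (cases "n = n0")
      case True
      then show ?thesis by (simp add: c_def)
    next
      case False
      then obtain f where f: "f \<in> L" "n f \<noteq> n0 f"
        using n n0 PiE_ext[of n L "\<lambda>_. UNIV" n0] by (auto simp: multi_indices_def)
      have "\<forall>\<^sub>F N in sequentially. c (Suc N) n = 0"
        using eventually_ge_at_top[of "n f + n0 f"]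
      proof eventually_elim
        case (elim N)
        have "\<not> int (Suc N) dvd int (n f) - int (n0 f)"
        proof
          assume "int (Suc N) dvd int (n f) - int (n0 f)"
          moreover have "int (n f) - int (n0 f) \<noteq> 0" using f(2) by simp
          ultimately have "\<bar>int (Suc N)\<bar> \<le> \<bar>int (n f) - int (n0 f)\<bar>" by (intro dvd_imp_le_int)
          then show False using elim by linarith
        qed
        then show ?case using f(1) by (auto simp: c_def)
      qed
      then show ?thesis using False by (simp add: tendsto_eventually)
    qed
  qed
  moreover have "infsum (\<lambda>n. if n = n0 then a n else 0) (multi_indices L) = a n0"
  proof -
    have "infsum (\<lambda>n. if n = n0 then a n else 0) (multi_indices L) = infsum a {n0}"
      by (rule infsum_cong_neutral) (use n0 in auto)
    then show ?thesis by simp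
  qed
  ultimately have "(\<lambda>N. infsum (c (Suc N)) (multi_indices L)) \<longlonglongrightarrow> a n0" by simp
  then have "norm (a n0) \<le> M"
    by (intro LIMSEQ_le_const2[OF tendsto_norm]) (use bound in auto)
  then show ?thesis by (simp only: norm_a)
qed


text \<open>Absolute summability on the torus is read off at its point with coordinates
  \<open>\<delta> f\<close>, since an unordered sum of complex numbers converges only
  absolutely.\<close>

lemma cauchy_estimate_has_sum:
  fixes b :: "(idx \<Rightarrow> nat) \<Rightarrow> complex"
  assumes L: "finite L" and \<delta>: "\<And>f. f \<in> L \<Longrightarrow> \<delta> f > 0"
    and H: "\<And>t. (\<forall>f\<in>L. norm (t f) = \<delta> f) \<Longrightarrow>
      ((\<lambda>n. b n * (\<Prod>f\<in>L. t f ^ n f)) has_sum H t) (multi_indices L)"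
    and M: "\<And>t. (\<forall>f\<in>L. norm (t f) = \<delta> f) \<Longrightarrow> norm (H t) \<le> M"
    and n: "n \<in> multi_indices L"
  shows "norm (b n) * (\<Prod>f\<in>L. \<delta> f ^ n f) \<le> M"
proof (rule cauchy_estimate[OF L \<delta> _ _ n])
  have "(\<lambda>n. b n * (\<Prod>f\<in>L. of_real (\<delta> f) ^ n f)) summable_on multi_indices L"
    using H[of "\<lambda>f. of_real (\<delta> f)"] \<delta> by (auto simp: less_imp_le has_sum_imp_summable)
  then have "(\<lambda>n. norm (b n * (\<Prod>f\<in>L. of_real (\<delta> f) ^ n f))) summable_on multi_indices L"
    by (simp only: summable_on_iff_abs_summable_on_complex)
  also have "(\<lambda>n. norm (b n * (\<Prod>f\<in>L. complex_of_real (\<delta> f) ^ n f))) = (\<lambda>n. norm (b n) * (\<Prod>f\<in>L. \<delta> f ^ n f))"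
    unfolding norm_mult prod_norm[symmetric] norm_power
    using \<delta> by (intro ext arg_cong2[where f = "(*)"] prod.cong) (auto simp: less_imp_le)
  finally show "(\<lambda>n. norm (b n) * (\<Prod>f\<in>L. \<delta> f ^ n f)) summable_on multi_indices L" .
  show "norm (\<Sum>\<^sub>\<infinity>n\<in>multi_indices L. b n * (\<Prod>f\<in>L. t f ^ n f)) \<le> M"
    if "\<forall>f\<in>L. norm (t f) = \<delta> f" for t
    using M[OF that] infsumI[OF H[OF that]] by simp
qed

text \<open>The Cauchy estimate with bound 0 for the difference. Values on a single torus suffice,
  so one that avoids the singularities of the formula for G can be used.\<close>

lemma power_series_unique:
  fixes b c :: "(idx \<Rightarrow> nat) \<Rightarrow> complex"
  assumes L: "finite L" and \<delta>: "\<And>f. f \<in> L \<Longrightarrow> \<delta> f > 0"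
    and b: "\<And>t. (\<forall>f\<in>L. norm (t f) = \<delta> f) \<Longrightarrow>
      ((\<lambda>n. b n * (\<Prod>f\<in>L. t f ^ n f)) has_sum H t) (multi_indices L)"
    and c: "\<And>t. (\<forall>f\<in>L. norm (t f) = \<delta> f) \<Longrightarrow>
      ((\<lambda>n. c n * (\<Prod>f\<in>L. t f ^ n f)) has_sum H t) (multi_indices L)"
    and n: "n \<in> multi_indices L"
  shows "b n = c n"
proof -
  have "norm (b n - c n) * (\<Prod>f\<in>L. \<delta> f ^ n f) \<le> 0"
  proof (rule cauchy_estimate_has_sum[OF L \<delta> _ _ n, where H = "\<lambda>_. 0"])
    fix t :: "idx \<Rightarrow> complex" assume "\<forall>f\<in>L. norm (t f) = \<delta> f"
    from has_sum_add[OF b[OF this] has_sum_cmult_right[OF c[OF this], of "- 1"]]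
    show "((\<lambda>n. (b n - c n) * (\<Prod>f\<in>L. t f ^ n f)) has_sum 0) (multi_indices L)"
      by (simp add: algebra_simps)
  qed auto
  moreover have "(\<Prod>f\<in>L. \<delta> f ^ n f) > 0" using \<delta> by (intro prod_pos) auto
  ultimately show ?thesis by (simp add: mult_le_0_iff)
qed

text \<open>A normal family argument on coefficients: the uniform bound gives a subsequence along
  which all coefficients converge, and on R a geometric series in the ratios
  \<open>norm (t f) / \<delta> f\<close> dominates, so the limit series sums to the limit function.
  The last clause identifies a coefficient whenever its full sequence converges.\<close>

theorem power_series_limit:
  fixes b :: "nat \<Rightarrow> (idx \<Rightarrow> nat) \<Rightarrow> complex"
  assumes L: "finite L" and \<delta>: "\<And>f. f \<in> L \<Longrightarrow> \<delta> f > 0"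
    and bound: "\<And>j n. n \<in> multi_indices L \<Longrightarrow> norm (b j n) * (\<Prod>f\<in>L. \<delta> f ^ n f) \<le> M"
    and R: "\<And>t f. t \<in> R \<Longrightarrow> f \<in> L \<Longrightarrow> norm (t f) < \<delta> f"
    and H: "\<And>j t. t \<in> R \<Longrightarrow> ((\<lambda>n. b j n * (\<Prod>f\<in>L. t f ^ n f)) has_sum H j t) (multi_indices L)"
    and lim: "\<And>t. t \<in> R \<Longrightarrow> (\<lambda>j. H j t) \<longlonglongrightarrow> G t"
  obtains c where "\<And>n. n \<in> multi_indices L \<Longrightarrow> norm (c n) * (\<Prod>f\<in>L. \<delta> f ^ n f) \<le> M"
    and "\<And>t. t \<in> R \<Longrightarrow> ((\<lambda>n. c n * (\<Prod>f\<in>L. t f ^ n f)) has_sum G t) (multi_indices L)"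
    and "\<And>n v. n \<in> multi_indices L \<Longrightarrow> (\<lambda>j. b j n) \<longlonglongrightarrow> v \<Longrightarrow> c n = v"
proof -
  define e where "e = from_nat_into (multi_indices L)"
  have "(\<lambda>f\<in>L. 0) \<in> multi_indices L" by (simp add: multi_indices_def)
  then have e_in: "e k \<in> multi_indices L" for k
    unfolding e_def by (intro from_nat_into) auto
  have \<delta>_pos: "(\<Prod>f\<in>L. \<delta> f ^ n f) > 0" for n using \<delta> by (intro prod_pos) auto
  \<comment> \<open>Diagonal extraction along an enumeration \<open>e\<close> of the countably many
    multi-indices.\<close>
  interpret subseqs "\<lambda>k s. convergent (\<lambda>i. b (s i) (e k))"
  proof
    fix k and s :: "nat \<Rightarrow> nat"
    have "norm (b (s i) (e k)) \<le> M / (\<Prod>f\<in>L. \<delta> f ^ e k f)" for i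
      using bound[OF e_in, of "s i" k] \<delta>_pos[of "e k"] by (simp add: field_simps)
    then have "bounded (range (\<lambda>i. b (s i) (e k)))" by (auto simp: bounded_iff)
    from bounded_imp_convergent_subsequence[OF this] obtain l r
      where "strict_mono r" "((\<lambda>i. b (s i) (e k)) \<circ> r) \<longlonglongrightarrow> l" by blast
    then show "\<exists>r'. strict_mono r' \<and> convergent (\<lambda>i. b ((s \<circ> r') i) (e k))"
      by (intro exI[of _ r]) (auto simp: convergent_def o_def)
  qed
  define c where "c n = lim (\<lambda>i. b (diagseq i) n)" for n
  have c: "(\<lambda>i. b (diagseq i) n) \<longlonglongrightarrow> c n" if n: "n \<in> multi_indices L" for n
  proof -
    obtain k where k: "e k = n"
      using from_nat_into_surj[OF countable_multi_indices[OF L] n] by (auto simp: e_def)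
    have "convergent (\<lambda>i. b ((diagseq \<circ> (+) (Suc k)) i) (e k))"
    proof (rule diagseq_holds)
      fix r s :: "nat \<Rightarrow> nat" and n
      assume r: "strict_mono r" and "convergent (\<lambda>i. b (s i) (e n))"
      then show "convergent (\<lambda>i. b ((s \<circ> r) i) (e n))"
        using convergent_subseq_convergent[OF _ r] by (fastforce simp: o_def)
    qed
    then have "convergent (\<lambda>i. b (diagseq (i + Suc k)) n)" by (simp add: k o_def add.commute)
    then have "convergent (\<lambda>i. b (diagseq i) n)"
      by (subst (asm) convergent_ignore_initial_segment)
    then show ?thesis by (simp add: c_def convergent_LIMSEQ_iff)
  qed
  show ?thesis
  proof
    fix n assume n: "n \<in> multi_indices L"
    have "(\<lambda>i. norm (b (diagseq i) n) * (\<Prod>f\<in>L. \<delta> f ^ n f)) \<longlonglongrightarrow> norm (c n) * (\<Prod>f\<in>L. \<delta> f ^ n f)"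
      by (intro tendsto_intros c n)
    then show "norm (c n) * (\<Prod>f\<in>L. \<delta> f ^ n f) \<le> M"
      by (rule LIMSEQ_le_const2) (use bound[OF n] in auto)
    fix v assume "(\<lambda>j. b j n) \<longlonglongrightarrow> v"
    from LIMSEQ_subseq_LIMSEQ[OF this subseq_diagseq] c[OF n] show "c n = v"
      by (auto simp: o_def intro: LIMSEQ_unique)
  next
    fix t assume t: "t \<in> R"
    define q where "q f = norm (t f) / \<delta> f" for f
    have q: "0 \<le> q f" "q f < 1" if "f \<in> L" for f
      using R[OF t that] \<delta>[OF that] by (auto simp: q_def)
    have "(\<lambda>n. norm (\<Prod>f\<in>L. complex_of_real (q f) ^ n f)) summable_on multi_indices L"
    proof (rule has_sum_prod_multi_indices(1)[OF L])
      fix f assume "f \<in> L"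
      then have "norm (complex_of_real (q f)) < 1" using q by simp
      then show "(\<lambda>k. norm (complex_of_real (q f) ^ k)) summable_on UNIV"
        and "((\<lambda>k. complex_of_real (q f) ^ k) has_sum 1 / (1 - complex_of_real (q f))) UNIV"
        by (rule geometric_has_sum)+
    qed
    then have g: "(\<lambda>n. M * norm (\<Prod>f\<in>L. complex_of_real (q f) ^ n f)) summable_on multi_indices L"
      by (rule summable_on_cmult_right)
    have g_bound: "norm (b (diagseq j) n * (\<Prod>f\<in>L. t f ^ n f)) \<le> M * norm (\<Prod>f\<in>L. complex_of_real (q f) ^ n f)"
      if n: "n \<in> multi_indices L" for j n
    proof -
      have "norm (\<Prod>f\<in>L. t f ^ n f) = (\<Prod>f\<in>L. \<delta> f ^ n f) * (\<Prod>f\<in>L. q f ^ n f)"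
        unfolding prod.distrib[symmetric] prod_norm[symmetric]
      proof (rule prod.cong[OF refl])
        fix f assume "f \<in> L"
        then show "norm (t f ^ n f) = \<delta> f ^ n f * q f ^ n f"
          using \<delta>[of f] by (simp add: q_def norm_power power_divide)
      qed
      moreover have "norm (\<Prod>f\<in>L. complex_of_real (q f) ^ n f) = (\<Prod>f\<in>L. q f ^ n f)"
        unfolding prod_norm[symmetric] using q(1) by (intro prod.cong refl) (simp add: norm_power)
      moreover have "0 \<le> (\<Prod>f\<in>L. q f ^ n f)" using q by (intro prod_nonneg) auto
      ultimately show ?thesis
        using mult_right_mono[OF bound[OF n, of "diagseq j"], of "\<Prod>f\<in>L. q f ^ n f"]
        by (simp add: norm_mult mult.assoc)
    qed
    have conv: "(\<lambda>j. b (diagseq j) n * (\<Prod>f\<in>L. t f ^ n f)) \<longlonglongrightarrow> c n * (\<Prod>f\<in>L. t f ^ n f)"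
      if "n \<in> multi_indices L" for n by (intro tendsto_intros c that)
    note dominated = tendsto_infsum_dominated[OF g g_bound conv]
    from dominated(1) have cs: "(\<lambda>n. c n * (\<Prod>f\<in>L. t f ^ n f)) summable_on multi_indices L"
      by simp
    from dominated(2) have "(\<lambda>j. H (diagseq j) t) \<longlonglongrightarrow> infsum (\<lambda>n. c n * (\<Prod>f\<in>L. t f ^ n f)) (multi_indices L)"
      by (simp add: infsumI[OF H[OF t]])
    moreover have "(\<lambda>j. H (diagseq j) t) \<longlonglongrightarrow> G t"
      using LIMSEQ_subseq_LIMSEQ[OF lim[OF t] subseq_diagseq] by (simp add: o_def)
    ultimately have "infsum (\<lambda>n. c n * (\<Prod>f\<in>L. t f ^ n f)) (multi_indices L) = G t"
      by (rule LIMSEQ_unique)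
    then show "((\<lambda>n. c n * (\<Prod>f\<in>L. t f ^ n f)) has_sum G t) (multi_indices L)"
      using cs by (simp add: has_sum_iff)
  qed
qed

text \<open>The radii are chosen one after the other, each so small compared with the previous ones that
  the forms that are already bounded away from 0 stay so.\<close>

lemma linear_forms_nonzero_on_torus:
  fixes A :: "('a \<Rightarrow> complex) set"
  assumes "finite L" "finite A" "\<And>a. a \<in> A \<Longrightarrow> \<exists>f\<in>L. a f \<noteq> 0" "0 < \<epsilon>"
  shows "\<exists>\<delta> m. 0 < m \<and> (\<forall>f\<in>L. 0 < \<delta> f \<and> \<delta> f < \<epsilon>) \<and>
      (\<forall>t a. (\<forall>f\<in>L. norm (t f) = \<delta> f) \<longrightarrow> a \<in> A \<longrightarrow> m \<le> norm (\<Sum>f\<in>L. a f * t f))"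
  using assms(1-3)
proof (induction L arbitrary: A rule: finite_induct)
  case empty
  then show ?case by (intro exI[of _ "\<lambda>_. 0"] exI[of _ 1]) auto
next
  case (insert g L)
  define A' where "A' = {a\<in>A. \<exists>f\<in>L. a f \<noteq> 0}"
  have "finite A'" "\<And>a. a \<in> A' \<Longrightarrow> \<exists>f\<in>L. a f \<noteq> 0"
    using insert.prems(1) by (auto simp: A'_def)
  then have "\<exists>\<delta> m. 0 < m \<and> (\<forall>f\<in>L. 0 < \<delta> f \<and> \<delta> f < \<epsilon>) \<and>
    (\<forall>t a. (\<forall>f\<in>L. norm (t f) = \<delta> f) \<longrightarrow> a \<in> A' \<longrightarrow> m \<le> norm (\<Sum>f\<in>L. a f * t f))"
    by (rule insert.IH)
  then obtain \<delta> m where *: "0 < m \<and> (\<forall>f\<in>L. 0 < \<delta> f \<and> \<delta> f < \<epsilon>) \<and>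
    (\<forall>t a. (\<forall>f\<in>L. norm (t f) = \<delta> f) \<longrightarrow> a \<in> A' \<longrightarrow> m \<le> norm (\<Sum>f\<in>L. a f * t f))"
    by (elim exE)
  then have m: "0 < m" and \<delta>: "\<And>f. f \<in> L \<Longrightarrow> 0 < \<delta> f \<and> \<delta> f < \<epsilon>"
    and A': "\<And>t a. (\<forall>f\<in>L. norm (t f) = \<delta> f) \<Longrightarrow> a \<in> A' \<Longrightarrow> m \<le> norm (\<Sum>f\<in>L. a f * t f)"
    by blast+
  define K where "K = 1 + (\<Sum>a\<in>A. norm (a g))"
  have K: "1 \<le> K" "norm (a g) \<le> K" if "a \<in> A" for a
    using member_le_sum[OF that, of "\<lambda>a. norm (a g)"] insert.prems
    by (auto simp: K_def intro: sum_nonneg)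
  have K1: "1 \<le> K" by (simp add: K_def sum_nonneg)
  define d where "d = min (\<epsilon> / 2) (m / (2 * K))"
  have d: "0 < d" "d < \<epsilon>" "K * d \<le> m / 2"
  proof -
    show "0 < d" "d < \<epsilon>" using \<open>0 < \<epsilon>\<close> m K1 by (auto simp: d_def)
    have "K * d \<le> K * (m / (2 * K))" using K1 by (intro mult_left_mono) (auto simp: d_def)
    then show "K * d \<le> m / 2" using K1 by simp
  qed
  define \<mu> where "\<mu> = Min (insert 1 ((\<lambda>a. norm (a g)) ` {a\<in>A. a g \<noteq> 0}))"
  have \<mu>: "0 < \<mu>" "\<And>a. a \<in> A \<Longrightarrow> a g \<noteq> 0 \<Longrightarrow> \<mu> \<le> norm (a g)"
    using insert.prems(1) by (auto simp: \<mu>_def)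
  have "min (m / 2) (\<mu> * d) \<le> norm (\<Sum>f\<in>insert g L. a f * t f)"
    if t: "\<forall>f\<in>insert g L. norm (t f) = (\<delta>(g := d)) f" and a: "a \<in> A" for t a
  proof -
    have tL: "\<forall>f\<in>L. norm (t f) = \<delta> f" using t insert.hyps(2) by (auto split: if_splits)
    have sum: "(\<Sum>f\<in>insert g L. a f * t f) = a g * t g + (\<Sum>f\<in>L. a f * t f)"
      using insert.hyps by simp
    show ?thesis
    proof (cases "a \<in> A'")
      case True
      have "norm (a g * t g) \<le> K * d"
        using K(2)[OF a] t d(1) by (simp add: norm_mult mult_right_mono)
      moreover have "m \<le> norm (\<Sum>f\<in>L. a f * t f)" by (rule A'[OF tL True])
      ultimately have "m / 2 \<le> norm (\<Sum>f\<in>insert g L. a f * t f)"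
        unfolding sum using d(3) norm_diff_ineq[of "\<Sum>f\<in>L. a f * t f" "a g * t g"]
        by (simp add: add.commute)
      then show ?thesis by simp
    next
      case False
      then have "(\<Sum>f\<in>L. a f * t f) = 0" using a by (auto simp: A'_def intro: sum.neutral)
      moreover have "a g \<noteq> 0" using False insert.prems(2)[OF a] a by (auto simp: A'_def)
      ultimately have "\<mu> * d \<le> norm (\<Sum>f\<in>insert g L. a f * t f)"
        unfolding sum using \<mu>(2)[OF a] t d(1) by (simp add: norm_mult mult_right_mono)
      then show ?thesis by simp
    qed
  qed
  moreover have "0 < min (m / 2) (\<mu> * d)" using m \<mu>(1) d(1) by simp
  moreover have "\<forall>f\<in>insert g L. 0 < (\<delta>(g := d)) f \<and> (\<delta>(g := d)) f < \<epsilon>"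
    using \<delta> d by auto
  ultimately show ?case by blast
qed

section \<open>The Taylor coefficients as lattice sums\<close>

lemma expi_eq_1_iff: "expi z = 1 \<longleftrightarrow> z \<in> \<int>"
proof
  assume "expi z = 1"
  then obtain n :: int where "Re (2 * of_real pi * \<i> * z) = 0" "Im (2 * of_real pi * \<i> * z) = of_int (2 * n) * pi"
    by (auto simp: expi_def exp_eq_1)
  then have "Im z = 0" "Re z = of_int n" by auto
  then have "z = of_int n" by (simp add: complex_eq_iff)
  then show "z \<in> \<int>" by simp
qed (rule expi_int)

text \<open>The coefficients of - t / (x - t) as a power series in t. For x = 0 the quotient is the
  constant 1, so every coefficient with k \<ge> 1 vanishes: this is how points at which a form is 0
  drop out.\<close>

definition geo_coeff :: "real \<Rightarrow> nat \<Rightarrow> complex"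
  where "geo_coeff x k =
    (if x = 0 then if k = 0 then 1 else 0 else if k = 0 then 0 else - 1 / of_real x ^ k)"

text \<open>An integer x is 0 or has absolute value at least 1, so the geometric series in t / x
  converges on the same disc \<open>norm t < 1\<close> for all nonzero x.\<close>

lemma geo_coeff_has_sum:
  assumes x: "x \<in> \<int>" and t: "t \<noteq> 0" "norm t < 1"
  shows "((\<lambda>k. geo_coeff x k * t ^ k) has_sum - t / (of_real x - t)) UNIV"
proof -
  have 0: "((\<lambda>k::nat. if k = 0 then 1 else 0 :: complex) has_sum 1) UNIV"
    by (rule has_sum_finite_neutralI[where B = "{0}"]) auto
  show ?thesis
  proof (cases "x = 0")
    case True
    then have "(\<lambda>k. geo_coeff x k * t ^ k) = (\<lambda>k. if k = 0 then 1 else 0)"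
      by (auto simp: geo_coeff_def)
    then show ?thesis using 0 t True by simp
  next
    case False
    with x have "1 \<le> \<bar>x\<bar>" by (auto elim!: Ints_cases)
    then have "norm (t / of_real x) < 1" using t False by (simp add: norm_divide divide_simps)
    from has_sum_add[OF 0 has_sum_cmult_right[OF geometric_has_sum(2)[OF this], of "- 1"]]
    have "((\<lambda>k. (if k = 0 then 1 else 0) + - 1 * (t / of_real x) ^ k) has_sum
        1 + - 1 * (1 / (1 - t / of_real x))) UNIV" .
    moreover have "(\<lambda>k. (if k = 0 then 1 else 0) + - 1 * (t / of_real x) ^ k) = (\<lambda>k. geo_coeff x k * t ^ k)"
      using False by (auto simp: geo_coeff_def power_divide)
    moreover have "1 + - 1 * (1 / (1 - t / of_real x)) = - t / (of_real x - t)"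
    proof -
      have "norm t < norm (complex_of_real x)" using t \<open>1 \<le> \<bar>x\<bar>\<close> by simp
      then have "of_real x - t \<noteq> 0" by auto
      then show ?thesis using False by (simp add: field_simps)
    qed
    ultimately show ?thesis by simp
  qed
qed

text \<open>A small positive shift does not change the floor. Left limits follow by applying this to
  - x.\<close>

lemma frac_perturb_right:
  fixes x r :: real
  assumes "r > 0"
  shows "(\<lambda>j. frac (x + r / real (Suc j))) \<longlonglongrightarrow> frac x"
    and "\<forall>\<^sub>F j in sequentially. x + r / real (Suc j) \<notin> \<int>"
proof -
  have lim: "(\<lambda>j. r / real (Suc j)) \<longlonglongrightarrow> 0"
    using LIMSEQ_Suc[OF lim_const_over_n[of r]] by simp
  have "frac x < 1" by (rule frac_lt_1)
  then have ev: "\<forall>\<^sub>F j in sequentially. r / real (Suc j) < 1 - frac x"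
    by (intro order_tendstoD(2)[OF lim]) auto
  have eq: "frac (x + r / real (Suc j)) = frac x + r / real (Suc j)"
    if "r / real (Suc j) < 1 - frac x" for j
  proof -
    have "0 < r / real (Suc j)" using assms by simp
    then have "\<lfloor>x + r / real (Suc j)\<rfloor> = \<lfloor>x\<rfloor>"
      using that unfolding frac_def by (intro floor_unique) linarith+
    then show ?thesis by (simp add: frac_def)
  qed
  have "(\<lambda>j. frac x + r / real (Suc j)) \<longlonglongrightarrow> frac x + 0" by (intro tendsto_intros lim)
  moreover have "\<forall>\<^sub>F j in sequentially. frac x + r / real (Suc j) = frac (x + r / real (Suc j))"
    using ev by eventually_elim (simp only: eq)
  ultimately show "(\<lambda>j. frac (x + r / real (Suc j))) \<longlonglongrightarrow> frac x"
    by (simp add: Lim_transform_eventually)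
  show "\<forall>\<^sub>F j in sequentially. x + r / real (Suc j) \<notin> \<int>"
    using ev
  proof eventually_elim
    case (elim j)
    have "0 < r / real (Suc j)" using assms by simp
    then have "0 < frac (x + r / real (Suc j))" using eq[OF elim] frac_ge_0[of x] by linarith
    then show ?case by (simp add: frac_gt_0_iff)
  qed
qed

text \<open>The clause \<open>covered\<close> brings every \<open>t f\<close> with f in L under a
  condition \<open>expi (t f) \<noteq> 1\<close> of \<open>regular_point\<close>. At regular points
  \<open>t f\<close> is therefore not an integer, and no denominator of the generating sum
  vanishes.\<close>

locale lattice_family =
  fixes J :: "nat set" and L :: "idx set" and F :: family
  assumes finite_J: "finite J" and finite_L: "finite L"
    and vec_in_lattice: "f \<in> L \<Longrightarrow> vec_of F f \<in> coord_lattice J"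
    and dot_Ints: "f \<in> L \<Longrightarrow> dot_of F f \<in> \<int>"
    and bases_nonempty: "bases J L F \<noteq> {}"
    and covered: "f \<in> L \<Longrightarrow> \<exists>B\<in>bases J L F. f \<in> B"
begin

lemma basis: "B \<in> bases J L F \<Longrightarrow> lattice_basis J F B"
  using bases_iff[OF finite_J finite_L, of B F] vec_in_lattice dot_Ints
  by (auto simp: lattice_basis_def lattice_basis_axioms_def)

lemma basis_subset: "B \<in> bases J L F \<Longrightarrow> B \<subseteq> L"
  by (simp add: bases_def)

lemma basis_finite: "B \<in> bases J L F \<Longrightarrow> finite B"
  using basis_subset finite_L finite_subset by blast

lemma regular_expi: "regular_point J L F t \<Longrightarrow> f \<in> L \<Longrightarrow> expi (t f) \<noteq> 1"
  using covered[of f] by (auto simp: regular_point_def)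

lemma regular_nonzero: "regular_point J L F t \<Longrightarrow> f \<in> L \<Longrightarrow> t f \<noteq> 0"
  using regular_expi by fastforce

lemma lin_form_Ints: "v \<in> coord_lattice J \<Longrightarrow> f \<in> L \<Longrightarrow> lin_form J F v f \<in> \<int>"
  unfolding lin_form_def
  by (intro Ints_add coord_inner_Ints vec_in_lattice Ints_complex_Re dot_Ints)

lemma shifted_form_eq: "f \<in> L \<Longrightarrow> shifted_form J F t v f = of_real (lin_form J F v f) - t f"
  using Ints_complex_Re(1)[OF dot_Ints[of f]] by (simp add: shifted_form_def lin_form_def)

definition summand :: "(idx \<Rightarrow> complex) \<Rightarrow> (nat \<Rightarrow> real) \<Rightarrow> complex"
  where "summand t v = (\<Prod>f\<in>L. - t f / (of_real (lin_form J F v f) - t f))"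

definition box_mean :: "nat \<Rightarrow> (nat \<Rightarrow> real) \<Rightarrow> (idx \<Rightarrow> complex) \<Rightarrow> complex"
  where "box_mean N y t = (\<Sum>v\<in>lattice_box J N. of_real (box_weight J N v) * char_at J y v * summand t v)"

definition basis_coeff :: "(idx \<Rightarrow> complex) \<Rightarrow> idx set \<Rightarrow> complex"
  where "basis_coeff t B = (\<Prod>g\<in>L-B. - t g / G_denom J F t B g) * (\<Prod>f\<in>B. - t f)"

text \<open>The identity of \<open>partial_fractions\<close> multiplied by
  \<open>summand t v\<close>: the shifted forms of \<open>L - B\<close> cancel, which leaves only
  those of B in the denominator.\<close>

lemma summand_partial_fractions:
  assumes reg: "regular_point J L F t" and v: "v \<in> coord_lattice J"
  shows "summand t v = (\<Sum>B\<in>bases J L F. basis_coeff t B * (\<Prod>f\<in>B. 1 / (of_real (lin_form J F v f) - t f)))"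
proof -
  define \<phi> where "\<phi> f = of_real (lin_form J F v f) - t f" for f
  have nz: "\<phi> f \<noteq> 0" if "f \<in> L" for f
  proof
    assume "\<phi> f = 0"
    then have "t f = of_real (lin_form J F v f)" by (simp add: \<phi>_def)
    then have "expi (t f) = 1"
      using lin_form_Ints[OF v that] by (simp only: expi_of_real_eq_1_iff)
    then show False using regular_expi[OF reg that] by simp
  qed
  have "(\<Sum>B\<in>bases J L F. \<Prod>g\<in>L-B. \<phi> g / G_denom J F t B g)
      = (\<Sum>B\<in>bases J L F. \<Prod>g\<in>L-B. shifted_form J F t v g / G_denom J F t B g)"
    by (intro sum.cong prod.cong refl) (simp add: shifted_form_eq \<phi>_def)
  also have "\<dots> = 1"
    using vec_in_lattice coord_lattice_imp_space reg
    by (intro partial_fractions finite_J finite_L bases_nonempty) (auto simp: regular_point_def)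
  finally have pf: "(\<Sum>B\<in>bases J L F. \<Prod>g\<in>L-B. \<phi> g / G_denom J F t B g) = 1" .
  have "summand t v = (\<Sum>B\<in>bases J L F. (\<Prod>g\<in>L-B. \<phi> g / G_denom J F t B g) * summand t v)"
    using pf by (simp add: sum_distrib_right[symmetric])
  also have "\<dots> = (\<Sum>B\<in>bases J L F. basis_coeff t B * (\<Prod>f\<in>B. 1 / \<phi> f))"
  proof (rule sum.cong[OF refl])
    fix B assume B: "B \<in> bases J L F"
    have "summand t v = (\<Prod>g\<in>L-B. - t g / \<phi> g) * (\<Prod>f\<in>B. - t f / \<phi> f)"
      unfolding summand_def \<phi>_def by (rule prod.subset_diff[OF basis_subset[OF B] finite_L])
    moreover have "(\<Prod>g\<in>L-B. \<phi> g / G_denom J F t B g) * (\<Prod>g\<in>L-B. - t g / \<phi> g)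
        = (\<Prod>g\<in>L-B. - t g / G_denom J F t B g)"
      unfolding prod.distrib[symmetric] using nz by (intro prod.cong) auto
    moreover have "(\<Prod>f\<in>B. - t f / \<phi> f) = (\<Prod>f\<in>B. - t f) * (\<Prod>f\<in>B. 1 / \<phi> f)"
      unfolding prod.distrib[symmetric] by simp
    ultimately show "(\<Prod>g\<in>L-B. \<phi> g / G_denom J F t B g) * summand t v = basis_coeff t B * (\<Prod>f\<in>B. 1 / \<phi> f)"
      by (simp add: basis_coeff_def mult.assoc[symmetric])
  qed
  finally show ?thesis by (simp add: \<phi>_def)
qed

text \<open>The weights do not depend on B, so the finite sum over the box and the sum over the
  bases can be interchanged.\<close>

lemma box_mean_decomp:
  assumes reg: "regular_point J L F t"
  shows "box_mean N y t = (\<Sum>B\<in>bases J L F. basis_coeff t B * lattice_basis.box_sum J F B t y N)"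
proof -
  have "box_mean N y t = (\<Sum>v\<in>lattice_box J N. \<Sum>B\<in>bases J L F. basis_coeff t B *
      (of_real (box_weight J N v) * char_at J y v * (\<Prod>f\<in>B. 1 / (of_real (lin_form J F v f) - t f))))"
    unfolding box_mean_def
    by (intro sum.cong refl) (simp add: summand_partial_fractions[OF reg] lattice_box_def sum_distrib_left mult_ac)
  also have "\<dots> = (\<Sum>B\<in>bases J L F. basis_coeff t B * lattice_basis.box_sum J F B t y N)"
    by (subst sum.swap) (simp add: sum_distrib_left lattice_basis.box_sum_def[OF basis] cong: sum.cong)
  finally show ?thesis .
qed

text \<open>The linear part of \<open>G_denom\<close> in t, up to sign. The coefficient at g itself
  is 1, so this linear form is never 0, as the choice of the torus requires.\<close>

definition form_coeff :: "idx set \<Rightarrow> idx \<Rightarrow> idx \<Rightarrow> complex"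
  where "form_coeff B g f = (if f = g then 1 else if f \<in> B then - of_real (coord_inner J (vec_of F g) (dual_vec J F B f)) else 0)"

definition denom_const :: "idx set \<Rightarrow> idx \<Rightarrow> complex"
  where "denom_const B g = dot_of F g - (\<Sum>f\<in>B. dot_of F f * of_real (coord_inner J (vec_of F g) (dual_vec J F B f)))"

lemma G_denom_linear:
  assumes B: "B \<in> bases J L F" and g: "g \<in> L - B"
  shows "G_denom J F t B g = denom_const B g - (\<Sum>f\<in>L. form_coeff B g f * t f)"
proof -
  have "(\<Sum>f\<in>L. form_coeff B g f * t f) = (\<Sum>f\<in>insert g B. form_coeff B g f * t f)"
    using basis_subset[OF B] g finite_L by (intro sum.mono_neutral_right) (auto simp: form_coeff_def)
  also have "\<dots> = t g + (\<Sum>f\<in>B. form_coeff B g f * t f)"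
    using basis_finite[OF B] g by (simp add: form_coeff_def)
  also have "(\<Sum>f\<in>B. form_coeff B g f * t f)
      = - (\<Sum>f\<in>B. t f * of_real (coord_inner J (vec_of F g) (dual_vec J F B f)))"
    unfolding sum_negf[symmetric] using g by (intro sum.cong) (auto simp: form_coeff_def)
  finally show ?thesis by (simp add: G_denom_def denom_const_def)
qed

text \<open>A denominator with nonzero constant term stays away from 0 for small t. One with
  constant term 0 is a nonzero linear form in t, for which
  \<open>linear_forms_nonzero_on_torus\<close> chooses the radii. A sphere of radius in (0, 1)
  contains no integer, so compactness bounds \<open>expi (t f) - 1\<close> away from 0.\<close>

lemma regular_torus:
  assumes "0 < \<epsilon>"
  obtains \<delta> m where "0 < m" "\<And>f. f \<in> L \<Longrightarrow> 0 < \<delta> f \<and> \<delta> f < \<epsilon> \<and> \<delta> f < 1"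
    and "\<And>t B g. (\<forall>f\<in>L. norm (t f) = \<delta> f) \<Longrightarrow> B \<in> bases J L F \<Longrightarrow> g \<in> L - B \<Longrightarrow> m \<le> norm (G_denom J F t B g)"
    and "\<And>t f. (\<forall>f\<in>L. norm (t f) = \<delta> f) \<Longrightarrow> f \<in> L \<Longrightarrow> m \<le> norm (expi (t f) - 1)"
proof -
  define P where "P = Sigma (bases J L F) (\<lambda>B. L - B)"
  have fin_P: "finite P" using finite_L finite_bases[OF finite_L] by (auto simp: P_def)
  define K where "K = 1 + (\<Sum>p\<in>P. \<Sum>f\<in>L. norm (form_coeff (fst p) (snd p) f))"
  have K: "(\<Sum>f\<in>L. norm (form_coeff B g f)) \<le> K" if "(B, g) \<in> P" for B g
    using member_le_sum[OF that _ fin_P, of "\<lambda>p. \<Sum>f\<in>L. norm (form_coeff (fst p) (snd p) f)"]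
    by (simp add: K_def sum_nonneg)
  have K1: "1 \<le> K" by (auto simp: K_def intro!: sum_nonneg)
  define c where "c = Min (insert 1 ((\<lambda>(B, g). norm (denom_const B g)) ` {p\<in>P. denom_const (fst p) (snd p) \<noteq> 0}))"
  have c: "0 < c" "\<And>B g. (B, g) \<in> P \<Longrightarrow> denom_const B g \<noteq> 0 \<Longrightarrow> c \<le> norm (denom_const B g)"
    using fin_P by (auto simp: c_def intro!: Min_le)
  \<comment> \<open>For radii below \<open>\<epsilon>'\<close> the linear part is at most
    \<open>c / 2\<close>, hence at most half of every nonzero constant term.\<close>
  define \<epsilon>' where "\<epsilon>' = min (min \<epsilon> 1) (c / (2 * K))"
  have \<epsilon>': "0 < \<epsilon>'" "\<epsilon>' \<le> \<epsilon>" "\<epsilon>' \<le> 1" "K * \<epsilon>' \<le> c / 2"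
  proof -
    show "0 < \<epsilon>'" "\<epsilon>' \<le> \<epsilon>" "\<epsilon>' \<le> 1" using assms c K1 by (auto simp: \<epsilon>'_def)
    have "K * \<epsilon>' \<le> K * (c / (2 * K))" using K1 by (intro mult_left_mono) (auto simp: \<epsilon>'_def)
    then show "K * \<epsilon>' \<le> c / 2" using K1 by simp
  qed
  have ex: "\<exists>f\<in>L. a f \<noteq> 0" if "a \<in> (\<lambda>(B, g). form_coeff B g) ` P" for a
    using that by (auto simp: P_def form_coeff_def)
  obtain \<delta> m where *: "0 < m \<and> (\<forall>f\<in>L. 0 < \<delta> f \<and> \<delta> f < \<epsilon>') \<and>
      (\<forall>t a. (\<forall>f\<in>L. norm (t f) = \<delta> f) \<longrightarrow> a \<in> (\<lambda>(B, g). form_coeff B g) ` P \<longrightarrow>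
        m \<le> norm (\<Sum>f\<in>L. a f * t f))"
    using linear_forms_nonzero_on_torus[of L "(\<lambda>(B, g). form_coeff B g) ` P" \<epsilon>'] finite_L fin_P ex \<epsilon>'(1)
    by auto
  then have m: "0 < m" and \<delta>: "\<And>f. f \<in> L \<Longrightarrow> 0 < \<delta> f \<and> \<delta> f < \<epsilon>'"
    and form: "\<And>t a. (\<forall>f\<in>L. norm (t f) = \<delta> f) \<Longrightarrow> a \<in> (\<lambda>(B, g). form_coeff B g) ` P \<Longrightarrow>
        m \<le> norm (\<Sum>f\<in>L. a f * t f)"
    by blast+
  have expi_bound: "\<exists>m'>0. \<forall>z. norm z = \<delta> f \<longrightarrow> m' \<le> norm (expi z - 1)" if f: "f \<in> L" for f
  proof -
    have ne: "sphere 0 (\<delta> f) \<noteq> ({} :: complex set)" using \<delta>[OF f] by simp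
    have "continuous_on (sphere 0 (\<delta> f)) (\<lambda>z. norm (expi z - 1))" by (intro continuous_intros)
    from continuous_attains_inf[OF compact_sphere ne this] obtain z0 where
      z0: "norm z0 = \<delta> f" "\<And>z. norm z = \<delta> f \<Longrightarrow> norm (expi z0 - 1) \<le> norm (expi z - 1)" by auto
    have "z0 \<notin> \<int>"
    proof
      assume "z0 \<in> \<int>"
      then obtain n :: int where n: "z0 = of_int n" by (elim Ints_cases)
      then have "0 < \<bar>real_of_int n\<bar>" "\<bar>real_of_int n\<bar> < 1" using z0(1) \<delta>[OF f] \<epsilon>' by auto
      then show False by (simp flip: of_int_abs)
    qed
    then have "0 < norm (expi z0 - 1)" by (simp add: expi_eq_1_iff)
    then show ?thesis using z0(2) by blast
  qed
  then have "\<forall>f\<in>L. \<exists>m'. 0 < m' \<and> (\<forall>z. norm z = \<delta> f \<longrightarrow> m' \<le> norm (expi z - 1))" by blast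
  from bchoice[OF this] obtain m' where "\<forall>f\<in>L. 0 < m' f \<and> (\<forall>z. norm z = \<delta> f \<longrightarrow> m' f \<le> norm (expi z - 1))"
    by blast
  then have m': "\<And>f. f \<in> L \<Longrightarrow> 0 < m' f" "\<And>f z. f \<in> L \<Longrightarrow> norm z = \<delta> f \<Longrightarrow> m' f \<le> norm (expi z - 1)"
    by blast+
  define \<mu> where "\<mu> = Min (insert (min m (c / 2)) (m' ` L))"
  have \<mu>: "0 < \<mu>" "\<mu> \<le> m" "\<mu> \<le> c / 2" "\<And>f. f \<in> L \<Longrightarrow> \<mu> \<le> m' f"
  proof -
    have fin: "finite (insert (min m (c / 2)) (m' ` L))" using finite_L by simp
    show "0 < \<mu>" using m c(1) m'(1) finite_L by (auto simp: \<mu>_def)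
    have "\<mu> \<le> min m (c / 2)" unfolding \<mu>_def by (rule Min_le[OF fin]) simp
    then show "\<mu> \<le> m" "\<mu> \<le> c / 2" by auto
    show "\<mu> \<le> m' f" if "f \<in> L" for f unfolding \<mu>_def by (rule Min_le[OF fin]) (use that in simp)
  qed
  show ?thesis
  proof
    show "0 < \<mu>" by (rule \<mu>(1))
    show "0 < \<delta> f \<and> \<delta> f < \<epsilon> \<and> \<delta> f < 1" if "f \<in> L" for f using \<delta>[OF that] \<epsilon>' by auto
    fix t :: "idx \<Rightarrow> complex" assume t: "\<forall>f\<in>L. norm (t f) = \<delta> f"
    show "\<mu> \<le> norm (expi (t f) - 1)" if "f \<in> L" for f
      using m'(2)[OF that, of "t f"] t \<mu>(4)[OF that] that by auto
    fix B g assume B: "B \<in> bases J L F" and g: "g \<in> L - B"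
    have p: "(B, g) \<in> P" using B g by (simp add: P_def)
    define \<Sigma> where "\<Sigma> = (\<Sum>f\<in>L. form_coeff B g f * t f)"
    have lin: "G_denom J F t B g = denom_const B g - \<Sigma>"
      unfolding \<Sigma>_def by (rule G_denom_linear[OF B g])
    show "\<mu> \<le> norm (G_denom J F t B g)"
    proof (cases "denom_const B g = 0")
      case True
      have "m \<le> norm \<Sigma>" unfolding \<Sigma>_def by (rule form[OF t]) (use p in force)
      then show ?thesis using \<mu>(2) by (simp add: lin True)
    next
      case False
      have "norm \<Sigma> \<le> (\<Sum>f\<in>L. norm (form_coeff B g f) * \<epsilon>')"
        unfolding \<Sigma>_def
      proof (rule sum_norm_le)
        fix f assume "f \<in> L"
        then show "norm (form_coeff B g f * t f) \<le> norm (form_coeff B g f) * \<epsilon>'"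
          using t \<delta>[of f] by (auto simp: norm_mult intro!: mult_left_mono)
      qed
      also have "\<dots> \<le> K * \<epsilon>'"
        unfolding sum_distrib_right[symmetric] using K[OF p] \<epsilon>'(1) by (intro mult_right_mono) auto
      also have "\<dots> \<le> c / 2" by (rule \<epsilon>'(4))
      finally have "c / 2 \<le> norm (denom_const B g - \<Sigma>)"
        using c(2)[OF p False] norm_triangle_ineq2[of "denom_const B g" \<Sigma>] by linarith
      then show ?thesis using \<mu>(3) by (simp add: lin)
    qed
  qed
qed

text \<open>The bound involves neither N nor y, which makes the coefficient bound uniform over both
  limits taken later. It rests on the decomposition over bases, so it holds only where the
  denominators stay away from 0.\<close>

lemma box_mean_bounded:
  assumes m: "0 < m"
    and t1: "\<And>f. f \<in> L \<Longrightarrow> norm (t f) \<le> 1"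
    and denom: "\<And>B g. B \<in> bases J L F \<Longrightarrow> g \<in> L - B \<Longrightarrow> m \<le> norm (G_denom J F t B g)"
    and expi: "\<And>f. f \<in> L \<Longrightarrow> m \<le> norm (expi (t f) - 1)"
  shows "norm (box_mean N y t)
    \<le> (\<Sum>B\<in>bases J L F. (\<Prod>g\<in>L-B. 1 / m) * (\<Prod>f\<in>B. 2 * pi * exp (2 * pi) / m))"
proof -
  have reg: "regular_point J L F t"
    using m denom expi basis_subset by (fastforce simp: regular_point_def)
  show ?thesis
    unfolding box_mean_decomp[OF reg]
  proof (rule sum_norm_le)
    fix B assume B: "B \<in> bases J L F"
    interpret lattice_basis J F B by (rule basis[OF B])
    have BL: "B \<subseteq> L" by (rule basis_subset[OF B])
    have "norm (basis_coeff t B) = (\<Prod>g\<in>L-B. norm (t g) / norm (G_denom J F t B g)) * (\<Prod>f\<in>B. norm (t f))"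
      by (simp add: basis_coeff_def norm_mult norm_divide flip: prod_norm)
    also have "\<dots> \<le> (\<Prod>g\<in>L-B. 1 / m) * (\<Prod>f\<in>B. 1)"
      using m t1 denom[OF B] BL
      by (intro mult_mono prod_mono prod_nonneg conjI frac_le ballI) auto
    finally have 1: "norm (basis_coeff t B) \<le> (\<Prod>g\<in>L-B. 1 / m)" by simp
    have "norm (box_sum t y N) \<le> (\<Prod>f\<in>B. 2 * pi * exp (2 * pi * norm (t f)) / norm (expi (t f) - 1))"
      using reg regular_expi BL by (intro norm_box_sum_le) auto
    also have "\<dots> \<le> (\<Prod>f\<in>B. 2 * pi * exp (2 * pi) / m)"
      using m t1 expi BL by (intro prod_mono conjI frac_le) (auto simp: subset_eq)
    finally show "norm (basis_coeff t B * box_sum t y N)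
      \<le> (\<Prod>g\<in>L-B. 1 / m) * (\<Prod>f\<in>B. 2 * pi * exp (2 * pi) / m)"
      unfolding norm_mult using 1 m by (intro mult_mono) (auto intro!: prod_nonneg)
  qed
qed

definition mean_coeff :: "nat \<Rightarrow> (nat \<Rightarrow> real) \<Rightarrow> (idx \<Rightarrow> nat) \<Rightarrow> complex"
  where "mean_coeff N y n = (\<Sum>v\<in>lattice_box J N. of_real (box_weight J N v) * char_at J y v *
    (\<Prod>f\<in>L. geo_coeff (lin_form J F v f) (n f)))"

lemma box_mean_has_sum:
  assumes t: "\<And>f. f \<in> L \<Longrightarrow> t f \<noteq> 0 \<and> norm (t f) < 1"
  shows "((\<lambda>n. mean_coeff N y n * (\<Prod>f\<in>L. t f ^ n f)) has_sum box_mean N y t) (multi_indices L)"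
proof -
  have "((\<lambda>n. \<Prod>f\<in>L. geo_coeff (lin_form J F v f) (n f) * t f ^ n f) has_sum summand t v) (multi_indices L)"
    if v: "v \<in> coord_lattice J" for v
    unfolding summand_def
  proof (rule has_sum_prod_multi_indices(2)[OF finite_L])
    fix f assume f: "f \<in> L"
    show *: "((\<lambda>k. geo_coeff (lin_form J F v f) k * t f ^ k) has_sum
        - t f / (of_real (lin_form J F v f) - t f)) UNIV"
      using t[OF f] by (intro geo_coeff_has_sum lin_form_Ints v f) auto
    show "(\<lambda>k. norm (geo_coeff (lin_form J F v f) k * t f ^ k)) summable_on UNIV"
      using has_sum_imp_summable[OF *] by (simp only: summable_on_iff_abs_summable_on_complex)
  qed
  then have "((\<lambda>n. \<Sum>v\<in>lattice_box J N. of_real (box_weight J N v) * char_at J y v *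
      (\<Prod>f\<in>L. geo_coeff (lin_form J F v f) (n f) * t f ^ n f)) has_sum box_mean N y t) (multi_indices L)"
    unfolding box_mean_def
    by (intro has_sum_sum_pointwise finite_lattice_box finite_J has_sum_cmult_right) (auto simp: lattice_box_def)
  then show ?thesis
    by (simp only: mean_coeff_def sum_distrib_right prod.distrib mult.assoc)
qed

definition nonzero_points :: "(nat \<Rightarrow> real) set"
  where "nonzero_points = {v \<in> coord_lattice J. \<forall>f\<in>L. lin_form J F v f \<noteq> 0}"

definition lattice_sum :: "(nat \<Rightarrow> real) \<Rightarrow> (idx \<Rightarrow> nat) \<Rightarrow> complex"
  where "lattice_sum y n =
    (\<Sum>\<^sub>\<infinity>v\<in>nonzero_points. char_at J y v * (\<Prod>f\<in>L. 1 / of_real (lin_form J F v f) ^ n f))"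

lemma norm_summand: "norm (char_at J y v * (\<Prod>f\<in>L. 1 / of_real (lin_form J F v f) ^ n f))
    = (\<Prod>f\<in>L. 1 / \<bar>lin_form J F v f\<bar> ^ n f)"
  by (simp add: char_at_def norm_mult norm_divide norm_power flip: prod_norm)

text \<open>Points at which some form vanishes contribute 0, because
  \<open>geo_coeff 0 k = 0\<close> for k \<ge> 1; elsewhere each factor carries a minus sign, whence
  \<open>(- 1) ^ card L\<close>. The weights lie in [0, 1] and tend to 1, so dominated convergence
  removes them.\<close>

lemma mean_coeff_tendsto:
  assumes n: "\<And>f. f \<in> L \<Longrightarrow> n f \<ge> 1"
    and summable: "(\<lambda>v. \<Prod>f\<in>L. 1 / \<bar>lin_form J F v f\<bar> ^ n f) summable_on nonzero_points"
  shows "(\<lambda>N. mean_coeff N y n) \<longlonglongrightarrow> (- 1) ^ card L * lattice_sum y n"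
proof -
  define a where "a v = char_at J y v * (\<Prod>f\<in>L. 1 / of_real (lin_form J F v f) ^ n f)" for v
  have mean: "mean_coeff N y n = infsum (\<lambda>v. of_real (box_weight J N v) * ((- 1) ^ card L * a v)) nonzero_points" for N
  proof -
    have geo: "(\<Prod>f\<in>L. geo_coeff (lin_form J F v f) (n f)) = (- 1) ^ card L * (\<Prod>f\<in>L. 1 / of_real (lin_form J F v f) ^ n f)"
      if "v \<in> nonzero_points" for v
    proof -
      have "(\<Prod>f\<in>L. geo_coeff (lin_form J F v f) (n f)) = (\<Prod>f\<in>L. - 1 * (1 / of_real (lin_form J F v f) ^ n f))"
        using that n by (intro prod.cong refl) (force simp: geo_coeff_def nonzero_points_def)
      also have "\<dots> = (- 1) ^ card L * (\<Prod>f\<in>L. 1 / of_real (lin_form J F v f) ^ n f)"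
        unfolding prod.distrib by simp
      finally show ?thesis .
    qed
    have "mean_coeff N y n = infsum (\<lambda>v. of_real (box_weight J N v) * char_at J y v *
        (\<Prod>f\<in>L. geo_coeff (lin_form J F v f) (n f))) (lattice_box J N)"
      using finite_lattice_box[OF finite_J] by (simp add: mean_coeff_def)
    also have "\<dots> = infsum (\<lambda>v. of_real (box_weight J N v) * ((- 1) ^ card L * a v)) nonzero_points"
    proof (rule infsum_cong_neutral)
      fix v assume "v \<in> nonzero_points - lattice_box J N"
      then show "of_real (box_weight J N v) * ((- 1) ^ card L * a v) = 0"
        using box_weight_eq_0[OF finite_J, of v N] by (auto simp: nonzero_points_def)
    next
      fix v assume "v \<in> lattice_box J N - nonzero_points"
      then obtain f where "f \<in> L" "lin_form J F v f = 0" by (auto simp: nonzero_points_def lattice_box_def)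
      then have "geo_coeff (lin_form J F v f) (n f) = 0" using n[of f] by (simp add: geo_coeff_def)
      then have "(\<Prod>f\<in>L. geo_coeff (lin_form J F v f) (n f)) = 0"
        using \<open>f \<in> L\<close> finite_L by (auto intro: prod_zero)
      then show "of_real (box_weight J N v) * char_at J y v * (\<Prod>f\<in>L. geo_coeff (lin_form J F v f) (n f)) = 0"
        by simp
    qed (simp add: geo a_def mult_ac)
    finally show ?thesis .
  qed
  have "(\<lambda>N. infsum (\<lambda>v. of_real (box_weight J N v) * ((- 1) ^ card L * a v)) nonzero_points)
      \<longlonglongrightarrow> infsum (\<lambda>v. (- 1) ^ card L * a v) nonzero_points"
  proof (rule tendsto_infsum_dominated(2)[OF summable])
    fix N v
    have "norm (of_real (box_weight J N v) * ((- 1) ^ card L * a v)) = box_weight J N v * norm (a v)"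
      by (simp add: norm_mult norm_power box_weight_nonneg)
    also have "\<dots> \<le> 1 * norm (a v)" by (intro mult_right_mono box_weight_le_1) simp
    finally show "norm (of_real (box_weight J N v) * ((- 1) ^ card L * a v)) \<le> (\<Prod>f\<in>L. 1 / \<bar>lin_form J F v f\<bar> ^ n f)"
      by (simp add: a_def norm_summand)
    have "(\<lambda>N. of_real (box_weight J N v) * ((- 1) ^ card L * a v)) \<longlonglongrightarrow> of_real 1 * ((- 1) ^ card L * a v)"
      by (intro tendsto_intros box_weight_tendsto)
    then show "(\<lambda>N. of_real (box_weight J N v) * ((- 1) ^ card L * a v)) \<longlonglongrightarrow> (- 1) ^ card L * a v" by simp
  qed
  then show ?thesis by (simp add: mean lattice_sum_def a_def infsum_cmult_right')
qed

lemma lattice_sum_tendsto: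
  assumes summable: "(\<lambda>v. \<Prod>f\<in>L. 1 / \<bar>lin_form J F v f\<bar> ^ n f) summable_on nonzero_points"
    and y: "\<And>j. j \<in> J \<Longrightarrow> (\<lambda>i. z i j) \<longlonglongrightarrow> y j"
  shows "(\<lambda>i. lattice_sum (z i) n) \<longlonglongrightarrow> lattice_sum y n"
  unfolding lattice_sum_def
proof (rule tendsto_infsum_dominated(2)[OF summable])
  show "norm (char_at J (z i) v * (\<Prod>f\<in>L. 1 / of_real (lin_form J F v f) ^ n f))
      \<le> (\<Prod>f\<in>L. 1 / \<bar>lin_form J F v f\<bar> ^ n f)" for i v
    by (simp only: norm_summand order_refl)
  show "(\<lambda>i. char_at J (z i) v * (\<Prod>f\<in>L. 1 / of_real (lin_form J F v f) ^ n f))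
      \<longlonglongrightarrow> char_at J y v * (\<Prod>f\<in>L. 1 / of_real (lin_form J F v f) ^ n f)" for v
    unfolding char_at_def coord_inner_def by (intro tendsto_intros y)
qed

text \<open>Off the walls \<open>1 - frac (- x) = frac x\<close>, so both branches of
  \<open>frac_part\<close> agree; since \<open>dot_of\<close> is integral, the phase depends on the
  fractional part only.\<close>

lemma G_fun_off_walls:
  assumes y: "\<And>B. B \<in> bases J L F \<Longrightarrow> lattice_basis.off_walls J F B y"
  shows "G_fun J L F \<rho> y t = (\<Sum>B\<in>bases J L F. basis_coeff t B * lattice_basis.lerch_sum J F B t y)"
  unfolding G_fun_def
proof (rule sum.cong[OF refl])
  fix B assume B: "B \<in> bases J L F"
  interpret lattice_basis J F B by (rule basis[OF B])
  have factor: "2 * of_real pi * \<i> * t f * expi ((t f - dot_of F f) * of_real (frac_part J F \<rho> B f (y + rep W))) / (expi (t f) - 1)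
      = - t f * (expi (- dot_of F f * of_real (coord (y + rep W) f)) * lerch_fun (t f) (frac (coord (y + rep W) f)))"
    if W: "W \<in> cosets J F B" and f: "f \<in> B" for W f
  proof -
    define x where "x = coord (y + rep W) f"
    have "x \<notin> \<int>" using y[OF B] W f by (simp add: off_walls_def x_def)
    then have fp: "frac_part J F \<rho> B f (y + rep W) = frac x"
      by (simp add: frac_part_def x_def frac_neg)
    have "expi (- dot_of F f * of_int \<lfloor>x\<rfloor>) = 1"
      using dot_Ints[OF f] by (intro expi_int Ints_mult Ints_minus) auto
    moreover have "- dot_of F f * of_real x = - dot_of F f * of_real (frac x) + - dot_of F f * of_int \<lfloor>x\<rfloor>"
      by (simp add: frac_def algebra_simps)
    ultimately have "expi (- dot_of F f * of_real x) = expi (- dot_of F f * of_real (frac x))"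
      by (simp only: expi_add mult_1_right)
    moreover have "expi ((t f - dot_of F f) * of_real (frac x)) = expi (t f * of_real (frac x)) * expi (- dot_of F f * of_real (frac x))"
      by (simp add: left_diff_distrib expi_add[symmetric])
    ultimately show ?thesis
      unfolding fp x_def[symmetric] lerch_fun_def by simp
  qed
  have "(\<Sum>W\<in>cosets J F B. let w = (SOME w. w \<in> W) in
        \<Prod>f\<in>B. 2 * of_real pi * \<i> * t f * expi ((t f - dot_of F f) * of_real (frac_part J F \<rho> B f (y + w))) / (expi (t f) - 1))
     = (\<Sum>W\<in>cosets J F B. \<Prod>f\<in>B. - t f *
        (expi (- dot_of F f * of_real (coord (y + rep W) f)) * lerch_fun (t f) (frac (coord (y + rep W) f))))"
    unfolding Let_def rep_def[symmetric] by (intro sum.cong prod.cong refl factor)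
  also have "\<dots> = (\<Prod>f\<in>B. - t f) * (\<Sum>W\<in>cosets J F B. \<Prod>f\<in>B.
        expi (- dot_of F f * of_real (coord (y + rep W) f)) * lerch_fun (t f) (frac (coord (y + rep W) f)))"
    unfolding prod.distrib[of "\<lambda>f. - t f"] sum_distrib_left ..
  finally show "(\<Prod>g\<in>L-B. - t g / G_denom J F t B g) * (1 / of_nat (card (cosets J F B))) *
      (\<Sum>W\<in>cosets J F B. let w = (SOME w. w \<in> W) in
        \<Prod>f\<in>B. 2 * of_real pi * \<i> * t f * expi ((t f - dot_of F f) * of_real (frac_part J F \<rho> B f (y + w))) / (expi (t f) - 1))
      = basis_coeff t B * lerch_sum t y"
    by (simp add: basis_coeff_def lerch_sum_def)
qed

lemma box_mean_tendsto:
  assumes reg: "regular_point J L F t"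
    and y: "\<And>B. B \<in> bases J L F \<Longrightarrow> lattice_basis.off_walls J F B y"
  shows "(\<lambda>N. box_mean N y t) \<longlonglongrightarrow> G_fun J L F \<rho> y t"
proof -
  have "G_fun J L F \<rho> y t = (\<Sum>B\<in>bases J L F. basis_coeff t B * lattice_basis.lerch_sum J F B t y)"
    by (rule G_fun_off_walls[OF y])
  then show ?thesis
    unfolding box_mean_decomp[OF reg] using regular_expi[OF reg] basis_subset
    by (simp only:) (intro tendsto_intros lattice_basis.box_sum_tendsto basis y, auto)
qed

definition perturb :: "(nat \<Rightarrow> real) \<Rightarrow> (nat \<Rightarrow> real) \<Rightarrow> nat \<Rightarrow> nat \<Rightarrow> real"
  where "perturb \<rho> y i = y + (1 / real (Suc i)) *\<^sub>R \<rho>"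

text \<open>Genericity makes every coordinate of \<rho> with respect to every basis nonzero, so a
  small multiple of \<rho> moves each of the finitely many relevant coordinates off the
  integers.\<close>

lemma perturb_off_walls:
  assumes \<rho>: "generic J L F \<rho>"
  shows "\<forall>\<^sub>F i in sequentially. \<forall>B\<in>bases J L F. lattice_basis.off_walls J F B (perturb \<rho> y i)"
proof -
  have "\<forall>\<^sub>F i in sequentially. coord_inner J (perturb \<rho> y i + w) (dual_vec J F B f) \<notin> \<int>"
    if "B \<in> bases J L F" "f \<in> B" for B f w
  proof -
    define x where "x = coord_inner J (y + w) (dual_vec J F B f)"
    define s where "s = coord_inner J \<rho> (dual_vec J F B f)"
    have s: "s \<noteq> 0" using \<rho> that by (auto simp: generic_def s_def)
    have eq: "coord_inner J (perturb \<rho> y i + w) (dual_vec J F B f) = x + s / real (Suc i)" for i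
      by (simp add: perturb_def coord_inner_left x_def s_def)
    show ?thesis
    proof (cases "s > 0")
      case True
      then show ?thesis unfolding eq by (rule frac_perturb_right(2))
    next
      case False
      then have "\<forall>\<^sub>F i in sequentially. - x + (- s) / real (Suc i) \<notin> \<int>"
        using s by (intro frac_perturb_right(2)) auto
      then show ?thesis
      proof eventually_elim
        case (elim i)
        then show ?case using Ints_minus[of "x + s / real (Suc i)"] by (auto simp: eq)
      qed
    qed
  qed
  then have "\<forall>\<^sub>F i in sequentially. \<forall>B\<in>bases J L F. \<forall>W\<in>cosets J F B. \<forall>f\<in>B.
      coord_inner J (perturb \<rho> y i + lattice_basis.rep W) (dual_vec J F B f) \<notin> \<int>"
    using finite_bases[OF finite_L] lattice_basis.finite_cosets[OF basis] basis_finite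
    by (intro eventually_ball_finite ballI) auto
  then show ?thesis
    by eventually_elim (simp add: lattice_basis.off_walls_def[OF basis])
qed

text \<open>The two branches of \<open>frac_part\<close> are the one-sided limits of the fractional
  part in the direction of \<rho>: from the right where \<rho> has positive coordinate, from the
  left where it has negative coordinate.\<close>

lemma G_fun_perturb_tendsto:
  assumes reg: "regular_point J L F t" and \<rho>: "generic J L F \<rho>"
  shows "(\<lambda>i. G_fun J L F \<rho> (perturb \<rho> y i) t) \<longlonglongrightarrow> G_fun J L F \<rho> y t"
  unfolding G_fun_def Let_def
proof (intro tendsto_sum tendsto_mult tendsto_const tendsto_prod tendsto_divide tendsto_expi tendsto_of_real)
  fix B f W assume B: "B \<in> bases J L F" and f: "f \<in> B"
  define w where "w = (SOME w. w \<in> (W :: (nat \<Rightarrow> real) set))"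
  define x where "x = coord_inner J (y + w) (dual_vec J F B f)"
  define s where "s = coord_inner J \<rho> (dual_vec J F B f)"
  have s: "s \<noteq> 0" using \<rho> B f by (auto simp: generic_def s_def)
  have eq: "coord_inner J (perturb \<rho> y i + w) (dual_vec J F B f) = x + s / real (Suc i)" for i
    by (simp add: perturb_def coord_inner_left x_def s_def)
  have "(\<lambda>i. frac_part J F \<rho> B f (perturb \<rho> y i + w)) \<longlonglongrightarrow> frac_part J F \<rho> B f (y + w)"
  proof (cases "s > 0")
    case True
    then show ?thesis
      using frac_perturb_right(1)[OF True, of x] by (simp add: frac_part_def eq s_def[symmetric] x_def[symmetric])
  next
    case False
    then have "(\<lambda>i. 1 - frac (- x + (- s) / real (Suc i))) \<longlonglongrightarrow> 1 - frac (- x)"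
      using s by (intro tendsto_intros frac_perturb_right(1)) auto
    then show ?thesis
      using False by (simp add: frac_part_def eq s_def[symmetric] x_def[symmetric])
  qed
  then show "(\<lambda>i. frac_part J F \<rho> B f (perturb \<rho> y i + (SOME w. w \<in> W))) \<longlonglongrightarrow> frac_part J F \<rho> B f (y + (SOME w. w \<in> W))"
    by (simp add: w_def)
  show "expi (t f) - 1 \<noteq> 0" using reg B f by (auto simp: regular_point_def)
qed

end

context lattice_family
begin

definition absolutely_convergent :: "(idx \<Rightarrow> nat) \<Rightarrow> bool"
  where "absolutely_convergent n \<longleftrightarrow> (\<forall>f\<in>L. n f \<ge> 1) \<and>
    (\<lambda>v. \<Prod>f\<in>L. 1 / \<bar>lin_form J F v f\<bar> ^ n f) summable_on nonzero_points"

text \<open>Two limits in succession. Off the walls the means converge to G as the cutoff grows. On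
  a wall they need not tend to the one-sided value that \<rho> selects, so G is reached there by a
  second limit over the points \<open>perturb \<rho> y i\<close>; the coefficient bound M holds
  along both.\<close>

theorem G_fun_power_series:
  assumes \<rho>: "generic J L F \<rho>"
  obtains \<delta> c where "\<And>f. f \<in> L \<Longrightarrow> 0 < \<delta> f"
    and "\<And>t. regular_point J L F t \<Longrightarrow> (\<forall>f\<in>L. norm (t f) < \<delta> f) \<Longrightarrow>
      ((\<lambda>n. c n * (\<Prod>f\<in>L. t f ^ n f)) has_sum G_fun J L F \<rho> y t) (multi_indices L)"
    and "\<And>n. n \<in> multi_indices L \<Longrightarrow> absolutely_convergent n \<Longrightarrow> c n = (- 1) ^ card L * lattice_sum y n"
proof -
  obtain \<delta> m where m: "0 < m" and \<delta>: "\<And>f. f \<in> L \<Longrightarrow> 0 < \<delta> f \<and> \<delta> f < 1 \<and> \<delta> f < 1"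
    and denom: "\<And>t B g. (\<forall>f\<in>L. norm (t f) = \<delta> f) \<Longrightarrow> B \<in> bases J L F \<Longrightarrow> g \<in> L - B \<Longrightarrow> m \<le> norm (G_denom J F t B g)"
    and expi: "\<And>t f. (\<forall>f\<in>L. norm (t f) = \<delta> f) \<Longrightarrow> f \<in> L \<Longrightarrow> m \<le> norm (expi (t f) - 1)"
    by (rule regular_torus[OF zero_less_one]) (rule that)
  define M where "M = (\<Sum>B\<in>bases J L F. (\<Prod>g\<in>L-B. 1 / m) * (\<Prod>f\<in>B. 2 * pi * exp (2 * pi) / m))"
  define R where "R = {t. regular_point J L F t \<and> (\<forall>f\<in>L. norm (t f) < \<delta> f)}"
  have \<delta>0: "f \<in> L \<Longrightarrow> 0 < \<delta> f" for f using \<delta> by blast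
  have R: "norm (t f) < \<delta> f" if "t \<in> R" "f \<in> L" for t f using that by (auto simp: R_def)
  have mean_bound: "norm (mean_coeff N y n) * (\<Prod>f\<in>L. \<delta> f ^ n f) \<le> M" if "n \<in> multi_indices L" for N y n
  proof (rule cauchy_estimate_has_sum[OF finite_L \<delta>0 _ _ that])
    fix t :: "idx \<Rightarrow> complex" assume t: "\<forall>f\<in>L. norm (t f) = \<delta> f"
    show "((\<lambda>n. mean_coeff N y n * (\<Prod>f\<in>L. t f ^ n f)) has_sum box_mean N y t) (multi_indices L)"
    proof (rule box_mean_has_sum)
      fix f assume "f \<in> L"
      then have "norm (t f) = \<delta> f" "0 < \<delta> f" "\<delta> f < 1" using t \<delta> by auto
      then show "t f \<noteq> 0 \<and> norm (t f) < 1" by auto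
    qed
    show "norm (box_mean N y t) \<le> M"
      unfolding M_def using t \<delta> by (intro box_mean_bounded m denom expi) (auto simp: less_imp_le)
  qed
  have stage1: "\<exists>c. (\<forall>n\<in>multi_indices L. norm (c n) * (\<Prod>f\<in>L. \<delta> f ^ n f) \<le> M) \<and>
      (\<forall>t\<in>R. ((\<lambda>n. c n * (\<Prod>f\<in>L. t f ^ n f)) has_sum G_fun J L F \<rho> y t) (multi_indices L)) \<and>
      (\<forall>n\<in>multi_indices L. absolutely_convergent n \<longrightarrow> c n = (- 1) ^ card L * lattice_sum y n)"
    if y: "\<forall>B\<in>bases J L F. lattice_basis.off_walls J F B y" for y
  proof -
    obtain c where c: "\<And>n. n \<in> multi_indices L \<Longrightarrow> norm (c n) * (\<Prod>f\<in>L. \<delta> f ^ n f) \<le> M"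
      "\<And>t. t \<in> R \<Longrightarrow> ((\<lambda>n. c n * (\<Prod>f\<in>L. t f ^ n f)) has_sum G_fun J L F \<rho> y t) (multi_indices L)"
      "\<And>n v. n \<in> multi_indices L \<Longrightarrow> (\<lambda>N. mean_coeff N y n) \<longlonglongrightarrow> v \<Longrightarrow> c n = v"
    proof (rule power_series_limit[where b = "\<lambda>N. mean_coeff N y" and M = M and R = R, OF finite_L \<delta>0])
      fix t N assume t: "t \<in> R"
      then have "t f \<noteq> 0 \<and> norm (t f) < 1" if "f \<in> L" for f
        using that \<delta>[of f] regular_nonzero[of t f] by (auto simp: R_def)
      then show "((\<lambda>n. mean_coeff N y n * (\<Prod>f\<in>L. t f ^ n f)) has_sum box_mean N y t) (multi_indices L)"
        by (rule box_mean_has_sum)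
    next
      fix t assume "t \<in> R"
      then show "(\<lambda>N. box_mean N y t) \<longlonglongrightarrow> G_fun J L F \<rho> y t"
        using y by (intro box_mean_tendsto) (auto simp: R_def)
    qed (use that mean_bound R in auto)
    show ?thesis
    proof (intro exI[of _ c] conjI ballI impI)
      fix n assume "n \<in> multi_indices L" "absolutely_convergent n"
      then show "c n = (- 1) ^ card L * lattice_sum y n"
        by (intro c(3) mean_coeff_tendsto) (auto simp: absolutely_convergent_def)
    qed (use c in auto)
  qed
  \<comment> \<open>From \<open>i0\<close> on the perturbed points are off all walls, so the first
    limit applies to each of them.\<close>
  obtain i0 where i0: "\<And>i. i \<ge> i0 \<Longrightarrow> \<forall>B\<in>bases J L F. lattice_basis.off_walls J F B (perturb \<rho> y i)"
    using perturb_off_walls[OF \<rho>, of y] by (auto simp: eventually_sequentially)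
  have "\<forall>i. \<exists>c. (\<forall>n\<in>multi_indices L. norm (c n) * (\<Prod>f\<in>L. \<delta> f ^ n f) \<le> M) \<and>
      (\<forall>t\<in>R. ((\<lambda>n. c n * (\<Prod>f\<in>L. t f ^ n f)) has_sum G_fun J L F \<rho> (perturb \<rho> y (i + i0)) t) (multi_indices L)) \<and>
      (\<forall>n\<in>multi_indices L. absolutely_convergent n \<longrightarrow> c n = (- 1) ^ card L * lattice_sum (perturb \<rho> y (i + i0)) n)"
    by (intro allI stage1 i0) simp
  from choice[OF this] obtain b where b: "\<forall>i. (\<forall>n\<in>multi_indices L. norm (b i n) * (\<Prod>f\<in>L. \<delta> f ^ n f) \<le> M) \<and>
      (\<forall>t\<in>R. ((\<lambda>n. b i n * (\<Prod>f\<in>L. t f ^ n f)) has_sum G_fun J L F \<rho> (perturb \<rho> y (i + i0)) t) (multi_indices L)) \<and>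
      (\<forall>n\<in>multi_indices L. absolutely_convergent n \<longrightarrow> b i n = (- 1) ^ card L * lattice_sum (perturb \<rho> y (i + i0)) n)"
    by blast
  obtain c where c: "\<And>n. n \<in> multi_indices L \<Longrightarrow> norm (c n) * (\<Prod>f\<in>L. \<delta> f ^ n f) \<le> M"
    "\<And>t. t \<in> R \<Longrightarrow> ((\<lambda>n. c n * (\<Prod>f\<in>L. t f ^ n f)) has_sum G_fun J L F \<rho> y t) (multi_indices L)"
    "\<And>n v. n \<in> multi_indices L \<Longrightarrow> (\<lambda>i. b i n) \<longlonglongrightarrow> v \<Longrightarrow> c n = v"
  proof (rule power_series_limit[where b = b and M = M and R = R, OF finite_L \<delta>0])
    fix t assume "t \<in> R"
    then show "(\<lambda>i. G_fun J L F \<rho> (perturb \<rho> y (i + i0)) t) \<longlonglongrightarrow> G_fun J L F \<rho> y t"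
      using \<rho> by (intro LIMSEQ_ignore_initial_segment G_fun_perturb_tendsto) (auto simp: R_def)
  qed (use b that R in auto)
  show ?thesis
  proof (rule that[of \<delta> c])
    fix n assume n: "n \<in> multi_indices L" "absolutely_convergent n"
    have "(\<lambda>i. lattice_sum (perturb \<rho> y i) n) \<longlonglongrightarrow> lattice_sum y n"
    proof (rule lattice_sum_tendsto)
      show "(\<lambda>v. \<Prod>f\<in>L. 1 / \<bar>lin_form J F v f\<bar> ^ n f) summable_on nonzero_points"
        using n(2) by (simp add: absolutely_convergent_def)
      fix j
      have "(\<lambda>i. y j + 1 / real (Suc i) * \<rho> j) \<longlonglongrightarrow> y j + 0 * \<rho> j"
        by (intro tendsto_intros LIMSEQ_Suc[OF lim_const_over_n])
      then show "(\<lambda>i. perturb \<rho> y i j) \<longlonglongrightarrow> y j" by (simp add: perturb_def)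
    qed
    then have "(\<lambda>i. (- 1) ^ card L * lattice_sum (perturb \<rho> y (i + i0)) n) \<longlonglongrightarrow> (- 1) ^ card L * lattice_sum y n"
      by (intro tendsto_mult tendsto_const LIMSEQ_ignore_initial_segment)
    then show "c n = (- 1) ^ card L * lattice_sum y n"
      using b n by (intro c(3)) auto
  qed (use c \<delta>0 in \<open>auto simp: R_def\<close>)
qed

text \<open>Both expansions hold on a small torus that avoids all singularities of the formula for
  G, and the values there determine the coefficients.\<close>

lemma taylor_coeffs_unique:
  assumes c: "taylor_coeffs J L F \<rho> y c" and d: "taylor_coeffs J L F \<rho> y d" and n: "n \<in> multi_indices L"
  shows "c n = d n"
proof -
  obtain e1 where e1: "0 < e1" "\<And>t. (\<forall>f\<in>L. norm (t f) < e1) \<Longrightarrow> regular_point J L F t \<Longrightarrow>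
     ((\<lambda>n. c n * (\<Prod>f\<in>L. t f ^ n f / fact (n f))) has_sum G_fun J L F \<rho> y t) (multi_indices L)"
    using c unfolding taylor_coeffs_def by blast
  obtain e2 where e2: "0 < e2" "\<And>t. (\<forall>f\<in>L. norm (t f) < e2) \<Longrightarrow> regular_point J L F t \<Longrightarrow>
     ((\<lambda>n. d n * (\<Prod>f\<in>L. t f ^ n f / fact (n f))) has_sum G_fun J L F \<rho> y t) (multi_indices L)"
    using d unfolding taylor_coeffs_def by blast
  have "0 < min e1 e2" using e1 e2 by simp
  then obtain \<delta> m where m: "0 < m" and \<delta>: "\<And>f. f \<in> L \<Longrightarrow> 0 < \<delta> f \<and> \<delta> f < min e1 e2 \<and> \<delta> f < 1"
    and denom: "\<And>t B g. (\<forall>f\<in>L. norm (t f) = \<delta> f) \<Longrightarrow> B \<in> bases J L F \<Longrightarrow> g \<in> L - B \<Longrightarrow> m \<le> norm (G_denom J F t B g)"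
    and expi: "\<And>t f. (\<forall>f\<in>L. norm (t f) = \<delta> f) \<Longrightarrow> f \<in> L \<Longrightarrow> m \<le> norm (expi (t f) - 1)"
    by (rule regular_torus) (rule that)
  have reg: "regular_point J L F t" if "\<forall>f\<in>L. norm (t f) = \<delta> f" for t
    using denom[OF that] expi[OF that] m basis_subset unfolding regular_point_def by fastforce
  have split: "(\<lambda>n. c n * (\<Prod>f\<in>L. t f ^ n f / fact (n f)))
      = (\<lambda>n. (c n * (\<Prod>f\<in>L. 1 / fact (n f))) * (\<Prod>f\<in>L. t f ^ n f))" for c and t :: "idx \<Rightarrow> complex"
    by (simp add: fun_eq_iff prod_dividef)
  have "c n * (\<Prod>f\<in>L. 1 / fact (n f)) = d n * (\<Prod>f\<in>L. 1 / fact (n f))"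
  proof (rule power_series_unique[OF finite_L _ _ _ n])
    fix t :: "idx \<Rightarrow> complex" assume t: "\<forall>f\<in>L. norm (t f) = \<delta> f"
    show "((\<lambda>n. c n * (\<Prod>f\<in>L. 1 / fact (n f)) * (\<Prod>f\<in>L. t f ^ n f)) has_sum G_fun J L F \<rho> y t) (multi_indices L)"
      unfolding split[symmetric] using t \<delta> by (intro e1(2) reg) auto
    show "((\<lambda>n. d n * (\<Prod>f\<in>L. 1 / fact (n f)) * (\<Prod>f\<in>L. t f ^ n f)) has_sum G_fun J L F \<rho> y t) (multi_indices L)"
      unfolding split[symmetric] using t \<delta> by (intro e2(2) reg) auto
  qed (use \<delta> in auto)
  moreover have "(\<Prod>f\<in>L. 1 / fact (n f) :: complex) \<noteq> 0" using finite_L by simp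
  ultimately show ?thesis by simp
qed

theorem D_coeff_eq:
  assumes \<rho>: "generic J L F \<rho>" and n: "n \<in> multi_indices L" "absolutely_convergent n"
  shows "D_coeff J L F \<rho> y n = (\<Prod>f\<in>L. fact (n f)) * ((- 1) ^ card L * lattice_sum y n)"
proof -
  obtain \<delta> c where \<delta>: "\<And>f. f \<in> L \<Longrightarrow> 0 < \<delta> f"
    and c: "\<And>t. regular_point J L F t \<Longrightarrow> (\<forall>f\<in>L. norm (t f) < \<delta> f) \<Longrightarrow>
      ((\<lambda>n. c n * (\<Prod>f\<in>L. t f ^ n f)) has_sum G_fun J L F \<rho> y t) (multi_indices L)"
    and cn: "\<And>n. n \<in> multi_indices L \<Longrightarrow> absolutely_convergent n \<Longrightarrow> c n = (- 1) ^ card L * lattice_sum y n"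
    by (rule G_fun_power_series[OF \<rho>, of y]) (rule that)
  \<comment> \<open>\<open>taylor_coeffs\<close> divides by factorials, whereas the series with
    coefficients c does not.\<close>
  define d where "d n = (\<Prod>f\<in>L. fact (n f)) * c n" for n
  define e where "e = Min (insert 1 (\<delta> ` L))"
  have e: "0 < e" "\<And>f. f \<in> L \<Longrightarrow> e \<le> \<delta> f"
    using finite_L \<delta> by (auto simp: e_def)
  have "taylor_coeffs J L F \<rho> y d"
    unfolding taylor_coeffs_def
  proof (intro exI[of _ e] conjI allI impI e(1))
    fix t :: "idx \<Rightarrow> complex"
    assume t: "(\<forall>f\<in>L. norm (t f) < e) \<and> regular_point J L F t"
    have "(\<lambda>n. d n * (\<Prod>f\<in>L. t f ^ n f / fact (n f))) = (\<lambda>n. c n * (\<Prod>f\<in>L. t f ^ n f))"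
      using finite_L by (simp add: d_def fun_eq_iff prod_dividef)
    then show "((\<lambda>n. d n * (\<Prod>f\<in>L. t f ^ n f / fact (n f))) has_sum G_fun J L F \<rho> y t) (multi_indices L)"
      using c[of t] t e(2) by fastforce
  qed
  then have "D_coeff J L F \<rho> y n = d n"
    unfolding D_coeff_def using taylor_coeffs_unique n(1) by (intro the_equality) blast+
  then show ?thesis by (simp add: d_def cn[OF n])
qed

end

section \<open>The parity theorem\<close>

lemma sum_Pow_minus_one: "finite N \<Longrightarrow> (\<Sum>K\<in>Pow N. (- 1) ^ card K) = (if N = {} then 1 else (0 :: complex))"
proof (induction N rule: finite_induct)
  case (insert x N)
  have "(\<Sum>K\<in>Pow (insert x N). (- 1) ^ card K)
      = (\<Sum>K\<in>Pow N. (- 1) ^ card K) + (\<Sum>K\<in>insert x ` Pow N. (- 1) ^ card K :: complex)"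
    unfolding Pow_insert using insert.hyps by (intro sum.union_disjoint) auto
  also have "(\<Sum>K\<in>insert x ` Pow N. (- 1) ^ card K) = (\<Sum>K\<in>Pow N. (- 1) ^ card (insert x K) :: complex)"
    using insert.hyps by (subst sum.reindex) (auto simp: inj_on_def)
  also have "\<dots> = (\<Sum>K\<in>Pow N. - ((- 1) ^ card K))"
  proof (intro sum.cong refl)
    fix K assume "K \<in> Pow N"
    then have "finite K" "x \<notin> K" using insert.hyps finite_subset by auto
    then show "(- 1) ^ card (insert x K) = - ((- 1) ^ card K :: complex)" by simp
  qed
  finally show ?case by (simp add: sum_negf)
qed simp

lemma inverse_power_minus: "1 / (- x) ^ n = (- 1) ^ n * (1 / x ^ n)" for x :: complex
  by (cases "even n") simp_all

definition row_form :: "nat \<Rightarrow> (nat \<Rightarrow> nat \<Rightarrow> nat) \<Rightarrow> nat \<Rightarrow> (nat \<Rightarrow> real) \<Rightarrow> real"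
  where "row_form r A i v = (\<Sum>j\<in>{1..r}. real (A i j) * v j)"

lemma Lambda_idx_cases:
  "f \<in> Lambda_idx l A J \<longleftrightarrow> (\<exists>j\<in>J. f = Inl j) \<or> (\<exists>i\<in>rows_meeting l A J. f = Inr i)"
  by (auto simp: Lambda_idx_def)

lemma finite_rows_meeting: "finite (rows_meeting l A J)"
  by (simp add: rows_meeting_def)

lemma prod_Lambda_idx:
  assumes "finite J"
  shows "(\<Prod>f\<in>Lambda_idx l A J. g f) = (\<Prod>j\<in>J. g (Inl j)) * (\<Prod>i\<in>rows_meeting l A J. g (Inr i))"
  unfolding Lambda_idx_def Plus_def
  using assms finite_rows_meeting[of l A J]
  by (subst prod.union_disjoint) (auto simp: prod.reindex)

text \<open>The unit vectors of J form a basis. A row that meets J has a nonzero coordinate along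
  some unit vector and can be exchanged for it, so every member of the family lies in a
  basis.\<close>

lemma lattice_family_Lambda:
  assumes J: "finite J"
  shows "lattice_family J (Lambda_idx l A J) (Lambda_fam r A J m)"
proof -
  define F where "F = Lambda_fam r A J m"
  define L where "L = Lambda_idx l A J"
  have fin_L: "finite L" using J by (simp add: L_def Lambda_idx_def finite_rows_meeting)
  have vec_Inl: "vec_of F (Inl j) = unitv j" if "j \<in> J" for j
    using that by (auto simp: F_def Lambda_fam_def coord_proj_def unitv_def fun_eq_iff)
  have vec_Inr: "vec_of F (Inr i) = coord_proj J (\<lambda>x. real (A i x))" for i
    by (simp add: F_def Lambda_fam_def)
  have vec: "vec_of F f \<in> coord_lattice J" if "f \<in> L" for f
    using that unitv_in_lattice
    by (auto simp: L_def Lambda_idx_cases vec_Inl vec_Inr coord_proj_def coord_lattice_def coord_space_def)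
  have dot: "dot_of F f \<in> \<int>" for f
    by (cases f) (auto simp: F_def Lambda_fam_def intro!: Ints_minus)
  define B where "B = (Inl ` J :: idx set)"
  have dual: "coord_inner J (vec_of F g) (unitv (projl f)) = (if g = f then 1 else 0)"
    if "f \<in> B" "g \<in> B" for f g
    using that J by (auto simp: B_def vec_Inl coord_inner_unitv) (auto simp: unitv_def split: if_splits)
  have "family_basis J F B"
  proof (rule family_basisI[OF J _ _ dual])
    show "vec_of F f \<in> coord_space J" if "f \<in> B" for f
      using that by (auto simp: B_def vec_Inl unitv_in_space)
    show "u = (\<Sum>f\<in>B. coord_inner J u (unitv (projl f)) *\<^sub>R vec_of F f)" if u: "u \<in> coord_space J" for u
    proof -
      have "(\<Sum>f\<in>B. coord_inner J u (unitv (projl f)) *\<^sub>R vec_of F f) = (\<Sum>x\<in>J. u x *\<^sub>R unitv x)"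
        unfolding B_def
        by (subst sum.reindex) (auto simp: vec_Inl coord_inner_commute[of J u] coord_inner_unitv J intro!: sum.cong)
      then show ?thesis using unitv_expansion[OF J u] by simp
    qed
  qed (use J in \<open>auto simp: B_def\<close>)
  then interpret family_basis J F B .
  have BL: "B \<subseteq> L" by (auto simp: B_def L_def Lambda_idx_cases)
  have B: "B \<in> bases J L F" using BL family_basis_axioms by (simp add: bases_iff[OF J fin_L])
  have covered: "\<exists>B\<in>bases J L F. f \<in> B" if f: "f \<in> L" for f
  proof (cases "f \<in> B")
    case False
    then obtain i j where i: "i \<in> rows_meeting l A J" "f = Inr i" and j: "j \<in> J" "A i j \<noteq> 0"
      using f by (auto simp: L_def Lambda_idx_cases B_def rows_meeting_def)
    have jB: "Inl j \<in> B" using j by (simp add: B_def)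
    have "dual (Inl j) = unitv j"
      using dual[OF jB] unitv_in_space[OF j(1)] by (intro dual_unique) auto
    then have "coord (vec_of F f) (Inl j) = coord_inner J (unitv j) (vec_of F f)"
      by (simp only: coord_inner_commute)
    also have "\<dots> = real (A i j)"
      using j(1) by (simp add: coord_inner_unitv[OF J] i vec_Inr coord_proj_def)
    finally have "coord (vec_of F f) (Inl j) = real (A i j)" .
    then have "family_basis J F (insert f (B - {Inl j}))"
      using vec[OF f] j(2) by (intro exchange(1) jB False) (auto simp: coord_lattice_imp_space)
    then have "insert f (B - {Inl j}) \<in> bases J L F" using BL f by (auto simp: bases_iff[OF J fin_L])
    then show ?thesis by blast
  qed (use B in blast)
  show ?thesis
    unfolding F_def[symmetric] L_def[symmetric]
    by unfold_locales (use J fin_L vec dot B covered in auto)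
qed

section \<open>Lattice points of Z^r and their sign patterns\<close>

locale parity_data =
  fixes r l :: nat and A :: "nat \<Rightarrow> nat \<Rightarrow> nat" and h k :: "nat \<Rightarrow> nat"
  assumes no_zero_row: "\<forall>i\<in>{1..l}. \<exists>j\<in>{1..r}. A i j \<noteq> 0"
    and h_pos: "\<forall>j\<in>{1..r}. h j \<ge> 1"
    and k_pos: "\<forall>i\<in>{1..l}. k i \<ge> 1"
    and convergence: "\<forall>J. J \<subseteq> {1..r} \<longrightarrow>
      (\<lambda>m. (\<Prod>j\<in>{1..r}. 1 / real (m j) ^ h j) *
            (\<Prod>i\<in>{1..l}. 1 / \<bar>signed_form r A J i m\<bar> ^ k i))
        summable_on {m \<in> pos_tuples {1..r}. \<forall>i\<in>{1..l}. signed_form r A J i m \<noteq> 0}"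
begin

abbreviation row :: "nat \<Rightarrow> (nat \<Rightarrow> real) \<Rightarrow> real" where "row \<equiv> row_form r A"

definition points :: "(nat \<Rightarrow> real) set"
  where "points = {v \<in> coord_lattice {1..r}. (\<forall>j\<in>{1..r}. v j \<noteq> 0) \<and> (\<forall>i\<in>{1..l}. row i v \<noteq> 0)}"

definition point_term :: "(nat \<Rightarrow> real) \<Rightarrow> (nat \<Rightarrow> real) \<Rightarrow> complex"
  where "point_term y v = char_at {1..r} y v *
    ((\<Prod>j\<in>{1..r}. 1 / of_real (v j) ^ h j) * (\<Prod>i\<in>{1..l}. 1 / of_real (row i v) ^ k i))"

definition majorant :: "(nat \<Rightarrow> real) \<Rightarrow> real"
  where "majorant v = (\<Prod>j\<in>{1..r}. 1 / \<bar>v j\<bar> ^ h j) * (\<Prod>i\<in>{1..l}. 1 / \<bar>row i v\<bar> ^ k i)"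

lemma norm_point_term: "norm (point_term y v) = majorant v"
  by (simp add: point_term_def majorant_def char_at_def norm_mult norm_divide norm_power flip: prod_norm)

definition signed_point :: "nat set \<Rightarrow> (nat \<Rightarrow> nat) \<Rightarrow> nat \<Rightarrow> real"
  where "signed_point P m = (\<lambda>j. if j \<in> P then real (m j) else if j \<in> {1..r} then - real (m j) else 0)"

definition orthant :: "nat set \<Rightarrow> (nat \<Rightarrow> real) set"
  where "orthant P = {v \<in> points. \<forall>j\<in>{1..r}. v j > 0 \<longleftrightarrow> j \<in> P}"

lemma row_signed_point: "P \<subseteq> {1..r} \<Longrightarrow> row i (signed_point P m) = signed_form r A P i m"
proof -
  assume P: "P \<subseteq> {1..r}"
  have "row i (signed_point P m)
      = (\<Sum>j\<in>{1..r}-P. real (A i j) * signed_point P m j) + (\<Sum>j\<in>P. real (A i j) * signed_point P m j)"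
    unfolding row_form_def by (rule sum.subset_diff[OF P]) simp
  also have "(\<Sum>j\<in>P. real (A i j) * signed_point P m j) = (\<Sum>j\<in>P. real (A i j) * real (m j))"
    by (simp add: signed_point_def)
  also have "(\<Sum>j\<in>{1..r}-P. real (A i j) * signed_point P m j) = - (\<Sum>j\<in>{1..r}-P. real (A i j) * real (m j))"
    unfolding sum_negf[symmetric] by (intro sum.cong) (auto simp: signed_point_def)
  finally show ?thesis by (simp add: signed_form_def)
qed

text \<open>The absolute values of the coordinates parametrise an orthant, and \<open>row\<close>
  becomes \<open>signed_form\<close>; this turns the convergence hypothesis for P into summability
  over one orthant.\<close>

lemma bij_signed_point:
  assumes P: "P \<subseteq> {1..r}"
  shows "bij_betw (signed_point P) {m \<in> pos_tuples {1..r}. \<forall>i\<in>{1..l}. signed_form r A P i m \<noteq> 0} (orthant P)"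
proof (rule bij_betw_byWitness[where f' = "\<lambda>v. restrict (\<lambda>j. nat \<lfloor>\<bar>v j\<bar>\<rfloor>) {1..r}"])
  show "\<forall>m\<in>{m \<in> pos_tuples {1..r}. \<forall>i\<in>{1..l}. signed_form r A P i m \<noteq> 0}.
      restrict (\<lambda>j. nat \<lfloor>\<bar>signed_point P m j\<bar>\<rfloor>) {1..r} = m"
  proof
    fix m assume "m \<in> {m \<in> pos_tuples {1..r}. \<forall>i\<in>{1..l}. signed_form r A P i m \<noteq> 0}"
    then have m: "m \<in> {1..r} \<rightarrow>\<^sub>E {1..}" by (simp add: pos_tuples_def)
    show "restrict (\<lambda>j. nat \<lfloor>\<bar>signed_point P m j\<bar>\<rfloor>) {1..r} = m"
    proof
      fix j
      show "restrict (\<lambda>j. nat \<lfloor>\<bar>signed_point P m j\<bar>\<rfloor>) {1..r} j = m j"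
        using PiE_arb[OF m, of j] by (cases "j \<in> {1..r}") (auto simp: signed_point_def)
    qed
  qed
  show "\<forall>v\<in>orthant P. signed_point P (restrict (\<lambda>j. nat \<lfloor>\<bar>v j\<bar>\<rfloor>) {1..r}) = v"
  proof
    fix v assume v: "v \<in> orthant P"
    show "signed_point P (restrict (\<lambda>j. nat \<lfloor>\<bar>v j\<bar>\<rfloor>) {1..r}) = v"
    proof
      fix j
      show "signed_point P (restrict (\<lambda>j. nat \<lfloor>\<bar>v j\<bar>\<rfloor>) {1..r}) j = v j"
      proof (cases "j \<in> {1..r}")
        case True
        have "v j \<in> \<int>" using v by (simp add: orthant_def points_def coord_lattice_def)
        then have "\<bar>v j\<bar> \<in> \<int>" by simp
        then have "real (nat \<lfloor>\<bar>v j\<bar>\<rfloor>) = \<bar>v j\<bar>" by simp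
        moreover have "(v j > 0 \<longleftrightarrow> j \<in> P)" "v j \<noteq> 0" using v True by (auto simp: orthant_def points_def)
        ultimately show ?thesis using True by (auto simp: signed_point_def)
      next
        case False
        then show ?thesis
          using v P by (auto simp: signed_point_def orthant_def points_def coord_lattice_def coord_space_def)
      qed
    qed
  qed
  show "signed_point P ` {m \<in> pos_tuples {1..r}. \<forall>i\<in>{1..l}. signed_form r A P i m \<noteq> 0} \<subseteq> orthant P"
  proof
    fix v assume "v \<in> signed_point P ` {m \<in> pos_tuples {1..r}. \<forall>i\<in>{1..l}. signed_form r A P i m \<noteq> 0}"
    then obtain m where v: "v = signed_point P m" and m: "m \<in> {1..r} \<rightarrow>\<^sub>E {1..}"
      and nz: "\<forall>i\<in>{1..l}. signed_form r A P i m \<noteq> 0" by (auto simp: pos_tuples_def)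
    have pos: "m j > 0" if "j \<in> {1..r}" for j using PiE_mem[OF m that] by simp
    have "v \<in> coord_lattice {1..r}"
      using P by (auto simp: v signed_point_def coord_lattice_def coord_space_def)
    moreover have "signed_point P m j \<noteq> 0" "signed_point P m j > 0 \<longleftrightarrow> j \<in> P" if "j \<in> {1..r}" for j
      using that pos[OF that] by (auto simp: signed_point_def)
    ultimately show "v \<in> orthant P"
      using nz by (simp add: orthant_def points_def v row_signed_point[OF P])
  qed
  show "(\<lambda>v. restrict (\<lambda>j. nat \<lfloor>\<bar>v j\<bar>\<rfloor>) {1..r}) ` orthant P
      \<subseteq> {m \<in> pos_tuples {1..r}. \<forall>i\<in>{1..l}. signed_form r A P i m \<noteq> 0}"
  proof
    fix m assume "m \<in> (\<lambda>v. restrict (\<lambda>j. nat \<lfloor>\<bar>v j\<bar>\<rfloor>) {1..r}) ` orthant P"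
    then obtain v where m: "m = restrict (\<lambda>j. nat \<lfloor>\<bar>v j\<bar>\<rfloor>) {1..r}" and v: "v \<in> orthant P" by blast
    have "1 \<le> nat \<lfloor>\<bar>v j\<bar>\<rfloor>" if "j \<in> {1..r}" for j
    proof -
      have "v j \<in> \<int>" "v j \<noteq> 0" using v that by (auto simp: orthant_def points_def coord_lattice_def)
      then have "1 \<le> \<bar>v j\<bar>" by (auto elim!: Ints_cases)
      then show ?thesis by linarith
    qed
    moreover have "signed_point P m = v"
      using \<open>\<forall>v\<in>orthant P. signed_point P (restrict (\<lambda>j. nat \<lfloor>\<bar>v j\<bar>\<rfloor>) {1..r}) = v\<close> v m by simp
    then have "signed_form r A P i m \<noteq> 0" if "i \<in> {1..l}" for i
    proof -
      have "row i v \<noteq> 0" using v that by (simp add: orthant_def points_def)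
      then show ?thesis using row_signed_point[OF P, of i m] \<open>signed_point P m = v\<close> by simp
    qed
    ultimately show "m \<in> {m \<in> pos_tuples {1..r}. \<forall>i\<in>{1..l}. signed_form r A P i m \<noteq> 0}"
      by (auto simp: pos_tuples_def m)
  qed
qed

lemma majorant_signed_point:
  assumes "P \<subseteq> {1..r}"
  shows "majorant (signed_point P m) = (\<Prod>j\<in>{1..r}. 1 / real (m j) ^ h j) *
            (\<Prod>i\<in>{1..l}. 1 / \<bar>signed_form r A P i m\<bar> ^ k i)"
  unfolding majorant_def row_signed_point[OF assms]
  by (intro arg_cong2[where f = "(*)"] prod.cong refl) (auto simp: signed_point_def)

text \<open>Finitely many disjoint orthants cover the points, and the hypothesis for P treats the
  orthant of P.\<close>

lemma majorant_summable: "majorant summable_on points"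
proof -
  have "majorant summable_on orthant P" if P: "P \<subseteq> {1..r}" for P
    using convergence P summable_on_reindex_bij_betw[OF bij_signed_point[OF P], of majorant]
    by (simp add: majorant_signed_point[OF P])
  then have "(majorant has_sum (\<Sum>P\<in>Pow {1..r}. infsum majorant (orthant P))) (\<Union> (orthant ` Pow {1..r}))"
    by (intro sum_has_sum has_sum_infsum) (auto simp: orthant_def)
  moreover have "\<Union> (orthant ` Pow {1..r}) = points"
  proof
    show "points \<subseteq> \<Union> (orthant ` Pow {1..r})"
    proof
      fix v assume "v \<in> points"
      then have "v \<in> orthant {j\<in>{1..r}. v j > 0}" by (simp add: orthant_def)
      then show "v \<in> \<Union> (orthant ` Pow {1..r})" by (rule UN_I[rotated]) auto
    qed
  qed (auto simp: orthant_def)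
  ultimately show ?thesis by (auto simp: has_sum_imp_summable)
qed

lemma point_term_summable: "S \<subseteq> points \<Longrightarrow> point_term y summable_on S"
proof -
  assume S: "S \<subseteq> points"
  have "(\<lambda>v. norm (point_term y v)) summable_on S"
    unfolding norm_point_term by (rule summable_on_subset_banach[OF majorant_summable S])
  then show ?thesis by (rule abs_summable_summable)
qed

section \<open>Inclusion-exclusion over signs\<close>

definition half_points :: "nat set \<Rightarrow> (nat \<Rightarrow> real) set"
  where "half_points J = {v \<in> points. \<forall>j\<in>{1..r}-J. v j < 0}"

text \<open>If N is the set of negative coordinates of v, then v lies in
  \<open>half_points J\<close> exactly when the complement of J is contained in N. As
  \<open>r + card J\<close> has the parity of the size of that complement, the signs at v form an
  alternating sum over the subsets of N, which vanishes unless N is empty.\<close>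

lemma inclusion_exclusion:
  "(\<Sum>J\<in>Pow {1..r}. (- 1) ^ (r + card J) * infsum (point_term y) (half_points J)) = infsum (point_term y) (orthant {1..r})"
proof -
  have half: "infsum (point_term y) (half_points J)
      = infsum (\<lambda>v. if v \<in> half_points J then point_term y v else 0) points" for J
    by (rule infsum_cong_neutral) (auto simp: half_points_def)
  have summ: "(\<lambda>v. if v \<in> half_points J then point_term y v else 0) summable_on points" for J
  proof -
    have "point_term y summable_on half_points J" by (rule point_term_summable) (auto simp: half_points_def)
    then show ?thesis
      by (subst summable_on_cong_neutral[where T = "half_points J" and g = "point_term y"]) (auto simp: half_points_def)
  qed
  have "((\<lambda>v. \<Sum>J\<in>Pow {1..r}. (- 1) ^ (r + card J) * (if v \<in> half_points J then point_term y v else 0)) has_sum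
      (\<Sum>J\<in>Pow {1..r}. (- 1) ^ (r + card J) * infsum (point_term y) (half_points J))) points"
    unfolding half by (intro has_sum_sum_pointwise has_sum_cmult_right has_sum_infsum summ) simp
  moreover have "(\<Sum>J\<in>Pow {1..r}. (- 1) ^ (r + card J) * (if v \<in> half_points J then point_term y v else 0))
      = (if v \<in> orthant {1..r} then point_term y v else 0)" if v: "v \<in> points" for v
  proof -
    define N where "N = {j\<in>{1..r}. v j < 0}"
    have "(\<Sum>J\<in>Pow {1..r}. (- 1) ^ (r + card J) * (if v \<in> half_points J then point_term y v else 0))
        = (\<Sum>J\<in>{J\<in>Pow {1..r}. v \<in> half_points J}. (- 1) ^ (r + card J) * point_term y v)"
      by (subst sum.inter_filter) (auto intro!: sum.cong)
    also have "\<dots> = (\<Sum>K\<in>Pow N. (- 1) ^ card K * point_term y v)"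
    proof (rule sum.reindex_bij_witness[where i = "\<lambda>K. {1..r} - K" and j = "\<lambda>J. {1..r} - J"])
      fix J assume J: "J \<in> {J\<in>Pow {1..r}. v \<in> half_points J}"
      have "card J + card ({1..r} - J) = r"
        using J card_Diff_subset[of J "{1..r}"] card_mono[of "{1..r}" J] by (auto simp: finite_subset)
      then have "r + card J = card ({1..r} - J) + 2 * card J" by simp
      then have "(- 1) ^ (r + card J) = ((- 1) ^ card ({1..r} - J) :: complex)"
        by (simp only: power_add power_mult) simp
      then show "(- 1) ^ card ({1..r} - J) * point_term y v = (- 1) ^ (r + card J) * point_term y v" by simp
    qed (use v in \<open>auto simp: N_def half_points_def\<close>)
    also have "\<dots> = (if N = {} then 1 else 0) * point_term y v"
      unfolding sum_distrib_right[symmetric] by (subst sum_Pow_minus_one) (auto simp: N_def)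
    also have "N = {} \<longleftrightarrow> v \<in> orthant {1..r}"
    proof -
      have "v j > 0 \<longleftrightarrow> \<not> v j < 0" if "j \<in> {1..r}" for j
        using v that unfolding points_def mem_Collect_eq by (metis linorder_neqE not_less_iff_gr_or_eq)
      then show ?thesis using v by (auto simp: N_def orthant_def)
    qed
    finally show ?thesis by simp
  qed
  ultimately have "((\<lambda>v. if v \<in> orthant {1..r} then point_term y v else 0) has_sum
      (\<Sum>J\<in>Pow {1..r}. (- 1) ^ (r + card J) * infsum (point_term y) (half_points J))) points"
    by (simp cong: has_sum_cong)
  then have "(\<Sum>J\<in>Pow {1..r}. (- 1) ^ (r + card J) * infsum (point_term y) (half_points J))
      = infsum (\<lambda>v. if v \<in> orthant {1..r} then point_term y v else 0) points"
    by (simp add: infsumI)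
  also have "\<dots> = infsum (point_term y) (orthant {1..r})"
    by (rule infsum_cong_neutral) (auto simp: orthant_def)
  finally show ?thesis .
qed

lemma signed_form_extreme:
  assumes m: "m \<in> pos_tuples {1..r}" and i: "i \<in> {1..l}"
  shows "signed_form r A {1..r} i m = real (\<Sum>j\<in>{1..r}. A i j * m j)"
    and "signed_form r A {} i m = - real (\<Sum>j\<in>{1..r}. A i j * m j)"
    and "(\<Sum>j\<in>{1..r}. A i j * m j) > 0"
proof -
  show "signed_form r A {1..r} i m = real (\<Sum>j\<in>{1..r}. A i j * m j)"
    "signed_form r A {} i m = - real (\<Sum>j\<in>{1..r}. A i j * m j)"
    by (simp_all add: signed_form_def)
  obtain j where j: "j \<in> {1..r}" "A i j \<noteq> 0" using no_zero_row i by blast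
  then have "0 < A i j * m j" using m by (auto simp: pos_tuples_def dest!: PiE_mem)
  then show "(\<Sum>j\<in>{1..r}. A i j * m j) > 0"
    using j(1) by (intro sum_pos2[of _ j]) auto
qed

lemma orthant_full_eq_zeta: "infsum (point_term y) (orthant {1..r}) = zeta_rl r l h k y A"
proof -
  have dom: "{m \<in> pos_tuples {1..r}. \<forall>i\<in>{1..l}. signed_form r A {1..r} i m \<noteq> 0} = pos_tuples {1..r}"
  proof -
    have "signed_form r A {1..r} i m \<noteq> 0" if "m \<in> pos_tuples {1..r}" "i \<in> {1..l}" for m i
      using signed_form_extreme(1,3)[OF that] by linarith
    then show ?thesis by blast
  qed
  have "infsum (point_term y) (orthant {1..r}) = infsum (\<lambda>m. point_term y (signed_point {1..r} m)) (pos_tuples {1..r})"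
    using infsum_reindex_bij_betw[OF bij_signed_point[OF order_refl], of "point_term y"] unfolding dom by simp
  also have "\<dots> = zeta_rl r l h k y A"
    unfolding zeta_rl_def
  proof (rule infsum_cong)
    fix m assume m: "m \<in> pos_tuples {1..r}"
    have "char_at {1..r} y (signed_point {1..r} m) = (\<Prod>j\<in>{1..r}. expi (of_real (real (m j) * y j)))"
      unfolding char_at_def coord_inner_def of_real_sum
      by (subst expi_sum) (auto simp: signed_point_def mult.commute intro!: prod.cong)
    moreover have "(\<Prod>i\<in>{1..l}. 1 / of_real (row i (signed_point {1..r} m)) ^ k i)
        = (\<Prod>i\<in>{1..l}. 1 / of_nat (\<Sum>j\<in>{1..r}. A i j * m j) ^ k i :: complex)"
      by (intro prod.cong refl) (simp only: row_signed_point[OF order_refl] signed_form_extreme[OF m] of_real_of_nat_eq)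
    moreover have "(\<Prod>j\<in>{1..r}. 1 / of_real (signed_point {1..r} m j) ^ h j) = (\<Prod>j\<in>{1..r}. 1 / of_nat (m j) ^ h j :: complex)"
      by (intro prod.cong refl) (simp add: signed_point_def)
    ultimately show "point_term y (signed_point {1..r} m) =
       (\<Prod>j\<in>{1..r}. expi (of_real (real (m j) * y j)) / of_nat (m j) ^ h j) *
       (\<Prod>i\<in>{1..l}. 1 / of_nat (\<Sum>j\<in>{1..r}. A i j * m j) ^ k i)"
      unfolding point_term_def by (simp add: prod_dividef)
  qed
  finally show ?thesis .
qed

text \<open>With v = - m every coordinate and every row changes sign, which puts the total weight
  into the exponent of - 1, and the character passes from y to - y.\<close>

lemma half_points_empty_eq_zeta:
  "infsum (point_term y) (half_points {}) = (- 1) ^ ((\<Sum>j\<in>{1..r}. h j) + (\<Sum>i\<in>{1..l}. k i)) * zeta_rl r l h k (\<lambda>j. - y j) A"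
proof -
  have dom: "{m \<in> pos_tuples {1..r}. \<forall>i\<in>{1..l}. signed_form r A {} i m \<noteq> 0} = pos_tuples {1..r}"
  proof -
    have "signed_form r A {} i m \<noteq> 0" if "m \<in> pos_tuples {1..r}" "i \<in> {1..l}" for m i
      using signed_form_extreme(2,3)[OF that] by linarith
    then show ?thesis by blast
  qed
  have "half_points {} = orthant {}"
  proof -
    have "v j < 0 \<longleftrightarrow> \<not> v j > 0" if "v \<in> points" "j \<in> {1..r}" for v j
      using that unfolding points_def mem_Collect_eq by (metis linorder_neqE not_less_iff_gr_or_eq)
    then show ?thesis by (simp add: half_points_def orthant_def cong: conj_cong)
  qed
  then have "infsum (point_term y) (half_points {}) = infsum (\<lambda>m. point_term y (signed_point {} m)) (pos_tuples {1..r})"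
    using infsum_reindex_bij_betw[OF bij_signed_point[OF empty_subsetI], of "point_term y"] unfolding dom by simp
  also have "\<dots> = infsum (\<lambda>m. (- 1) ^ ((\<Sum>j\<in>{1..r}. h j) + (\<Sum>i\<in>{1..l}. k i)) *
       ((\<Prod>j\<in>{1..r}. expi (of_real (real (m j) * - y j)) / of_nat (m j) ^ h j) *
       (\<Prod>i\<in>{1..l}. 1 / of_nat (\<Sum>j\<in>{1..r}. A i j * m j) ^ k i))) (pos_tuples {1..r})"
  proof (rule infsum_cong)
    fix m assume m: "m \<in> pos_tuples {1..r}"
    have "char_at {1..r} y (signed_point {} m) = (\<Prod>j\<in>{1..r}. expi (of_real (real (m j) * - y j)))"
      unfolding char_at_def coord_inner_def of_real_sum
      by (subst expi_sum) (auto simp: signed_point_def mult.commute intro!: prod.cong)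
    moreover have "(\<Prod>i\<in>{1..l}. 1 / of_real (row i (signed_point {} m)) ^ k i)
        = (- 1) ^ (\<Sum>i\<in>{1..l}. k i) * (\<Prod>i\<in>{1..l}. 1 / of_nat (\<Sum>j\<in>{1..r}. A i j * m j) ^ k i :: complex)"
      unfolding power_sum prod.distrib[symmetric]
      by (intro prod.cong refl)
        (simp only: row_signed_point[OF empty_subsetI] signed_form_extreme[OF m] of_real_minus of_real_of_nat_eq
          inverse_power_minus)
    moreover have "(\<Prod>j\<in>{1..r}. 1 / of_real (signed_point {} m j) ^ h j)
        = (- 1) ^ (\<Sum>j\<in>{1..r}. h j) * (\<Prod>j\<in>{1..r}. 1 / of_nat (m j) ^ h j :: complex)"
      unfolding power_sum prod.distrib[symmetric]
      by (intro prod.cong refl) (simp add: signed_point_def inverse_power_minus)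
    ultimately show "point_term y (signed_point {} m) = (- 1) ^ ((\<Sum>j\<in>{1..r}. h j) + (\<Sum>i\<in>{1..l}. k i)) *
       ((\<Prod>j\<in>{1..r}. expi (of_real (real (m j) * - y j)) / of_nat (m j) ^ h j) *
       (\<Prod>i\<in>{1..l}. 1 / of_nat (\<Sum>j\<in>{1..r}. A i j * m j) ^ k i))"
      unfolding point_term_def by (simp add: prod_dividef power_add)
  qed
  also have "\<dots> = (- 1) ^ ((\<Sum>j\<in>{1..r}. h j) + (\<Sum>i\<in>{1..l}. k i)) * zeta_rl r l h k (\<lambda>j. - y j) A"
    unfolding zeta_rl_def by (rule infsum_cmult_right')
  finally show ?thesis .
qed

text \<open>A point of Z^r cut into free coordinates u on J and fixed coordinates - m outside J; the
  minus sign matches the constants in \<open>Lambda_fam\<close>.\<close>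

definition glue :: "nat set \<Rightarrow> (nat \<Rightarrow> nat) \<Rightarrow> (nat \<Rightarrow> real) \<Rightarrow> nat \<Rightarrow> real"
  where "glue J m u = (\<lambda>j. if j \<in> J then u j else if j \<in> {1..r} then - real (m j) else 0)"

abbreviation slice :: "nat set \<Rightarrow> (nat \<Rightarrow> nat) \<Rightarrow> (nat \<Rightarrow> real) set"
  where "slice J m \<equiv> lattice_family.nonzero_points J (Lambda_idx l A J) (Lambda_fam r A J m)"

abbreviation exponents :: "nat set \<Rightarrow> idx \<Rightarrow> nat"
  where "exponents J \<equiv> restrict (case_sum h k) (Lambda_idx l A J)"

section \<open>The sum for a fixed J, slice by slice\<close>

context
  fixes J :: "nat set"
  assumes J: "J \<noteq> {}" "J \<subseteq> {1..r}"
begin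

lemma finite_J: "finite J"
  using J finite_subset by blast

lemma row_glue:
  "row i (glue J m u) = (\<Sum>j\<in>J. real (A i j) * u j) - (\<Sum>j\<in>{1..r}-J. real (A i j) * real (m j))"
proof -
  have "row i (glue J m u)
      = (\<Sum>j\<in>{1..r}-J. real (A i j) * glue J m u j) + (\<Sum>j\<in>J. real (A i j) * glue J m u j)"
    unfolding row_form_def by (rule sum.subset_diff[OF J(2)]) simp
  also have "(\<Sum>j\<in>J. real (A i j) * glue J m u j) = (\<Sum>j\<in>J. real (A i j) * u j)"
    by (simp add: glue_def)
  also have "(\<Sum>j\<in>{1..r}-J. real (A i j) * glue J m u j) = - (\<Sum>j\<in>{1..r}-J. real (A i j) * real (m j))"
    unfolding sum_negf[symmetric] by (intro sum.cong) (auto simp: glue_def)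
  finally show ?thesis by simp
qed

lemma lin_form_Inl: "j \<in> J \<Longrightarrow> lin_form J (Lambda_fam r A J m) u (Inl j) = glue J m u j"
proof -
  assume j: "j \<in> J"
  have "coord_proj J (\<lambda>x. if x = j then 1 else 0) = unitv j"
    using j by (auto simp: coord_proj_def unitv_def)
  then show ?thesis
    using j coord_inner_unitv[OF finite_J j] by (simp add: lin_form_def Lambda_fam_def glue_def)
qed

text \<open>The constant in \<open>Lambda_fam\<close> is the contribution of the coordinates - m. So
  the forms of the family are the coordinates in J and the rows meeting J, restricted to a slice of
  Z^r.\<close>

lemma lin_form_Inr: "lin_form J (Lambda_fam r A J m) u (Inr i) = row i (glue J m u)"
  by (simp add: lin_form_def Lambda_fam_def row_glue coord_inner_def coord_proj_def)

lemma row_glue_other: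
  assumes m: "m \<in> pos_tuples ({1..r} - J)" and i: "i \<in> {1..l} - rows_meeting l A J"
  shows "row i (glue J m u) = - real (\<Sum>j\<in>{1..r}-J. A i j * m j)"
    and "(\<Sum>j\<in>{1..r}-J. A i j * m j) > 0"
proof -
  have 0: "A i j = 0" if "j \<in> J" for j using i that by (auto simp: rows_meeting_def)
  then show "row i (glue J m u) = - real (\<Sum>j\<in>{1..r}-J. A i j * m j)"
    by (simp add: row_glue)
  obtain j where j: "j \<in> {1..r}" "A i j \<noteq> 0" using no_zero_row i by blast
  then have j': "j \<in> {1..r} - J" using 0 by auto
  then have "0 < A i j * m j" using m j by (auto simp: pos_tuples_def dest!: PiE_mem)
  then show "(\<Sum>j\<in>{1..r}-J. A i j * m j) > 0"
    using j' by (intro sum_pos2[of _ j]) auto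
qed

text \<open>The remaining conditions in \<open>points\<close> hold automatically: coordinates
  outside J are negative, and a nonzero row that misses J sees only these.\<close>

lemma slice_iff:
  assumes m: "m \<in> pos_tuples ({1..r} - J)"
  shows "u \<in> slice J m \<longleftrightarrow> u \<in> coord_lattice J \<and> glue J m u \<in> points"
proof -
  have "glue J m u \<in> coord_lattice {1..r}" if "u \<in> coord_lattice J"
    using that J by (auto simp: glue_def coord_lattice_def coord_space_def)
  moreover have "glue J m u j \<noteq> 0" if "j \<in> {1..r} - J" for j
    using that m by (auto simp: glue_def pos_tuples_def dest!: PiE_mem)
  moreover have "row i (glue J m u) \<noteq> 0" if "i \<in> {1..l} - rows_meeting l A J" for i
    using row_glue_other(1)[OF m that, of u] row_glue_other(2)[OF m that] by linarith
  moreover have "u \<in> slice J m \<longleftrightarrow> u \<in> coord_lattice J \<and> (\<forall>j\<in>J. glue J m u j \<noteq> 0) \<and>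
      (\<forall>i\<in>rows_meeting l A J. row i (glue J m u) \<noteq> 0)"
    unfolding lattice_family.nonzero_points_def[OF lattice_family_Lambda[OF finite_J]] mem_Collect_eq
    by (simp add: Lambda_idx_def ball_Un lin_form_Inl lin_form_Inr Plus_def)
  moreover have "rows_meeting l A J \<subseteq> {1..l}" by (auto simp: rows_meeting_def)
  ultimately show ?thesis
    using J(2) unfolding points_def by blast
qed

text \<open>Sorts \<open>half_points J\<close> by the coordinates outside J, which are the outer
  summation variables of T with reversed sign.\<close>

lemma bij_glue: "bij_betw (\<lambda>(m, u). glue J m u) (Sigma (pos_tuples ({1..r} - J)) (slice J)) (half_points J)"
proof (rule bij_betw_byWitness[where f' = "\<lambda>v. (restrict (\<lambda>j. nat \<lfloor>- v j\<rfloor>) ({1..r} - J), coord_proj J v)"])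
  have inv: "restrict (\<lambda>j. nat \<lfloor>- glue J m u j\<rfloor>) ({1..r} - J) = m \<and> coord_proj J (glue J m u) = u"
    if m: "m \<in> pos_tuples ({1..r} - J)" and u: "u \<in> slice J m" for m u
  proof
    have mP: "m \<in> ({1..r} - J) \<rightarrow>\<^sub>E {1..}" using m by (simp add: pos_tuples_def)
    show "restrict (\<lambda>j. nat \<lfloor>- glue J m u j\<rfloor>) ({1..r} - J) = m"
    proof
      fix j
      show "restrict (\<lambda>j. nat \<lfloor>- glue J m u j\<rfloor>) ({1..r} - J) j = m j"
        using PiE_arb[OF mP, of j] by (cases "j \<in> {1..r} - J") (auto simp: glue_def)
    qed
    have "u \<in> coord_lattice J" using u m by (simp add: slice_iff)
    then show "coord_proj J (glue J m u) = u"
      by (auto simp: coord_proj_def glue_def coord_lattice_def coord_space_def fun_eq_iff)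
  qed
  then show "\<forall>p\<in>Sigma (pos_tuples ({1..r} - J)) (slice J).
      (restrict (\<lambda>j. nat \<lfloor>- (case p of (m, u) \<Rightarrow> glue J m u) j\<rfloor>) ({1..r} - J),
       coord_proj J (case p of (m, u) \<Rightarrow> glue J m u)) = p"
    by auto
  have glue_inv: "glue J (restrict (\<lambda>j. nat \<lfloor>- v j\<rfloor>) ({1..r} - J)) (coord_proj J v) = v"
    and pos: "\<And>j. j \<in> {1..r} - J \<Longrightarrow> 1 \<le> nat \<lfloor>- v j\<rfloor>"
    if v: "v \<in> half_points J" for v
  proof -
    have v': "v \<in> coord_lattice {1..r}" "\<And>j. j \<in> {1..r} - J \<Longrightarrow> v j < 0"
      using v by (auto simp: half_points_def points_def)
    have int: "real_of_int \<lfloor>- v j\<rfloor> = - v j" for j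
      using v'(1) by (simp add: coord_lattice_def)
    show "1 \<le> nat \<lfloor>- v j\<rfloor>" if "j \<in> {1..r} - J" for j
      using v'(2)[OF that] int[of j] by linarith
    show "glue J (restrict (\<lambda>j. nat \<lfloor>- v j\<rfloor>) ({1..r} - J)) (coord_proj J v) = v"
    proof
      fix j
      show "glue J (restrict (\<lambda>j. nat \<lfloor>- v j\<rfloor>) ({1..r} - J)) (coord_proj J v) j = v j"
      proof (cases "j \<in> {1..r} - J")
        case True
        then have "real (nat \<lfloor>- v j\<rfloor>) = - v j" using v'(2)[OF True] int[of j] by linarith
        then show ?thesis using True by (simp add: glue_def)
      next
        case False
        then show ?thesis
          using v'(1) by (auto simp: glue_def coord_proj_def coord_lattice_def coord_space_def)
      qed
    qed
  qed
  then show "\<forall>v\<in>half_points J. (case (restrict (\<lambda>j. nat \<lfloor>- v j\<rfloor>) ({1..r} - J), coord_proj J v) of (m, u) \<Rightarrow> glue J m u) = v"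
    by simp
  show "(\<lambda>(m, u). glue J m u) ` Sigma (pos_tuples ({1..r} - J)) (slice J) \<subseteq> half_points J"
  proof
    fix v assume "v \<in> (\<lambda>(m, u). glue J m u) ` Sigma (pos_tuples ({1..r} - J)) (slice J)"
    then obtain m u where v: "v = glue J m u" and m: "m \<in> pos_tuples ({1..r} - J)" and u: "u \<in> slice J m"
      by auto
    have "glue J m u j < 0" if "j \<in> {1..r} - J" for j
      using that m by (auto simp: glue_def pos_tuples_def dest!: PiE_mem)
    then show "v \<in> half_points J" using u m by (simp add: v half_points_def slice_iff)
  qed
  show "(\<lambda>v. (restrict (\<lambda>j. nat \<lfloor>- v j\<rfloor>) ({1..r} - J), coord_proj J v)) ` half_points J
      \<subseteq> Sigma (pos_tuples ({1..r} - J)) (slice J)"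
  proof
    fix p assume "p \<in> (\<lambda>v. (restrict (\<lambda>j. nat \<lfloor>- v j\<rfloor>) ({1..r} - J), coord_proj J v)) ` half_points J"
    then obtain v where p: "p = (restrict (\<lambda>j. nat \<lfloor>- v j\<rfloor>) ({1..r} - J), coord_proj J v)"
      and v: "v \<in> half_points J" by blast
    have m: "restrict (\<lambda>j. nat \<lfloor>- v j\<rfloor>) ({1..r} - J) \<in> pos_tuples ({1..r} - J)"
      using pos[OF v] by (auto simp: pos_tuples_def)
    have "coord_proj J v \<in> coord_lattice J"
      using v by (auto simp: half_points_def points_def coord_proj_def coord_lattice_def coord_space_def)
    then show "p \<in> Sigma (pos_tuples ({1..r} - J)) (slice J)"
      using m glue_inv[OF v] v by (simp add: p slice_iff half_points_def)
  qed
qed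

definition outer_factor :: "(nat \<Rightarrow> real) \<Rightarrow> (nat \<Rightarrow> nat) \<Rightarrow> complex"
  where "outer_factor y m =
    (\<Prod>j\<in>{1..r}-J. expi (- of_real (real (m j) * y j)) / of_nat (m j) ^ h j) *
    (\<Prod>i\<in>{1..l}-rows_meeting l A J. 1 / of_nat (\<Sum>j\<in>{1..r}-J. A i j * m j) ^ k i)"

definition outer_sign :: complex
  where "outer_sign = (- 1) ^ ((\<Sum>j\<in>{1..r}-J. h j) + (\<Sum>i\<in>{1..l}-rows_meeting l A J. k i))"

abbreviation inner_term :: "(nat \<Rightarrow> real) \<Rightarrow> (nat \<Rightarrow> nat) \<Rightarrow> (nat \<Rightarrow> real) \<Rightarrow> complex"
  where "inner_term y m u \<equiv> char_at J (coord_proj J y) u *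
    (\<Prod>f\<in>Lambda_idx l A J. 1 / of_real (lin_form J (Lambda_fam r A J m) u f) ^ exponents J f)"

lemma inner_prod:
  fixes g :: "idx \<Rightarrow> nat \<Rightarrow> 'a :: comm_monoid_mult"
  shows "(\<Prod>f\<in>Lambda_idx l A J. g f (exponents J f))
    = (\<Prod>j\<in>J. g (Inl j) (h j)) * (\<Prod>i\<in>rows_meeting l A J. g (Inr i) (k i))"
  unfolding prod_Lambda_idx[OF finite_J]
  by (intro arg_cong2[where f = "(*)"] prod.cong refl) (auto simp: Lambda_idx_cases)

text \<open>Separates the factors that are constant on a slice. The sign comes from the negative
  coordinates outside J and from the negative rows that miss J; the remaining factors are those of
  the family for J.\<close>

lemma point_term_glue:
  assumes m: "m \<in> pos_tuples ({1..r} - J)"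
  shows "point_term y (glue J m u) = outer_sign * outer_factor y m * inner_term y m u"
proof -
  define I where "I = rows_meeting l A J"
  have I: "I \<subseteq> {1..l}" by (auto simp: I_def rows_meeting_def)
  have "coord_inner {1..r} y (glue J m u)
      = (\<Sum>j\<in>{1..r}-J. y j * glue J m u j) + (\<Sum>j\<in>J. y j * glue J m u j)"
    unfolding coord_inner_def by (rule sum.subset_diff[OF J(2)]) simp
  also have "(\<Sum>j\<in>J. y j * glue J m u j) = coord_inner J (coord_proj J y) u"
    unfolding coord_inner_def by (intro sum.cong) (auto simp: glue_def coord_proj_def)
  also have "(\<Sum>j\<in>{1..r}-J. y j * glue J m u j) = (\<Sum>j\<in>{1..r}-J. - (real (m j) * y j))"
    by (intro sum.cong) (auto simp: glue_def)
  finally have char: "char_at {1..r} y (glue J m u)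
      = (\<Prod>j\<in>{1..r}-J. expi (- of_real (real (m j) * y j))) * char_at J (coord_proj J y) u"
    by (simp add: char_at_def expi_add expi_sum)
  have "(\<Prod>j\<in>{1..r}. 1 / of_real (glue J m u j) ^ h j)
      = (\<Prod>j\<in>{1..r}-J. 1 / of_real (glue J m u j) ^ h j) * (\<Prod>j\<in>J. 1 / of_real (glue J m u j) ^ h j :: complex)"
    by (rule prod.subset_diff[OF J(2)]) simp
  also have "(\<Prod>j\<in>{1..r}-J. 1 / of_real (glue J m u j) ^ h j)
      = (- 1) ^ (\<Sum>j\<in>{1..r}-J. h j) * (\<Prod>j\<in>{1..r}-J. 1 / of_nat (m j) ^ h j :: complex)"
    unfolding power_sum prod.distrib[symmetric]
    by (intro prod.cong refl) (auto simp: glue_def inverse_power_minus)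
  finally have hs: "(\<Prod>j\<in>{1..r}. 1 / of_real (glue J m u j) ^ h j)
      = (- 1) ^ (\<Sum>j\<in>{1..r}-J. h j) * (\<Prod>j\<in>{1..r}-J. 1 / of_nat (m j) ^ h j) *
        (\<Prod>j\<in>J. 1 / of_real (glue J m u j) ^ h j :: complex)" .
  have "(\<Prod>i\<in>{1..l}. 1 / of_real (row i (glue J m u)) ^ k i)
      = (\<Prod>i\<in>{1..l}-I. 1 / of_real (row i (glue J m u)) ^ k i) * (\<Prod>i\<in>I. 1 / of_real (row i (glue J m u)) ^ k i :: complex)"
    by (rule prod.subset_diff[OF I]) simp
  also have "(\<Prod>i\<in>{1..l}-I. 1 / of_real (row i (glue J m u)) ^ k i)
      = (- 1) ^ (\<Sum>i\<in>{1..l}-I. k i) * (\<Prod>i\<in>{1..l}-I. 1 / of_nat (\<Sum>j\<in>{1..r}-J. A i j * m j) ^ k i :: complex)"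
    unfolding power_sum prod.distrib[symmetric] I_def
    by (intro prod.cong refl) (simp only: row_glue_other(1)[OF m] of_real_minus of_real_of_nat_eq inverse_power_minus)
  finally have ks: "(\<Prod>i\<in>{1..l}. 1 / of_real (row i (glue J m u)) ^ k i)
      = (- 1) ^ (\<Sum>i\<in>{1..l}-I. k i) * (\<Prod>i\<in>{1..l}-I. 1 / of_nat (\<Sum>j\<in>{1..r}-J. A i j * m j) ^ k i) *
        (\<Prod>i\<in>I. 1 / of_real (row i (glue J m u)) ^ k i :: complex)" .
  have inner: "(\<Prod>f\<in>Lambda_idx l A J. 1 / of_real (lin_form J (Lambda_fam r A J m) u f) ^ exponents J f)
      = (\<Prod>j\<in>J. 1 / of_real (glue J m u j) ^ h j) * (\<Prod>i\<in>I. 1 / of_real (row i (glue J m u)) ^ k i :: complex)"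
    unfolding inner_prod[of "\<lambda>f n. 1 / of_real (lin_form J (Lambda_fam r A J m) u f) ^ n"] I_def
    by (simp add: lin_form_Inl lin_form_Inr)
  have split: "(\<Prod>j\<in>{1..r}-J. expi (- of_real (real (m j) * y j)) / of_nat (m j) ^ h j)
      = (\<Prod>j\<in>{1..r}-J. expi (- of_real (real (m j) * y j))) * (\<Prod>j\<in>{1..r}-J. 1 / of_nat (m j) ^ h j)"
    unfolding prod.distrib[symmetric] by simp
  show ?thesis
    unfolding point_term_def char hs ks inner outer_sign_def outer_factor_def split power_add I_def[symmetric]
    by (simp only: mult_ac)
qed

lemma outer_factor_nonzero:
  assumes m: "m \<in> pos_tuples ({1..r} - J)"
  shows "outer_factor y m \<noteq> 0"
proof -
  have "m j > 0" if "j \<in> {1..r} - J" for j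
    using m that by (auto simp: pos_tuples_def dest!: PiE_mem)
  moreover have "of_nat (\<Sum>j\<in>{1..r}-J. A i j * m j) \<noteq> (0 :: complex)" if "i \<in> {1..l}-rows_meeting l A J" for i
    using row_glue_other(2)[OF m that] by (simp only: of_nat_eq_0_iff)
  ultimately show ?thesis
    unfolding outer_factor_def by (auto simp: prod_zero_iff simp del: of_nat_sum of_nat_mult)
qed

text \<open>The glued slice lies in \<open>points\<close>, where the majorant is summable, and on it
  the majorant is a nonzero constant times the series in question.\<close>

lemma absolutely_convergent_slice:
  assumes m: "m \<in> pos_tuples ({1..r} - J)"
  shows "lattice_family.absolutely_convergent J (Lambda_idx l A J) (Lambda_fam r A J m) (exponents J)"
proof -
  interpret lattice_family J "Lambda_idx l A J" "Lambda_fam r A J m"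
    by (rule lattice_family_Lambda[OF finite_J])
  have "inj_on (glue J m) (slice J m)"
  proof (rule inj_onI)
    fix u u' assume "u \<in> slice J m" "u' \<in> slice J m" "glue J m u = glue J m u'"
    then have "(m, u) = (m, u')"
      using bij_betw_imp_inj_on[OF bij_glue] m by (intro inj_onD[of "\<lambda>(m, u). glue J m u"]) auto
    then show "u = u'" by simp
  qed
  moreover have "majorant summable_on glue J m ` slice J m"
    by (rule summable_on_subset_banach[OF majorant_summable]) (use m in \<open>auto simp: slice_iff\<close>)
  ultimately have "(\<lambda>u. majorant (glue J m u)) summable_on slice J m"
    by (simp add: summable_on_reindex o_def)
  \<comment> \<open>The modulus does not depend on the character, so the constant may be taken at y
    = 0.\<close>
  moreover have "majorant (glue J m u) = norm (outer_factor 0 m) *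
      (\<Prod>f\<in>Lambda_idx l A J. 1 / \<bar>lin_form J (Lambda_fam r A J m) u f\<bar> ^ exponents J f)" for u
    unfolding norm_point_term[of 0, symmetric] point_term_glue[OF m]
    by (simp add: norm_mult norm_divide norm_power outer_sign_def char_at_def flip: prod_norm)
  ultimately have "(\<lambda>u. norm (outer_factor 0 m) *
      (\<Prod>f\<in>Lambda_idx l A J. 1 / \<bar>lin_form J (Lambda_fam r A J m) u f\<bar> ^ exponents J f)) summable_on slice J m"
    by simp
  then have "(\<lambda>u. \<Prod>f\<in>Lambda_idx l A J. 1 / \<bar>lin_form J (Lambda_fam r A J m) u f\<bar> ^ exponents J f) summable_on slice J m"
    using outer_factor_nonzero[OF m] by (simp add: summable_on_cmult_right')
  moreover have "exponents J f \<ge> 1" if "f \<in> Lambda_idx l A J" for f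
    using that h_pos k_pos J(2) by (auto simp: Lambda_idx_cases rows_meeting_def)
  ultimately show ?thesis by (simp add: absolutely_convergent_def)
qed

text \<open>\<open>D_coeff_eq\<close> supplies the factorials, which cancel those in T, and the sign
  \<open>(- 1) ^ card (Lambda_idx l A J)\<close>. The factor \<open>outer_sign\<close> enters
  because \<open>point_term\<close> contains it and \<open>outer_factor\<close> does not; its square
  is 1.\<close>

lemma T_term_eq:
  assumes m: "m \<in> pos_tuples ({1..r} - J)"
    and \<rho>: "generic J (Lambda_idx l A J) (Lambda_fam r A J m) (\<rho> m)"
  shows "T_term r l J h k y A \<rho> m
    = outer_sign * (- 1) ^ (card J + card (rows_meeting l A J)) * (\<Sum>\<^sub>\<infinity>u\<in>slice J m. point_term y (glue J m u))"
proof -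
  interpret lattice_family J "Lambda_idx l A J" "Lambda_fam r A J m"
    by (rule lattice_family_Lambda[OF finite_J])
  have n: "exponents J \<in> multi_indices (Lambda_idx l A J)" by (simp add: multi_indices_def)
  have card: "card (Lambda_idx l A J) = card J + card (rows_meeting l A J)"
    unfolding Lambda_idx_def by (rule card_Plus[OF finite_J finite_rows_meeting])
  have fact: "(\<Prod>f\<in>Lambda_idx l A J. fact (exponents J f)) * ((\<Prod>j\<in>J. 1 / fact (h j)) * (\<Prod>i\<in>rows_meeting l A J. 1 / fact (k i))) = (1 :: complex)"
    unfolding inner_prod[of "\<lambda>f. fact"] using finite_J finite_rows_meeting by (simp add: prod_dividef)
  define S where "S = lattice_sum (coord_proj J y) (exponents J)"
  have S: "(\<Sum>\<^sub>\<infinity>u\<in>slice J m. point_term y (glue J m u)) = outer_sign * outer_factor y m * S"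
    unfolding S_def lattice_sum_def point_term_glue[OF m] by (rule infsum_cmult_right')
  have sign: "outer_sign * outer_sign = 1"
    unfolding outer_sign_def by (simp flip: power_add)
  have "T_term r l J h k y A \<rho> m = outer_factor y m *
      D_coeff J (Lambda_idx l A J) (Lambda_fam r A J m) (\<rho> m) (coord_proj J y) (exponents J) *
      ((\<Prod>j\<in>J. 1 / fact (h j)) * (\<Prod>i\<in>rows_meeting l A J. 1 / fact (k i)))"
    by (simp add: T_term_def Let_def outer_factor_def mult.assoc)
  also have "\<dots> = outer_factor y m * ((- 1) ^ card (Lambda_idx l A J) * S) * ((\<Prod>f\<in>Lambda_idx l A J. fact (exponents J f)) * ((\<Prod>j\<in>J. 1 / fact (h j)) * (\<Prod>i\<in>rows_meeting l A J. 1 / fact (k i))))"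
    unfolding D_coeff_eq[OF \<rho> n absolutely_convergent_slice[OF m]] S_def by (simp only: mult_ac)
  also have "\<dots> = outer_factor y m * ((- 1) ^ (card J + card (rows_meeting l A J)) * S)"
    unfolding fact card by simp
  also have "\<dots> = (outer_sign * outer_sign) * outer_factor y m * ((- 1) ^ (card J + card (rows_meeting l A J)) * S)"
    by (simp add: sign)
  finally show ?thesis unfolding S by (simp only: mult_ac)
qed

text \<open>Absolute convergence over \<open>half_points J\<close> allows summation slice by slice.
  The sign in the definition of T cancels \<open>outer_sign\<close> and the power with
  \<open>card (rows_meeting l A J)\<close>, which leaves the sign of J in
  \<open>inclusion_exclusion\<close>.\<close>

lemma T_sum_eq:
  assumes \<rho>: "\<And>m. m \<in> pos_tuples ({1..r} - J) \<Longrightarrow> generic J (Lambda_idx l A J) (Lambda_fam r A J m) (\<rho> m)"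
  shows "T_term r l J h k y A \<rho> summable_on pos_tuples ({1..r} - J)"
    and "T_sum r l J h k y A \<rho> = (- 1) ^ (r + card J) * infsum (point_term y) (half_points J)"
proof -
  define s where "s = outer_sign * (- 1) ^ (card J + card (rows_meeting l A J))"
  have summ: "(\<lambda>(m, u). point_term y (glue J m u)) summable_on Sigma (pos_tuples ({1..r} - J)) (slice J)"
  proof -
    have "point_term y summable_on half_points J" by (rule point_term_summable) (auto simp: half_points_def)
    then show ?thesis
      using summable_on_reindex_bij_betw[OF bij_glue, of "point_term y"] by (simp add: case_prod_unfold)
  qed
  have "(\<lambda>m. \<Sum>\<^sub>\<infinity>u\<in>slice J m. point_term y (glue J m u)) summable_on pos_tuples ({1..r} - J)"
    using summable_on_Sigma_banach[OF summ] by simp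
  then have "(\<lambda>m. s * (\<Sum>\<^sub>\<infinity>u\<in>slice J m. point_term y (glue J m u))) summable_on pos_tuples ({1..r} - J)"
    by (rule summable_on_cmult_right)
  then show "T_term r l J h k y A \<rho> summable_on pos_tuples ({1..r} - J)"
    unfolding s_def by (subst summable_on_cong[OF T_term_eq]) (use \<rho> in auto)
  have "infsum (T_term r l J h k y A \<rho>) (pos_tuples ({1..r} - J))
      = infsum (\<lambda>m. s * (\<Sum>\<^sub>\<infinity>u\<in>slice J m. point_term y (glue J m u))) (pos_tuples ({1..r} - J))"
    unfolding s_def by (intro infsum_cong T_term_eq) (use \<rho> in auto)
  also have "\<dots> = s * infsum (\<lambda>m. \<Sum>\<^sub>\<infinity>u\<in>slice J m. point_term y (glue J m u)) (pos_tuples ({1..r} - J))"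
    by (rule infsum_cmult_right')
  also have "infsum (\<lambda>m. \<Sum>\<^sub>\<infinity>u\<in>slice J m. point_term y (glue J m u)) (pos_tuples ({1..r} - J))
      = infsum (\<lambda>(m, u). point_term y (glue J m u)) (Sigma (pos_tuples ({1..r} - J)) (slice J))"
    using infsum_Sigma'_banach[OF summ] by simp
  also have "\<dots> = infsum (point_term y) (half_points J)"
    using infsum_reindex_bij_betw[OF bij_glue, of "point_term y"] by (simp add: case_prod_unfold)
  finally have T: "infsum (T_term r l J h k y A \<rho>) (pos_tuples ({1..r} - J)) = s * infsum (point_term y) (half_points J)" .
  have "(- 1) ^ ((\<Sum>j\<in>{1..r} - J. h j) + (\<Sum>i\<in>{1..l} - rows_meeting l A J. k i) + r + card (rows_meeting l A J)) * s
      = outer_sign * outer_sign * ((- 1) ^ (r + card J) * ((- 1) ^ card (rows_meeting l A J) * (- 1) ^ card (rows_meeting l A J)))"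
    unfolding s_def outer_sign_def by (simp only: power_add mult_ac)
  also have "\<dots> = (- 1) ^ (r + card J)"
    unfolding outer_sign_def by (simp flip: power_add)
  finally show "T_sum r l J h k y A \<rho> = (- 1) ^ (r + card J) * infsum (point_term y) (half_points J)"
    unfolding T_sum_def Let_def T by (simp only: mult.assoc[symmetric])
qed

end

end

text \<open>An \<open>infsum\<close> is 0 by default where it does not converge, so the summability
  clause shows that the outer sums in T are genuine. The identity is
  \<open>inclusion_exclusion\<close> with the term of the empty set, a multiple of the zeta value at
  - y, moved to the left.\<close>

theorem theorem2p1:
  fixes r l :: nat
    and A :: "nat \<Rightarrow> nat \<Rightarrow> nat"
    and h k :: "nat \<Rightarrow> nat"
    and y :: "nat \<Rightarrow> real"
    and \<rho> :: "nat set \<Rightarrow> (nat \<Rightarrow> nat) \<Rightarrow> nat \<Rightarrow> real"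
  assumes "r \<ge> 1" and "l \<ge> 1"
    and no_zero_row: "\<forall>i\<in>{1..l}. \<exists>j\<in>{1..r}. A i j \<noteq> 0"
    and no_zero_column: "\<forall>j\<in>{1..r}. \<exists>i\<in>{1..l}. A i j \<noteq> 0"
    and h_pos: "\<forall>j\<in>{1..r}. h j \<ge> 1"
    and k_pos: "\<forall>i\<in>{1..l}. k i \<ge> 1"
    and convergence: "\<forall>J. J \<subseteq> {1..r} \<longrightarrow>
      (\<lambda>m. (\<Prod>j\<in>{1..r}. 1 / real (m j) ^ h j) *
            (\<Prod>i\<in>{1..l}. 1 / \<bar>signed_form r A J i m\<bar> ^ k i))
        summable_on {m \<in> pos_tuples {1..r}. \<forall>i\<in>{1..l}. signed_form r A J i m \<noteq> 0}"
    and rho: "\<forall>J m. J \<noteq> {} \<and> J \<subseteq> {1..r} \<and> m \<in> pos_tuples ({1..r} - J) \<longrightarrow>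
      generic J (Lambda_idx l A J) (Lambda_fam r A J m) (\<rho> J m)"
  shows "(\<forall>J. J \<noteq> {} \<and> J \<subseteq> {1..r} \<longrightarrow>
            T_term r l J h k y A (\<rho> J) summable_on pos_tuples ({1..r} - J)) \<and>
         zeta_rl r l h k y A
           + (-1) ^ ((\<Sum>j\<in>{1..r}. h j) + (\<Sum>i\<in>{1..l}. k i) + r + 1)
             * zeta_rl r l h k (\<lambda>j. - y j) A
         = (\<Sum>J\<in>{J. J \<noteq> {} \<and> J \<subseteq> {1..r}}. T_sum r l J h k y A (\<rho> J))"
proof -
  interpret parity_data r l A h k
    by unfold_locales (fact no_zero_row h_pos k_pos convergence)+
  define E where "E J = (- 1) ^ (r + card J) * infsum (point_term y) (half_points J)" for J
  have Pow_eq: "Pow {1..r} = insert {} {J. J \<noteq> {} \<and> J \<subseteq> {1..r}}" by auto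
  have fin: "finite {J. J \<noteq> {} \<and> J \<subseteq> {1..r}}"
    by (rule finite_subset[of _ "Pow {1..r}"]) auto
  have "zeta_rl r l h k y A = (\<Sum>J\<in>Pow {1..r}. E J)"
    unfolding E_def inclusion_exclusion by (rule orthant_full_eq_zeta[symmetric])
  also have "\<dots> = E {} + (\<Sum>J\<in>{J. J \<noteq> {} \<and> J \<subseteq> {1..r}}. E J)"
    unfolding Pow_eq by (rule sum.insert[OF fin]) simp
  also have "(\<Sum>J\<in>{J. J \<noteq> {} \<and> J \<subseteq> {1..r}}. E J) = (\<Sum>J\<in>{J. J \<noteq> {} \<and> J \<subseteq> {1..r}}. T_sum r l J h k y A (\<rho> J))"
  proof (rule sum.cong[OF refl])
    fix J assume "J \<in> {J. J \<noteq> {} \<and> J \<subseteq> {1..r}}"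
    then show "E J = T_sum r l J h k y A (\<rho> J)"
      unfolding E_def using rho by (intro T_sum_eq(2)[symmetric]) auto
  qed
  also have "E {} = - ((-1) ^ ((\<Sum>j\<in>{1..r}. h j) + (\<Sum>i\<in>{1..l}. k i) + r + 1) * zeta_rl r l h k (\<lambda>j. - y j) A)"
    unfolding E_def half_points_empty_eq_zeta by (simp add: power_add)
  finally have "zeta_rl r l h k y A
           + (-1) ^ ((\<Sum>j\<in>{1..r}. h j) + (\<Sum>i\<in>{1..l}. k i) + r + 1)
             * zeta_rl r l h k (\<lambda>j. - y j) A
         = (\<Sum>J\<in>{J. J \<noteq> {} \<and> J \<subseteq> {1..r}}. T_sum r l J h k y A (\<rho> J))"
    by simp
  moreover have "T_term r l J h k y A (\<rho> J) summable_on pos_tuples ({1..r} - J)"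
    if "J \<noteq> {} \<and> J \<subseteq> {1..r}" for J
    using that rho by (intro T_sum_eq(1)) auto
  ultimately show ?thesis by blast
qed

end
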